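(* Let $G$ be a countable discrete amenable group acting on a compact metric group $X$ by continuous automorphisms. Then the action $(X, G)$ is asymptotically $h$-expansive if and only if $h^a (G, X)< \infty$.
   Context: Setting: $G$ is a countable discrete amenable group (hence sofic), with a fixed sofic approximation $\Sigma=\{\sigma_i: G \rightarrow \mathrm{Sym}(d_i),\ g\mapsto \sigma_{i, g}\}_{i\in \mathbb{N}}$, where $d_i\in\mathbb{N}$, $d_i\to\infty$, $\mathrm{Sym}(d)$ is the permutation group of $\{1,\dots,d\}$, and $\lim_{i} \frac{1}{d_i} |\{a: \sigma_{i,s}\sigma_{i,t}(a)=\sigma_{i,st}(a)\}|=1$ for all $s,t\in G$, $\lim_{i} \frac{1}{d_i} |\{a: \sigma_{i,s}(a)\neq \sigma_{i,t}(a)\}|=1$ for all distinct $s,t\in G$. A compact metric group is a compact topological group whose topology is given by a metric $\rho$. $\mathcal{C}_X$ and $\mathcal{C}_X^o$ are the sets of finite Borel covers and of finite open covers of $X$. For a cover $\mathcal{V}$ and a set $K$, $N(\mathcal{V},K)$ is the minimal cardinality of sub-families of $\mathcal{V}$ covering $K$ ($N(\mathcal{V},\emptyset)=0$). For $\mathcal{U}\in\mathcal{C}_X$, $\mathcal{U}^d$ is the cover of $X^d$ consisting of all products $U_1\times\cdots\times U_d$ with $U_j\in\mathcal{U}$. Convention: $\log 0=-\infty$. $\mathfrak{F}_G$ is the set of non-empty finite subsets of $G$. Sofic notions: for $F\in\mathfrak{F}_G$, $\delta>0$, $\sigma:G\to\mathrm{Sym}(d)$, put $$X^d_{F,\delta,\sigma}=\left\{(x_1,\dots,x_d)\in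 X^d:\max_{s\in F}\sqrt{\sum_{j=1}^d\frac1d\rho^2(sx_j,x_{\sigma_s(j)})}<\delta\right\}.$$ For $\mathcal{U}_1,\mathcal{U}_2\in\mathcal{C}_X$ define $$h(G,\mathcal{U}_1|\mathcal{U}_2)=\inf_{F\in\mathfrak{F}_G}\inf_{\delta>0}\limsup_{i\to\infty}\frac1{d_i}\log\max_{V\in\mathcal{U}_2^{d_i}}N\left(\mathcal{U}_1^{d_i},X^{d_i}_{F,\delta,\sigma_i}\cap V\right),$$ $h(G,X|\mathcal{U}_2)=\sup_{\mathcal{U}_1\in\mathcal{C}_X^o}h(G,\mathcal{U}_1|\mathcal{U}_2)$ and $h^*(G,X)=\inf_{\mathcal{U}_2\in\mathcal{C}_X^o}h(G,X|\mathcal{U}_2)$. $(X,G)$ is asymptotically $h$-expansive if $h^*(G,X)\le0$. Amenable topological entropy: for $\mathcal{W}\in\mathcal{C}_X$ and $F\in\mathfrak{F}_G$, $\mathcal{W}_F=\bigvee_{g\in F}g^{-1}\mathcal{W}$, where the join of covers is the family of all intersections of one element from each. Then $h^a(G,\mathcal{W})=\lim_{n\to\infty}\frac1{|F_n|}\log N(\mathcal{W}_{F_n},X)$, where $\{F_n\}\subset\mathfrak{F}_G$ is a Følner sequence ($|gF_n\Delta F_n|/|F_n|\to0$ for all $g\in G$); the limit exists and is independent of the Følner sequence by the Ornstein–Weiss lemma. The topological entropy is $h^a(G,X)=\sup_{\mathcal{U}\in\mathcal{C}_X^o}h^a(G,\mathcal{U})$. *)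

theory Defs
  imports "HOL-Analysis.Analysis" "HOL-Combinatorics.Permutations"
begin

(* Both the acting group and the space are type-class groups.  group_add is written additively
   but is NOT assumed commutative: in the acting group s + t, - s, 0 stand for st, s^-1, e. *)

section \<open>Amenability and sofic approximations\<close>

definition folner :: "(nat \<Rightarrow> 'g::group_add set) \<Rightarrow> bool" where
  "folner F \<longleftrightarrow> (\<forall>n. finite (F n) \<and> F n \<noteq> {}) \<and>
     (\<forall>g. (\<lambda>n. real (card (sym_diff ((+) g ` F n) (F n))) / real (card (F n))) \<longlonglongrightarrow> 0)"

definition amenable :: "'g::group_add itself \<Rightarrow> bool" where
  "amenable _ \<longleftrightarrow> (\<exists>F :: nat \<Rightarrow> 'g set. folner F)"

definition sofic_approximation :: "(nat \<Rightarrow> nat) \<Rightarrow> (nat \<Rightarrow> 'g::group_add \<Rightarrow> nat \<Rightarrow> nat) \<Rightarrow> bool" where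
  "sofic_approximation d \<sigma> \<longleftrightarrow>
     filterlim d at_top sequentially \<and>
     (\<forall>i g. \<sigma> i g permutes {1..d i}) \<and>
     (\<forall>s t. (\<lambda>i. real (card {a \<in> {1..d i}. \<sigma> i s (\<sigma> i t a) = \<sigma> i (s + t) a}) / real (d i)) \<longlonglongrightarrow> 1) \<and>
     (\<forall>s t. s \<noteq> t \<longrightarrow>
        (\<lambda>i. real (card {a \<in> {1..d i}. \<sigma> i s a \<noteq> \<sigma> i t a}) / real (d i)) \<longlonglongrightarrow> 1)"

definition acts_by_continuous_automorphisms ::
    "('g::group_add \<Rightarrow> 'x::{metric_space, topological_group_add} \<Rightarrow> 'x) \<Rightarrow> bool" where
  "acts_by_continuous_automorphisms \<alpha> \<longleftrightarrow>
     \<alpha> 0 = id \<and> (\<forall>s t. \<alpha> (s + t) = \<alpha> s \<circ> \<alpha> t) \<and>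
     (\<forall>s. continuous_on UNIV (\<alpha> s) \<and> (\<forall>x y. \<alpha> s (x + y) = \<alpha> s x + \<alpha> s y))"

section \<open>Covers\<close>

definition open_covers :: "'x::topological_space set set set" where
  "open_covers = {\<U>. finite \<U> \<and> (\<forall>U\<in>\<U>. open U) \<and> \<Union>\<U> = UNIV}"

definition cov_num :: "'y set set \<Rightarrow> 'y set \<Rightarrow> nat" where
  "cov_num \<V> K = (LEAST n. \<exists>\<W>\<subseteq>\<V>. finite \<W> \<and> card \<W> = n \<and> K \<subseteq> \<Union>\<W>)"

(* The real ln 0 is 0 in HOL; the entropies use the convention log 0 = -infinity. *)
definition log_nat :: "nat \<Rightarrow> ereal" where
  "log_nat n = (if n = 0 then -\<infinity> else ereal (ln (real n)))"

(* A point of X^d is an extensional function on {1..d}. *)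
definition power_cover :: "nat \<Rightarrow> 'x set set \<Rightarrow> (nat \<Rightarrow> 'x) set set" where
  "power_cover d \<U> = {Pi\<^sub>E {1..d} U | U. \<forall>j\<in>{1..d}. U j \<in> \<U>}"

definition join_cover :: "'i set \<Rightarrow> ('i \<Rightarrow> 'x set set) \<Rightarrow> 'x set set" where
  "join_cover I \<V> = {\<Inter>i\<in>I. V i | V. \<forall>i\<in>I. V i \<in> \<V> i}"

section \<open>Sofic tail entropy and asymptotic h-expansiveness\<close>

definition sofic_orbits :: "('g \<Rightarrow> 'x::metric_space \<Rightarrow> 'x) \<Rightarrow> 'g set \<Rightarrow> real \<Rightarrow>
    nat \<Rightarrow> ('g \<Rightarrow> nat \<Rightarrow> nat) \<Rightarrow> (nat \<Rightarrow> 'x) set" where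
  "sofic_orbits \<alpha> F \<delta> d \<tau> = {x \<in> {1..d} \<rightarrow>\<^sub>E UNIV.
     (MAX s\<in>F. sqrt (\<Sum>j=1..d. 1 / real d * (dist (\<alpha> s (x j)) (x (\<tau> s j)))\<^sup>2)) < \<delta>}"

definition cond_entropy_cover :: "(nat \<Rightarrow> nat) \<Rightarrow> (nat \<Rightarrow> 'g \<Rightarrow> nat \<Rightarrow> nat) \<Rightarrow>
    ('g \<Rightarrow> 'x::metric_space \<Rightarrow> 'x) \<Rightarrow> 'x set set \<Rightarrow> 'x set set \<Rightarrow> ereal" where
  "cond_entropy_cover d \<sigma> \<alpha> \<U>\<^sub>1 \<U>\<^sub>2 =
     (INF F\<in>{F. finite F \<and> F \<noteq> {}}. INF \<delta>\<in>{0<..}.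
        limsup (\<lambda>i. ereal (1 / real (d i)) *
          log_nat (MAX V\<in>power_cover (d i) \<U>\<^sub>2.
            cov_num (power_cover (d i) \<U>\<^sub>1) (sofic_orbits \<alpha> F \<delta> (d i) (\<sigma> i) \<inter> V))))"

definition cond_entropy :: "(nat \<Rightarrow> nat) \<Rightarrow> (nat \<Rightarrow> 'g \<Rightarrow> nat \<Rightarrow> nat) \<Rightarrow>
    ('g \<Rightarrow> 'x::metric_space \<Rightarrow> 'x) \<Rightarrow> 'x set set \<Rightarrow> ereal" where
  "cond_entropy d \<sigma> \<alpha> \<U>\<^sub>2 = (SUP \<U>\<^sub>1\<in>open_covers. cond_entropy_cover d \<sigma> \<alpha> \<U>\<^sub>1 \<U>\<^sub>2)"

definition tail_entropy :: "(nat \<Rightarrow> nat) \<Rightarrow> (nat \<Rightarrow> 'g \<Rightarrow> nat \<Rightarrow> nat) \<Rightarrow>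
    ('g \<Rightarrow> 'x::metric_space \<Rightarrow> 'x) \<Rightarrow> ereal" where
  "tail_entropy d \<sigma> \<alpha> = (INF \<U>\<^sub>2\<in>open_covers. cond_entropy d \<sigma> \<alpha> \<U>\<^sub>2)"

definition asymptotically_h_expansive :: "(nat \<Rightarrow> nat) \<Rightarrow> (nat \<Rightarrow> 'g \<Rightarrow> nat \<Rightarrow> nat) \<Rightarrow>
    ('g \<Rightarrow> 'x::metric_space \<Rightarrow> 'x) \<Rightarrow> bool" where
  "asymptotically_h_expansive d \<sigma> \<alpha> \<longleftrightarrow> tail_entropy d \<sigma> \<alpha> \<le> 0"

section \<open>Amenable topological entropy\<close>

definition dyn_cover :: "('g \<Rightarrow> 'x \<Rightarrow> 'x) \<Rightarrow> 'g set \<Rightarrow> 'x set set \<Rightarrow> 'x set set" where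
  "dyn_cover \<alpha> F \<W> = join_cover F (\<lambda>g. (\<lambda>W. \<alpha> g -` W) ` \<W>)"

(* The common limit along all Folner sequences.  For an action of an amenable group and a
   cover of a non-empty space, the Ornstein-Weiss lemma makes this description proper. *)
definition amenable_entropy_cover ::
    "('g::group_add \<Rightarrow> 'x \<Rightarrow> 'x) \<Rightarrow> 'x set set \<Rightarrow> ereal" where
  "amenable_entropy_cover \<alpha> \<W> = (THE h. \<forall>F. folner F \<longrightarrow>
     (\<lambda>n. ereal (1 / real (card (F n))) * log_nat (cov_num (dyn_cover \<alpha> (F n) \<W>) UNIV))
       \<longlonglongrightarrow> h)"

definition amenable_entropy :: "('g::group_add \<Rightarrow> 'x::topological_space \<Rightarrow> 'x) \<Rightarrow> ereal" where
  "amenable_entropy \<alpha> = (SUP \<U>\<in>open_covers. amenable_entropy_cover \<alpha> \<U>)"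

end

theory Submission
  imports Defs
begin

text \<open>The number of points of \<open>X\<^sup>d\<close> that are close to sofic orbits and \<open>\<epsilon>\<close>-separated in some
  coordinate grows, along every sofic approximation, at the exponential rate of the amenable
  entropy. The reason is that \<open>{1..d}\<close> is almost covered by almost disjoint copies of Folner sets
  (a greedy quasi-tiling). A sofic orbit is determined up to small errors by its values at the
  centres of the tiles, which bounds the number from above; conversely, true orbit segments can be
  chosen independently on the disjoint parts of the tiles, which bounds it from below. The same
  quasi-tilings, applied to Folner sets instead of \<open>{1..d}\<close>, give the Ornstein-Weiss limit.

  A finite tail entropy thus bounds the entropy, as \<open>\<U>\<^sub>2\<close>-cells contribute at most \<open>card \<U>\<^sub>2\<close> per
  coordinate. For the converse, let \<open>y\<close> lie in a fine cell and let \<open>x\<close> run over a separated set of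
  sofic orbits in that cell and \<open>z\<close> over a coarsely separated set of sofic orbits. Since the action
  is by automorphisms, the points \<open>x - y + z\<close> are again close to sofic orbits, and they are
  pairwise separated. Hence the growth rate inside one cell plus the growth rate at the coarse scale
  is at most the entropy, and the latter rate is already almost all of it.\<close>

section \<open>Quasi-tilings of approximate actions\<close>

text \<open>The tilings are built in an abstract finite model \<open>D\<close> on which the group
  law is exact at the points of a large part \<open>D0\<close>. The obstacle in the converse is the
  order of quantifiers: one cover \<open>\<U>\<^sub>2\<close> has to serve every
  \<open>\<U>\<^sub>1\<close>. It is therefore derived from a single coarse scale at which the
  entropy is within a fraction of \<open>\<kappa>\<close> of its supremum; such a scale exists
  because the supremum is finite. A finer \<open>\<U>\<^sub>1\<close> only changes the scale at
  which the points x - y + z are counted, and at every scale their number is bounded through the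
  same supremum. The points stay separated because w = x - y + z can be undone: w - z + y = x, in
  this order, as the group may be non-commutative. Closeness to sofic orbits is a mean-square
  condition. It is turned into a bound on the number of bad coordinates and back, so all estimates
  are counts.\<close>

definition approx_action ::
    "'g::group_add set \<Rightarrow> 'd set \<Rightarrow> ('g \<Rightarrow> 'd \<Rightarrow> 'd) \<Rightarrow> 'd set \<Rightarrow> bool" where
  "approx_action T D \<tau> D0 \<longleftrightarrow> finite D \<and> D0 \<subseteq> D \<and> (\<forall>s. inj_on (\<tau> s) D) \<and>
     (\<forall>a\<in>D0. \<tau> 0 a = a \<and> (\<forall>s\<in>T. \<tau> s a \<in> D) \<and> inj_on (\<lambda>s. \<tau> s a) T \<and>
        (\<forall>s\<in>T. \<forall>t\<in>T. \<tau> s (\<tau> t a) = \<tau> (s + t) a))"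

lemma approx_action_mono:
  "approx_action T' D \<tau> D0 \<Longrightarrow> T \<subseteq> T' \<Longrightarrow> approx_action T D \<tau> D0"
  unfolding approx_action_def by (blast intro: inj_on_subset)

text \<open>A tile \<open>(c, F, A)\<close> is the translate of the shape \<open>F\<close> at the centre \<open>c\<close>; its core is
  the part \<open>A\<close> that no earlier tile had covered. The cores are disjoint and have the same union
  as the full tiles. The union of the full tiles is as invariant as the shapes are, which would
  not be visible from the cores.\<close>

type_synonym ('d, 'g) tile = "'d \<times> 'g set \<times> 'g set"

definition tile :: "('g \<Rightarrow> 'd \<Rightarrow> 'd) \<Rightarrow> ('d, 'g) tile \<Rightarrow> 'd set" where
  "tile \<tau> = (\<lambda>(c, F, A). (\<lambda>s. \<tau> s c) ` F)"

definition core :: "('g \<Rightarrow> 'd \<Rightarrow> 'd) \<Rightarrow> ('d, 'g) tile \<Rightarrow> 'd set" where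
  "core \<tau> = (\<lambda>(c, F, A). (\<lambda>s. \<tau> s c) ` A)"

definition covered :: "('g \<Rightarrow> 'd \<Rightarrow> 'd) \<Rightarrow> ('d, 'g) tile set \<Rightarrow> 'd set" where
  "covered \<tau> P = (\<Union>p\<in>P. core \<tau> p)"

definition quasi_tiling ::
    "real \<Rightarrow> ('g \<Rightarrow> 'd \<Rightarrow> 'd) \<Rightarrow> 'd set \<Rightarrow> 'g set \<Rightarrow> ('d, 'g) tile set \<Rightarrow> bool" where
  "quasi_tiling \<epsilon> \<tau> D0 T P \<longleftrightarrow> finite P \<and>
     (\<forall>(c, F, A)\<in>P. c \<in> D0 \<and> finite F \<and> F \<noteq> {} \<and> F \<subseteq> T \<and> A \<subseteq> F \<and>
        (1 - \<epsilon>) * real (card F) \<le> real (card A)) \<and>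
     disjoint_family_on (core \<tau>) P \<and> (\<Union>p\<in>P. tile \<tau> p) \<subseteq> covered \<tau> P"

lemma quasi_tiling_tile:
  assumes "quasi_tiling \<epsilon> \<tau> D0 T P" "(c, F, A) \<in> P"
  shows "c \<in> D0" "finite F" "F \<noteq> {}" "F \<subseteq> T" "A \<subseteq> F" "(1 - \<epsilon>) * real (card F) \<le> real (card A)"
  using assms unfolding quasi_tiling_def by auto

lemma covered_tile:
  assumes "quasi_tiling \<epsilon> \<tau> D0 T P"
  shows "x \<in> covered \<tau> P \<longleftrightarrow> (\<exists>(c, F, A)\<in>P. \<exists>s\<in>F. x = \<tau> s c)"
proof
  assume "x \<in> covered \<tau> P"
  then obtain c F A s where "(c, F, A) \<in> P" "s \<in> A" "x = \<tau> s c"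
    unfolding covered_def core_def by auto
  with quasi_tiling_tile(5)[OF assms this(1)] show "\<exists>(c, F, A)\<in>P. \<exists>s\<in>F. x = \<tau> s c" by blast
next
  assume "\<exists>(c, F, A)\<in>P. \<exists>s\<in>F. x = \<tau> s c"
  then have "x \<in> (\<Union>p\<in>P. tile \<tau> p)" unfolding tile_def by force
  with assms show "x \<in> covered \<tau> P" unfolding quasi_tiling_def by blast
qed

lemma covered_subset:
  assumes "approx_action T D \<tau> D0" "quasi_tiling \<epsilon> \<tau> D0 T P"
  shows "covered \<tau> P \<subseteq> D"
proof
  fix x assume "x \<in> covered \<tau> P"
  then obtain c F A s where "(c, F, A) \<in> P" "s \<in> F" "x = \<tau> s c"
    unfolding covered_tile[OF assms(2)] by auto
  with quasi_tiling_tile[OF assms(2) this(1)] assms(1) show "x \<in> D"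
    unfolding approx_action_def by blast
qed

lemma card_covered:
  assumes "approx_action T D \<tau> D0" "quasi_tiling \<epsilon> \<tau> D0 T P"
  shows "card (covered \<tau> P) = (\<Sum>(c, F, A)\<in>P. card A)"
proof -
  have fin: "finite P" "disjoint_family_on (core \<tau>) P" using assms(2) unfolding quasi_tiling_def by auto
  have fc: "finite (core \<tau> p)" if "p \<in> P" for p
    using that covered_subset[OF assms] assms(1) unfolding covered_def approx_action_def
    by (meson UN_subset_iff finite_subset)
  have "card (covered \<tau> P) = (\<Sum>p\<in>P. card (core \<tau> p))"
    unfolding covered_def using fin fc
    by (intro card_UN_disjoint) (auto simp: disjoint_family_on_def)
  also have "\<dots> = (\<Sum>(c, F, A)\<in>P. card A)"
  proof (rule sum.cong[OF refl], clarify)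
    fix c F A assume p: "(c, F, A) \<in> P"
    have "inj_on (\<lambda>s. \<tau> s c) A"
      using quasi_tiling_tile[OF assms(2) p] assms(1) unfolding approx_action_def
      by (meson inj_on_subset)
    then show "card (core \<tau> (c, F, A)) = card A" unfolding core_def by (simp add: card_image)
  qed
  finally show ?thesis .
qed

text \<open>Full tiles may overlap, but each loses at most the fraction \<epsilon> of its shape to
  earlier ones. For \<epsilon> < 1, adding up shapes instead of cores thus overestimates the covered
  set by at most the factor 1/(1 - \<epsilon>).\<close>

lemma sum_card_shapes:
  assumes "approx_action T D \<tau> D0" "quasi_tiling \<epsilon> \<tau> D0 T P"
  shows "(1 - \<epsilon>) * (\<Sum>(c, F, A)\<in>P. real (card F)) \<le> real (card (covered \<tau> P))"
proof -
  have "(1 - \<epsilon>) * (\<Sum>(c, F, A)\<in>P. real (card F)) = (\<Sum>(c, F, A)\<in>P. (1 - \<epsilon>) * real (card F))"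
    by (simp add: sum_distrib_left case_prod_unfold)
  also have "\<dots> \<le> (\<Sum>(c, F, A)\<in>P. real (card A))"
    using quasi_tiling_tile(6)[OF assms(2)] by (intro sum_mono) auto
  also have "\<dots> = real (card (covered \<tau> P))"
    unfolding card_covered[OF assms] by (simp add: case_prod_unfold)
  finally show ?thesis .
qed

section \<open>Greedy tiling, one scale after the other\<close>

lemma quasi_tiling_insert:
  assumes "quasi_tiling \<epsilon> \<tau> D0 T P" "c \<in> D0" "finite F" "F \<noteq> {}" "F \<subseteq> T"
    and A: "A = {s\<in>F. \<tau> s c \<notin> covered \<tau> P}" "(1 - \<epsilon>) * real (card F) \<le> real (card A)"
  shows "quasi_tiling \<epsilon> \<tau> D0 T (insert (c, F, A) P)"
    and "covered \<tau> (insert (c, F, A) P) = covered \<tau> P \<union> (\<lambda>s. \<tau> s c) ` A"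
proof -
  show c: "covered \<tau> (insert (c, F, A) P) = covered \<tau> P \<union> (\<lambda>s. \<tau> s c) ` A"
    unfolding covered_def core_def by auto
  have disj: "core \<tau> (c, F, A) \<inter> covered \<tau> P = {}" unfolding core_def A by auto
  then have "core \<tau> (c, F, A) \<inter> core \<tau> p = {}" "core \<tau> p \<inter> core \<tau> (c, F, A) = {}" if "p \<in> P" for p
    using that unfolding covered_def by auto
  then have "disjoint_family_on (core \<tau>) (insert (c, F, A) P)"
    using assms(1) unfolding quasi_tiling_def disjoint_family_on_def by auto
  \<comment> \<open>By the choice of \<open>A\<close>, the part of the new tile outside its core was
    covered before.\<close>
  moreover have "tile \<tau> (c, F, A) \<subseteq> covered \<tau> (insert (c, F, A) P)"
    unfolding c tile_def using A(1) by auto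
  moreover have "covered \<tau> P \<subseteq> covered \<tau> (insert (c, F, A) P)" unfolding c by auto
  moreover have "A \<subseteq> F" unfolding A by auto
  ultimately show "quasi_tiling \<epsilon> \<tau> D0 T (insert (c, F, A) P)"
    using assms unfolding quasi_tiling_def by auto
qed

text \<open>Tiles of shape \<open>F\<close> are added while some centre in \<open>D0\<close>
  contributes at least (1 - \<epsilon>)|F| new points. As \<epsilon> < 1, each of them lowers the
  number of uncovered points, so the process stops. From then on, more than \<epsilon>|F| positions
  of the translate at any centre are covered.\<close>

lemma quasi_tiling_saturate:
  assumes "approx_action T D \<tau> D0" "quasi_tiling \<epsilon> \<tau> D0 T P"
    and F: "finite F" "F \<noteq> {}" "F \<subseteq> T" and "\<epsilon> < 1"
  shows "\<exists>P'. quasi_tiling \<epsilon> \<tau> D0 T P' \<and> P \<subseteq> P' \<and> (\<forall>(c, H, A)\<in>P' - P. H = F) \<and>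
    (\<forall>c\<in>D0. real (card {s\<in>F. \<tau> s c \<notin> covered \<tau> P'}) < (1 - \<epsilon>) * real (card F))"
  using assms(2)
proof (induction "card (D - covered \<tau> P)" arbitrary: P rule: less_induct)
  case less
  show ?case
  proof (cases "\<forall>c\<in>D0. real (card {s\<in>F. \<tau> s c \<notin> covered \<tau> P}) < (1 - \<epsilon>) * real (card F)")
    case True
    then show ?thesis using less.prems by blast
  next
    case False
    then obtain c where c: "c \<in> D0"
      "(1 - \<epsilon>) * real (card F) \<le> real (card {s\<in>F. \<tau> s c \<notin> covered \<tau> P})"
      by force
    define A where "A = {s\<in>F. \<tau> s c \<notin> covered \<tau> P}"
    define P1 where "P1 = insert (c, F, A) P"
    note ins = quasi_tiling_insert[OF less.prems c(1) F A_def, folded P1_def]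
    have q1: "quasi_tiling \<epsilon> \<tau> D0 T P1" using ins(1) c(2) unfolding A_def by simp
    have cov: "covered \<tau> P1 = covered \<tau> P \<union> (\<lambda>s. \<tau> s c) ` A"
      using ins(2) c(2) unfolding A_def by simp
    have "0 < (1 - \<epsilon>) * real (card F)" using F \<open>\<epsilon> < 1\<close> by (simp add: card_gt_0_iff)
    with c(2) have "0 < real (card A)" unfolding A_def by linarith
    then have "A \<noteq> {}" by auto
    then obtain s where s: "s \<in> A" by auto
    have "\<tau> s c \<in> D" using covered_subset[OF assms(1) q1] s unfolding cov by auto
    moreover have "\<tau> s c \<notin> covered \<tau> P" "\<tau> s c \<in> covered \<tau> P1" using s unfolding cov A_def by auto
    ultimately have "D - covered \<tau> P1 \<subset> D - covered \<tau> P" unfolding cov by auto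
    moreover have "finite D" using assms(1) unfolding approx_action_def by auto
    ultimately have "card (D - covered \<tau> P1) < card (D - covered \<tau> P)"
      by (simp add: psubset_card_mono)
    from less.hyps[OF this q1] obtain P' where P': "quasi_tiling \<epsilon> \<tau> D0 T P'" "P1 \<subseteq> P'"
      "\<forall>(c, H, A)\<in>P' - P1. H = F"
      "\<forall>c\<in>D0. real (card {s\<in>F. \<tau> s c \<notin> covered \<tau> P'}) < (1 - \<epsilon>) * real (card F)"
      by (elim exE conjE)
    have "\<forall>(c, H, A)\<in>P' - P. H = F"
    proof clarify
      fix c' H A' assume "(c', H, A') \<in> P'" "(c', H, A') \<notin> P"
      then show "H = F" using bspec[OF P'(3), of "(c', H, A')"] unfolding P1_def by auto
    qed
    moreover have "P \<subseteq> P'" using P'(2) unfolding P1_def by auto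
    ultimately show ?thesis using P'(1,4) by (intro exI[of _ P'] conjI)
  qed
qed

text \<open>The translate by \<open>- s\<close> minus \<open>F\<close> consists of the positions
  outside \<open>F\<close> that \<open>s\<close> moves into \<open>F\<close>. Summing over
  \<open>K\<close> absorbs the later union bound over \<open>K\<close> into the one constant
  \<gamma>.\<close>

definition almost_invariant :: "real \<Rightarrow> 'g::group_add set \<Rightarrow> 'g set \<Rightarrow> bool" where
  "almost_invariant \<gamma> K F \<longleftrightarrow> (\<Sum>s\<in>K. real (card ((+) (- s) ` F - F))) \<le> \<gamma> * real (card F)"

text \<open>An uncovered point that some s in \<open>K\<close> moves into a tile lies in the outer
  \<open>K\<close>-boundary of that tile, which is small by almost invariance of the shape. The
  factor 2 pays for the overlap of the tiles, by \<open>sum_card_shapes\<close> with \<epsilon>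
  \<le> 1/2.\<close>

lemma boundary_covered:
  assumes "approx_action T D \<tau> D0" "quasi_tiling \<epsilon> \<tau> D0 T P"
    and K: "finite K" "K \<subseteq> T" "uminus ` K \<subseteq> T"
    and inv: "\<forall>(c, F, A)\<in>P. almost_invariant \<gamma> K F"
    and "0 \<le> \<gamma>" "\<epsilon> \<le> 1 / 2"
  shows "real (card {a\<in>D0. a \<notin> covered \<tau> P \<and> (\<exists>s\<in>K. \<tau> s a \<in> covered \<tau> P)}) \<le> 2 * \<gamma> * real (card D)"
proof -
  have finP: "finite P" using assms(2) unfolding quasi_tiling_def by auto
  have finD: "finite D" using assms(1) unfolding approx_action_def by auto
  define b where "b = (\<lambda>(c, F, A :: 'a set). \<Union>s\<in>K. (\<lambda>t. \<tau> t c) ` ((+) (- s) ` F - F))"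
  have finF: "finite F" if "(c, F, A) \<in> P" for c F A using quasi_tiling_tile(2)[OF assms(2) that] .
  have sub: "{a\<in>D0. a \<notin> covered \<tau> P \<and> (\<exists>s\<in>K. \<tau> s a \<in> covered \<tau> P)} \<subseteq> (\<Union>p\<in>P. b p)"
  proof clarify
    fix a s assume a: "a \<in> D0" "a \<notin> covered \<tau> P" "s \<in> K" "\<tau> s a \<in> covered \<tau> P"
    obtain c F A t where t: "(c, F, A) \<in> P" "t \<in> F" "\<tau> s a = \<tau> t c"
      using a(4) unfolding covered_tile[OF assms(2)] by auto
    note q = quasi_tiling_tile[OF assms(2) t(1)]
    \<comment> \<open>The point \<open>\<tau> s a\<close> may be bad, so the group law is applied at
      \<open>a\<close> and at the centre \<open>c\<close>, which both lie in
      \<open>D0\<close>.\<close>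
    have "- s \<in> T" "s \<in> T" "t \<in> T" using a K q t by auto
    then have "\<tau> (- s) (\<tau> s a) = \<tau> (- s + s) a" "\<tau> (- s) (\<tau> t c) = \<tau> (- s + t) c" "\<tau> 0 a = a"
      using a(1) q(1) assms(1) unfolding approx_action_def by blast+
    then have eq: "a = \<tau> (- s + t) c" using t(3) by simp
    have "- s + t \<notin> F"
    proof
      assume "- s + t \<in> F"
      then have "a \<in> covered \<tau> P" unfolding covered_tile[OF assms(2)] using t(1) eq by blast
      with a(2) show False by simp
    qed
    then have "a \<in> b (c, F, A)" unfolding b_def using eq t(2) a(3) by auto
    then show "a \<in> (\<Union>p\<in>P. b p)" using t(1) by blast
  qed
  have finb: "finite (b p)" if "p \<in> P" for p
    using that finF K(1) unfolding b_def by (cases p) auto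
  have "card {a\<in>D0. a \<notin> covered \<tau> P \<and> (\<exists>s\<in>K. \<tau> s a \<in> covered \<tau> P)} \<le> card (\<Union>p\<in>P. b p)"
    using finP finb by (intro card_mono sub) auto
  also have "\<dots> \<le> (\<Sum>p\<in>P. card (b p))" using finP by (rule card_UN_le)
  finally have "real (card {a\<in>D0. a \<notin> covered \<tau> P \<and> (\<exists>s\<in>K. \<tau> s a \<in> covered \<tau> P)})
      \<le> (\<Sum>p\<in>P. real (card (b p)))" unfolding of_nat_sum[symmetric] of_nat_le_iff .
  also have "\<dots> \<le> (\<Sum>(c, F, A)\<in>P. \<gamma> * real (card F))"
  proof (rule sum_mono, clarify)
    fix c F A assume p: "(c, F, A) \<in> P"
    have "card (b (c, F, A)) \<le> (\<Sum>s\<in>K. card ((\<lambda>t. \<tau> t c) ` ((+) (- s) ` F - F)))"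
      unfolding b_def using K(1) by (simp add: card_UN_le)
    also have "\<dots> \<le> (\<Sum>s\<in>K. card ((+) (- s) ` F - F))"
      using finF[OF p] by (intro sum_mono card_image_le) auto
    finally have "real (card (b (c, F, A))) \<le> (\<Sum>s\<in>K. real (card ((+) (- s) ` F - F)))"
      unfolding of_nat_sum[symmetric] of_nat_le_iff .
    also have "\<dots> \<le> \<gamma> * real (card F)" using inv p unfolding almost_invariant_def by auto
    finally show "real (card (b (c, F, A))) \<le> \<gamma> * real (card F)" .
  qed
  also have "\<dots> = \<gamma> * (\<Sum>(c, F, A)\<in>P. real (card F))"
    by (simp add: sum_distrib_left case_prod_unfold)
  also have "\<dots> \<le> \<gamma> * (2 * real (card D))"
  proof (rule mult_left_mono[OF _ \<open>0 \<le> \<gamma>\<close>])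
    have "(1 / 2) * (\<Sum>(c, F, A)\<in>P. real (card F)) \<le> (1 - \<epsilon>) * (\<Sum>(c, F, A)\<in>P. real (card F))"
      using \<open>\<epsilon> \<le> 1 / 2\<close> by (intro mult_right_mono sum_nonneg) auto
    also have "\<dots> \<le> real (card (covered \<tau> P))" by (rule sum_card_shapes[OF assms(1,2)])
    also have "\<dots> \<le> real (card D)" using covered_subset[OF assms(1,2)] finD by (simp add: card_mono)
    finally show "(\<Sum>(c, F, A)\<in>P. real (card F)) \<le> 2 * real (card D)" by simp
  qed
  finally show ?thesis by simp
qed

lemma card_pairs_le:
  assumes "finite F" "finite E" "finite V" "\<And>s. s \<in> F \<Longrightarrow> inj_on (\<tau> s) E"
  shows "(\<Sum>c\<in>E. card {s\<in>F. \<tau> s c \<in> V}) \<le> card F * card V"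
proof -
  have "(\<Sum>c\<in>E. card {s\<in>F. \<tau> s c \<in> V}) = (\<Sum>s\<in>F. card {c\<in>E. \<tau> s c \<in> V})"
    using assms(1,2) by (intro sum_multicount_gen) auto
  also have "\<dots> \<le> (\<Sum>s\<in>F. card V)"
  proof (rule sum_mono)
    fix s assume "s \<in> F"
    then show "card {c\<in>E. \<tau> s c \<in> V} \<le> card V"
      using assms by (intro card_inj_on_le[of "\<tau> s"]) (auto intro: inj_on_subset)
  qed
  finally show ?thesis by simp
qed

text \<open>Double counting. Consider the uncovered points of \<open>D0\<close> from which all of
  \<open>F\<close> leads to points uncovered by \<open>P\<close>. By saturation each of them has at
  least \<epsilon>|F| positions in the newly covered set, and each s in \<open>F\<close> acts
  injectively; so the new set has at least \<epsilon> times as many points as there are such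
  centres. The other uncovered points are outside \<open>D0\<close> or in the boundary, at most
  \<beta> in all. As \<beta> is the fixed point of the resulting affine recursion, the excess over
  \<beta> contracts by 1 - \<epsilon>.\<close>

lemma saturated_gain:
  assumes "approx_action T D \<tau> D0" "quasi_tiling \<epsilon> \<tau> D0 T P" "quasi_tiling \<epsilon> \<tau> D0 T P'" "P \<subseteq> P'"
    and F: "finite F" "F \<noteq> {}" "F \<subseteq> T" "uminus ` F \<subseteq> T"
    and sat: "\<forall>c\<in>D0. real (card {s\<in>F. \<tau> s c \<notin> covered \<tau> P'}) < (1 - \<epsilon>) * real (card F)"
    and inv: "\<forall>(c, H, A)\<in>P. almost_invariant \<gamma> F H"
    and "0 \<le> \<gamma>" "0 < \<epsilon>" "\<epsilon> \<le> 1 / 2"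
    and D0: "real (card (D - D0)) \<le> \<eta> * real (card D)"
    and \<beta>: "\<beta> = (\<eta> + 2 * \<gamma>) * real (card D)"
  shows "real (card (D - covered \<tau> P')) - \<beta> \<le> (1 - \<epsilon>) * (real (card (D - covered \<tau> P)) - \<beta>)"
proof -
  have finD: "finite D" "D0 \<subseteq> D" using assms(1) unfolding approx_action_def by auto
  let ?V = "covered \<tau> P" let ?V' = "covered \<tau> P'"
  have VV: "?V \<subseteq> ?V'" "?V' \<subseteq> D"
    using \<open>P \<subseteq> P'\<close> covered_subset[OF assms(1,3)] unfolding covered_def by auto
  define E where "E = {a\<in>D0. a \<notin> ?V \<and> (\<forall>s\<in>F. \<tau> s a \<notin> ?V)}"
  have finE: "finite E" "E \<subseteq> D" using finD unfolding E_def by (auto intro: finite_subset)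
  define B where "B = {a\<in>D0. a \<notin> ?V \<and> (\<exists>s\<in>F. \<tau> s a \<in> ?V)}"
  have Bc: "real (card B) \<le> 2 * \<gamma> * real (card D)"
    unfolding B_def by (rule boundary_covered[OF assms(1,2) F(1,3,4) inv]) fact+
  have "D - ?V \<subseteq> E \<union> (D - D0) \<union> B" unfolding E_def B_def by auto
  then have "card (D - ?V) \<le> card (E \<union> (D - D0) \<union> B)"
    using finD finE unfolding B_def by (intro card_mono) (auto intro: finite_subset)
  also have "\<dots> \<le> card E + card (D - D0) + card B"
    by (meson add_mono_thms_linordered_semiring(3) card_Un_le order_trans)
  finally have "real (card (D - ?V)) \<le> real (card E) + real (card (D - D0)) + real (card B)" by linarith
  then have E_ge: "real (card (D - ?V)) - \<beta> \<le> real (card E)"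
    using D0 Bc unfolding \<beta> by (simp add: algebra_simps)
  have "\<epsilon> * real (card F) * real (card E) = (\<Sum>c\<in>E. \<epsilon> * real (card F))" by simp
  also have "\<dots> \<le> (\<Sum>c\<in>E. real (card {s\<in>F. \<tau> s c \<in> ?V' - ?V}))"
  proof (rule sum_mono)
    fix c assume c: "c \<in> E"
    have "{s\<in>F. \<tau> s c \<in> ?V' - ?V} = F - {s\<in>F. \<tau> s c \<notin> ?V'}" using c unfolding E_def by auto
    then have "real (card {s\<in>F. \<tau> s c \<in> ?V' - ?V}) = real (card F) - real (card {s\<in>F. \<tau> s c \<notin> ?V'})"
      using F(1) by (simp add: card_Diff_subset card_mono of_nat_diff)
    moreover have "real (card {s\<in>F. \<tau> s c \<notin> ?V'}) < (1 - \<epsilon>) * real (card F)"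
      using sat c unfolding E_def by auto
    ultimately show "\<epsilon> * real (card F) \<le> real (card {s\<in>F. \<tau> s c \<in> ?V' - ?V})"
      by (simp add: algebra_simps)
  qed
  also have "\<dots> = real (\<Sum>c\<in>E. card {s\<in>F. \<tau> s c \<in> ?V' - ?V})" by simp
  also have "\<dots> \<le> real (card F * card (?V' - ?V))"
  proof (subst of_nat_le_iff, rule card_pairs_le)
    show "finite (?V' - ?V)" using VV finD by (auto intro: finite_subset)
    show "inj_on (\<tau> s) E" for s
      using assms(1) finE(2) unfolding approx_action_def by (meson inj_on_subset)
  qed (use F finE in auto)
  finally have "real (card F) * (\<epsilon> * real (card E)) \<le> real (card F) * real (card (?V' - ?V))"
    by (simp add: algebra_simps)
  then have gain: "\<epsilon> * real (card E) \<le> real (card (?V' - ?V))"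
    using F(1,2) by (simp add: card_gt_0_iff)
  have "card (D - ?V) = card (D - ?V') + card (?V' - ?V)"
    using VV finD by (subst card_Un_disjoint[symmetric]) (auto intro: finite_subset arg_cong[where f = card])
  then have "real (card (D - ?V')) \<le> real (card (D - ?V)) - \<epsilon> * real (card E)" using gain by linarith
  also have "\<dots> \<le> real (card (D - ?V)) - \<epsilon> * (real (card (D - ?V)) - \<beta>)"
    using E_ge \<open>0 < \<epsilon>\<close> by simp
  finally show ?thesis by (simp add: algebra_simps)
qed

text \<open>The order of the list matters: every earlier shape is almost invariant under every later
  one, so the tiles already placed have a small boundary with respect to the shape whose turn it is,
  and \<open>saturated_gain\<close> applies at each scale.\<close>

lemma quasi_tiling_list:
  assumes "approx_action T D \<tau> D0" "quasi_tiling \<epsilon> \<tau> D0 T P"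
    and "\<forall>F\<in>set Hs. finite F \<and> F \<noteq> {} \<and> F \<subseteq> T \<and> uminus ` F \<subseteq> T"
    and "sorted_wrt (\<lambda>H F. almost_invariant \<gamma> F H) Hs"
    and "\<forall>(c, H, A)\<in>P. \<forall>F\<in>set Hs. almost_invariant \<gamma> F H"
    and "0 \<le> \<gamma>" "0 < \<epsilon>" "\<epsilon> \<le> 1 / 2"
    and "real (card (D - D0)) \<le> \<eta> * real (card D)"
    and \<beta>: "\<beta> = (\<eta> + 2 * \<gamma>) * real (card D)"
  shows "\<exists>P'. quasi_tiling \<epsilon> \<tau> D0 T P' \<and> (\<forall>(c, F, A)\<in>P' - P. F \<in> set Hs) \<and>
    real (card (D - covered \<tau> P')) - \<beta> \<le> (1 - \<epsilon>) ^ length Hs * (real (card (D - covered \<tau> P)) - \<beta>)"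
  using assms(2-5)
proof (induction Hs arbitrary: P)
  case Nil
  then show ?case by (intro exI[of _ P]) auto
next
  case (Cons F Hs)
  have F: "finite F" "F \<noteq> {}" "F \<subseteq> T" "uminus ` F \<subseteq> T" using Cons.prems(2) by auto
  obtain P1 where P1: "quasi_tiling \<epsilon> \<tau> D0 T P1" "P \<subseteq> P1" "\<forall>(c, H, A)\<in>P1 - P. H = F"
    "\<forall>c\<in>D0. real (card {s\<in>F. \<tau> s c \<notin> covered \<tau> P1}) < (1 - \<epsilon>) * real (card F)"
    using quasi_tiling_saturate[OF assms(1) Cons.prems(1) F(1-3)] assms(8) by auto
  have g: "real (card (D - covered \<tau> P1)) - \<beta> \<le> (1 - \<epsilon>) * (real (card (D - covered \<tau> P)) - \<beta>)"
    by (rule saturated_gain[OF assms(1) Cons.prems(1) P1(1,2) F P1(4)])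
      (use Cons.prems(4) assms in auto)
  have "\<forall>(c, H, A)\<in>P1. \<forall>F\<in>set Hs. almost_invariant \<gamma> F H"
  proof clarify
    fix c H A F' assume p: "(c, H, A) \<in> P1" "F' \<in> set Hs"
    show "almost_invariant \<gamma> F' H"
    proof (cases "(c, H, A) \<in> P")
      case True
      then show ?thesis using Cons.prems(4) p(2) by auto
    next
      case False
      then have "H = F" using bspec[OF P1(3), of "(c, H, A)"] p(1) by simp
      then show ?thesis using Cons.prems(3) p(2) by simp
    qed
  qed
  from Cons.IH[OF P1(1) _ _ this] Cons.prems(2,3) obtain P' where P':
    "quasi_tiling \<epsilon> \<tau> D0 T P'" "\<forall>(c, F, A)\<in>P' - P1. F \<in> set Hs"
    "real (card (D - covered \<tau> P')) - \<beta> \<le> (1 - \<epsilon>) ^ length Hs * (real (card (D - covered \<tau> P1)) - \<beta>)"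
    by auto
  note P'(3)
  also have "(1 - \<epsilon>) ^ length Hs * (real (card (D - covered \<tau> P1)) - \<beta>) \<le>
      (1 - \<epsilon>) ^ length Hs * ((1 - \<epsilon>) * (real (card (D - covered \<tau> P)) - \<beta>))"
    using g assms(7,8) by (intro mult_left_mono) auto
  finally have "real (card (D - covered \<tau> P')) - \<beta> \<le>
      (1 - \<epsilon>) ^ length (F # Hs) * (real (card (D - covered \<tau> P)) - \<beta>)" by (simp add: algebra_simps)
  moreover have "\<forall>(c, H, A)\<in>P' - P. H \<in> set (F # Hs)"
  proof clarify
    fix c H A assume "(c, H, A) \<in> P'" "(c, H, A) \<notin> P"
    then show "H \<in> set (F # Hs)"
      using bspec[OF P'(2), of "(c, H, A)"] bspec[OF P1(3), of "(c, H, A)"] by auto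
  qed
  ultimately show ?case using P'(1) by (intro exI[of _ P'] conjI)
qed

lemma folner_almost_invariant:
  assumes "folner \<Phi>" "finite K" "0 < \<gamma>"
  shows "\<forall>\<^sub>F n in sequentially. almost_invariant \<gamma> K (\<Phi> n)"
proof -
  have fin: "finite (\<Phi> n)" "\<Phi> n \<noteq> {}" for n using assms(1) unfolding folner_def by auto
  have "(\<lambda>n. \<Sum>s\<in>K. real (card (sym_diff ((+) (- s) ` \<Phi> n) (\<Phi> n))) / real (card (\<Phi> n))) \<longlonglongrightarrow> (\<Sum>s\<in>K. 0)"
    using assms(1) unfolding folner_def by (intro tendsto_sum) auto
  then have "(\<lambda>n. \<Sum>s\<in>K. real (card (sym_diff ((+) (- s) ` \<Phi> n) (\<Phi> n))) / real (card (\<Phi> n))) \<longlonglongrightarrow> 0"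
    by simp
  from order_tendstoD(2)[OF this \<open>0 < \<gamma>\<close>] show ?thesis
  proof eventually_elim
    case (elim n)
    have "(\<Sum>s\<in>K. real (card ((+) (- s) ` \<Phi> n - \<Phi> n))) \<le>
        (\<Sum>s\<in>K. real (card (sym_diff ((+) (- s) ` \<Phi> n) (\<Phi> n))))"
      using fin by (intro sum_mono) (auto intro!: card_mono)
    also have "\<dots> \<le> \<gamma> * real (card (\<Phi> n))"
      using elim fin[of n] by (simp add: sum_divide_distrib[symmetric] divide_less_eq card_gt_0_iff)
    finally show ?case unfolding almost_invariant_def .
  qed
qed

text \<open>The list grows at its head: a late Folner set is almost invariant under the finitely
  many shapes chosen so far. The shape that is placed first is thus chosen last.\<close>

lemma folner_list:
  assumes "folner \<Phi>" "0 < \<gamma>"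
  shows "\<exists>Hs. length Hs = l \<and> set Hs \<subseteq> range \<Phi> \<and> sorted_wrt (\<lambda>H F. almost_invariant \<gamma> F H) Hs"
proof (induction l)
  case (Suc l)
  then obtain Hs where Hs: "length Hs = l" "set Hs \<subseteq> range \<Phi>"
    "sorted_wrt (\<lambda>H F. almost_invariant \<gamma> F H) Hs" by blast
  have "\<forall>\<^sub>F n in sequentially. \<forall>F\<in>set Hs. almost_invariant \<gamma> F (\<Phi> n)"
    using Hs(2) assms by (intro eventually_ball_finite ballI folner_almost_invariant) (auto simp: folner_def)
  then obtain n where "\<forall>F\<in>set Hs. almost_invariant \<gamma> F (\<Phi> n)"
    using eventually_happens trivial_limit_sequentially by blast
  with Hs show ?case by (intro exI[of _ "\<Phi> n # Hs"]) auto
qed auto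

theorem quasi_tiling_exists:
  fixes \<Phi> :: "nat \<Rightarrow> 'g::group_add set"
  assumes "folner \<Phi>" "0 < \<epsilon>" "\<epsilon> \<le> 1 / 2"
  shows "\<exists>T \<eta>. finite T \<and> 0 < \<eta> \<and> (\<forall>(D :: 'd set) \<tau> D0.
    approx_action T D \<tau> D0 \<longrightarrow> real (card (D - D0)) \<le> \<eta> * real (card D) \<longrightarrow>
    (\<exists>P. quasi_tiling \<epsilon> \<tau> D0 T P \<and> (\<forall>(c, F, A)\<in>P. F \<in> range \<Phi>) \<and>
      real (card (D - covered \<tau> P)) \<le> \<epsilon> * real (card D)))"
proof -
  \<comment> \<open>The uncovered fraction ends up at most 3\<epsilon>/4: \<epsilon>/4 from the
    points outside \<open>D0\<close>, 2 * \<epsilon>/8 from boundaries, and \<epsilon>/4 that is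
    left after \<open>l\<close> contractions. The number of scales depends on \<epsilon>
    alone.\<close>
  obtain l where l: "(1 - \<epsilon>) ^ l < \<epsilon> / 4"
    using real_arch_pow_inv[of "\<epsilon> / 4" "1 - \<epsilon>"] assms by auto
  obtain Hs where Hs: "length Hs = l" "set Hs \<subseteq> range \<Phi>"
    "sorted_wrt (\<lambda>H F. almost_invariant (\<epsilon> / 8) F H) Hs"
    using folner_list[OF assms(1), of "\<epsilon> / 8" l] assms(2) by auto
  have finH: "finite F \<and> F \<noteq> {}" if F: "F \<in> set Hs" for F
  proof -
    obtain n where "F = \<Phi> n" using subsetD[OF Hs(2) F] by auto
    then show ?thesis using assms(1) unfolding folner_def by simp
  qed
  \<comment> \<open>Each shape in turn plays the role of \<open>K\<close> in
    \<open>boundary_covered\<close>, where inverses occur.\<close>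
  define T where "T = \<Union>(set Hs) \<union> uminus ` \<Union>(set Hs)"
  have finT: "finite T" unfolding T_def using finH by auto
  have HT: "\<forall>F\<in>set Hs. finite F \<and> F \<noteq> {} \<and> F \<subseteq> T \<and> uminus ` F \<subseteq> T"
    using finH unfolding T_def by auto
  have "\<exists>P. quasi_tiling \<epsilon> \<tau> D0 T P \<and> (\<forall>(c, F, A)\<in>P. F \<in> range \<Phi>) \<and>
      real (card (D - covered \<tau> P)) \<le> \<epsilon> * real (card D)"
    if D: "approx_action T D \<tau> D0" "real (card (D - D0)) \<le> \<epsilon> / 4 * real (card D)"
    for D :: "'d set" and \<tau> D0
  proof -
    have "quasi_tiling \<epsilon> \<tau> D0 T {}"
      unfolding quasi_tiling_def covered_def disjoint_family_on_def by auto
    from quasi_tiling_list[OF D(1) this HT Hs(3) _ _ assms(2,3) D(2) refl] assms(2)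
    obtain P where P: "quasi_tiling \<epsilon> \<tau> D0 T P" "\<forall>(c, F, A)\<in>P. F \<in> set Hs"
      "real (card (D - covered \<tau> P)) - (\<epsilon> / 4 + 2 * (\<epsilon> / 8)) * real (card D) \<le>
       (1 - \<epsilon>) ^ length Hs * (real (card (D - covered \<tau> {})) - (\<epsilon> / 4 + 2 * (\<epsilon> / 8)) * real (card D))"
      by auto
    note P(3)
    also have "(1 - \<epsilon>) ^ length Hs * (real (card (D - covered \<tau> {})) - (\<epsilon> / 4 + 2 * (\<epsilon> / 8)) * real (card D))
        \<le> (1 - \<epsilon>) ^ length Hs * real (card D)"
      using assms(2,3) by (intro mult_left_mono) (auto simp: covered_def)
    also have "\<dots> \<le> \<epsilon> / 4 * real (card D)" using l Hs(1) by (intro mult_right_mono) auto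
    finally have "real (card (D - covered \<tau> P)) \<le> (3 * \<epsilon> / 4) * real (card D)" by (simp add: algebra_simps)
    also have "\<dots> \<le> \<epsilon> * real (card D)" using assms(2) by (intro mult_right_mono) auto
    finally have "real (card (D - covered \<tau> P)) \<le> \<epsilon> * real (card D)" .
    moreover have "\<forall>(c, F, A)\<in>P. F \<in> range \<Phi>" using P(2) Hs(2) by auto
    ultimately show ?thesis using P(1) by blast
  qed
  then show ?thesis using finT assms(2) by (intro exI[of _ T] exI[of _ "\<epsilon> / 4"]) auto
qed

section \<open>Dynamical covers and the Ornstein-Weiss limit\<close>

lemma cov_num_le:
  assumes "\<W> \<subseteq> \<V>" "finite \<W>" "K \<subseteq> \<Union>\<W>"
  shows "cov_num \<V> K \<le> card \<W>"
  unfolding cov_num_def using assms by (intro Least_le) blast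

lemma cov_num_witness:
  assumes "finite \<V>" "K \<subseteq> \<Union>\<V>"
  obtains \<W> where "\<W> \<subseteq> \<V>" "finite \<W>" "card \<W> = cov_num \<V> K" "K \<subseteq> \<Union>\<W>"
proof -
  have "\<exists>n. \<exists>\<W>\<subseteq>\<V>. finite \<W> \<and> card \<W> = n \<and> K \<subseteq> \<Union>\<W>" using assms by blast
  from LeastI_ex[OF this] show ?thesis using that unfolding cov_num_def by blast
qed

lemma cov_num_refine:
  assumes "finite \<W>" "K \<subseteq> \<Union>\<W>" "\<And>W. W \<in> \<W> \<Longrightarrow> \<exists>V\<in>\<V>. W \<subseteq> V"
  shows "cov_num \<V> K \<le> card \<W>"
proof -
  obtain f where f: "\<And>W. W \<in> \<W> \<Longrightarrow> f W \<in> \<V> \<and> W \<subseteq> f W" using assms(3) by metis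
  then have "cov_num \<V> K \<le> card (f ` \<W>)" using assms(1,2) by (intro cov_num_le) fastforce+
  also have "\<dots> \<le> card \<W>" using assms(1) by (rule card_image_le)
  finally show ?thesis .
qed

section \<open>Submultiplicativity of dynamical covering numbers\<close>

definition dyn_num :: "('g \<Rightarrow> 'x \<Rightarrow> 'x) \<Rightarrow> 'x set set \<Rightarrow> 'g set \<Rightarrow> nat" where
  "dyn_num \<alpha> \<W> F = cov_num (dyn_cover \<alpha> F \<W>) UNIV"

lemma mem_dyn_cover:
  "Q \<in> dyn_cover \<alpha> F \<W> \<longleftrightarrow> (\<exists>U. (\<forall>g\<in>F. U g \<in> \<W>) \<and> Q = {x. \<forall>g\<in>F. \<alpha> g x \<in> U g})"
proof
  assume "Q \<in> dyn_cover \<alpha> F \<W>"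
  then obtain V where V: "\<forall>g\<in>F. V g \<in> (\<lambda>W. \<alpha> g -` W) ` \<W>" "Q = (\<Inter>g\<in>F. V g)"
    unfolding dyn_cover_def join_cover_def by auto
  from V(1) have "\<forall>g\<in>F. \<exists>U. U \<in> \<W> \<and> V g = \<alpha> g -` U" by blast
  then obtain U where "\<forall>g\<in>F. U g \<in> \<W> \<and> V g = \<alpha> g -` U g" by metis
  then show "\<exists>U. (\<forall>g\<in>F. U g \<in> \<W>) \<and> Q = {x. \<forall>g\<in>F. \<alpha> g x \<in> U g}"
    unfolding V(2) by (intro exI[of _ U]) auto
next
  assume "\<exists>U. (\<forall>g\<in>F. U g \<in> \<W>) \<and> Q = {x. \<forall>g\<in>F. \<alpha> g x \<in> U g}"
  then obtain U where "\<forall>g\<in>F. U g \<in> \<W>" "Q = (\<Inter>g\<in>F. \<alpha> g -` U g)" by auto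
  then show "Q \<in> dyn_cover \<alpha> F \<W>"
    unfolding dyn_cover_def join_cover_def by (intro CollectI exI[of _ "\<lambda>g. \<alpha> g -` U g"]) auto
qed

lemma dyn_coverE:
  assumes "Q \<in> dyn_cover \<alpha> F \<W>"
  obtains U where "\<forall>g\<in>F. U g \<in> \<W>" "Q = {x. \<forall>g\<in>F. \<alpha> g x \<in> U g}"
  using assms unfolding mem_dyn_cover by (elim exE conjE)

lemma finite_dyn_cover:
  assumes "finite F" "finite \<W>"
  shows "finite (dyn_cover \<alpha> F \<W>)"
proof (rule finite_subset)
  show "dyn_cover \<alpha> F \<W> \<subseteq> (\<lambda>U. {x. \<forall>g\<in>F. \<alpha> g x \<in> U g}) ` (F \<rightarrow>\<^sub>E \<W>)"
  proof
    fix Q assume "Q \<in> dyn_cover \<alpha> F \<W>"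
    then obtain U where "\<forall>g\<in>F. U g \<in> \<W>" "Q = {x. \<forall>g\<in>F. \<alpha> g x \<in> U g}" unfolding mem_dyn_cover by auto
    then show "Q \<in> (\<lambda>U. {x. \<forall>g\<in>F. \<alpha> g x \<in> U g}) ` (F \<rightarrow>\<^sub>E \<W>)"
      by (intro image_eqI[of _ _ "restrict U F"]) auto
  qed
  show "finite ((\<lambda>U. {x. \<forall>g\<in>F. \<alpha> g x \<in> U g}) ` (F \<rightarrow>\<^sub>E \<W>))"
    using assms by (intro finite_imageI finite_PiE) auto
qed

lemma Union_dyn_cover:
  assumes "\<Union>\<W> = UNIV"
  shows "\<Union>(dyn_cover \<alpha> F \<W>) = UNIV"
proof -
  have "x \<in> \<Union>(dyn_cover \<alpha> F \<W>)" for x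
  proof -
    have "\<forall>g. \<exists>U. U \<in> \<W> \<and> \<alpha> g x \<in> U"
    proof
      fix g
      have "\<alpha> g x \<in> \<Union>\<W>" unfolding assms by simp
      then show "\<exists>U. U \<in> \<W> \<and> \<alpha> g x \<in> U" by blast
    qed
    then obtain U where "\<forall>g. U g \<in> \<W> \<and> \<alpha> g x \<in> U g" by metis
    then show ?thesis
      by (intro UnionI[of "{x. \<forall>g\<in>F. \<alpha> g x \<in> U g}"]) (auto simp: mem_dyn_cover)
  qed
  then show ?thesis by auto
qed

lemma dyn_num_witness:
  assumes "finite \<W>" "\<Union>\<W> = UNIV" "finite F"
  obtains \<S> where "\<S> \<subseteq> dyn_cover \<alpha> F \<W>" "finite \<S>" "card \<S> = dyn_num \<alpha> \<W> F" "\<Union>\<S> = UNIV"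
proof -
  have "UNIV \<subseteq> \<Union>(dyn_cover \<alpha> F \<W>)" unfolding Union_dyn_cover[OF assms(2)] by simp
  from cov_num_witness[OF finite_dyn_cover[OF assms(3,1)] this] that show ?thesis
    unfolding dyn_num_def by (metis top.extremum_uniqueI)
qed

lemma dyn_num_pos:
  assumes "finite \<W>" "\<Union>\<W> = UNIV" "finite F"
  shows "0 < dyn_num \<alpha> \<W> F"
proof -
  obtain \<S> where "\<S> \<subseteq> dyn_cover \<alpha> F \<W>" "finite \<S>" "card \<S> = dyn_num \<alpha> \<W> F" "\<Union>\<S> = UNIV"
    by (rule dyn_num_witness[OF assms])
  moreover from this have "\<S> \<noteq> {}" by auto
  ultimately show ?thesis by (metis card_gt_0_iff)
qed

text \<open>The empty intersection is the whole space. This is the base case of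
  \<open>dyn_num_UN\<close>.\<close>

lemma dyn_num_empty: "dyn_num \<alpha> \<W> {} \<le> 1"
proof -
  have "dyn_num \<alpha> \<W> {} \<le> card {UNIV :: 'b set}"
    unfolding dyn_num_def by (rule cov_num_le) (auto simp: mem_dyn_cover)
  then show ?thesis by simp
qed

lemma dyn_num_Un:
  assumes "finite \<W>" "\<Union>\<W> = UNIV" "finite A" "finite B"
  shows "dyn_num \<alpha> \<W> (A \<union> B) \<le> dyn_num \<alpha> \<W> A * dyn_num \<alpha> \<W> B"
proof -
  obtain \<S> where S: "\<S> \<subseteq> dyn_cover \<alpha> A \<W>" "finite \<S>" "card \<S> = dyn_num \<alpha> \<W> A" "\<Union>\<S> = UNIV"
    by (rule dyn_num_witness[OF assms(1-3)])
  obtain \<T> where T: "\<T> \<subseteq> dyn_cover \<alpha> B \<W>" "finite \<T>" "card \<T> = dyn_num \<alpha> \<W> B" "\<Union>\<T> = UNIV"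
    by (rule dyn_num_witness[OF assms(1,2,4)])
  have "dyn_num \<alpha> \<W> (A \<union> B) \<le> card ((\<lambda>(P, Q). P \<inter> Q) ` (\<S> \<times> \<T>))"
    unfolding dyn_num_def
  proof (rule cov_num_refine)
    show "UNIV \<subseteq> \<Union> ((\<lambda>(P, Q). P \<inter> Q) ` (\<S> \<times> \<T>))"
    proof
      fix x
      have "x \<in> \<Union>\<S>" "x \<in> \<Union>\<T>" unfolding S T by simp_all
      then obtain P Q where "P \<in> \<S>" "x \<in> P" "Q \<in> \<T>" "x \<in> Q" by blast
      then show "x \<in> \<Union> ((\<lambda>(P, Q). P \<inter> Q) ` (\<S> \<times> \<T>))" by blast
    qed
    fix R assume "R \<in> (\<lambda>(P, Q). P \<inter> Q) ` (\<S> \<times> \<T>)"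
    then obtain P Q where R: "P \<in> \<S>" "Q \<in> \<T>" "R = P \<inter> Q" by auto
    obtain U where U: "\<forall>g\<in>A. U g \<in> \<W>" "P = {x. \<forall>g\<in>A. \<alpha> g x \<in> U g}"
      by (rule dyn_coverE[OF subsetD[OF S(1) R(1)]])
    obtain V where V: "\<forall>g\<in>B. V g \<in> \<W>" "Q = {x. \<forall>g\<in>B. \<alpha> g x \<in> V g}"
      by (rule dyn_coverE[OF subsetD[OF T(1) R(2)]])
    let ?X = "\<lambda>g. if g \<in> A then U g else V g"
    have "{x. \<forall>g\<in>A \<union> B. \<alpha> g x \<in> ?X g} \<in> dyn_cover \<alpha> (A \<union> B) \<W>"
      unfolding mem_dyn_cover using U(1) V(1) by (intro exI[of _ ?X]) auto
    moreover have "R \<subseteq> {x. \<forall>g\<in>A \<union> B. \<alpha> g x \<in> ?X g}" unfolding R(3) U(2) V(2) by auto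
    ultimately show "\<exists>V\<in>dyn_cover \<alpha> (A \<union> B) \<W>. R \<subseteq> V" by blast
  qed (use S T in auto)
  also have "\<dots> \<le> card (\<S> \<times> \<T>)" using S T by (intro card_image_le) auto
  finally show ?thesis by (simp add: card_cartesian_product S T)
qed

lemma dyn_num_mono:
  assumes "finite \<W>" "\<Union>\<W> = UNIV" "finite B" "A \<subseteq> B"
  shows "dyn_num \<alpha> \<W> A \<le> dyn_num \<alpha> \<W> B"
proof -
  obtain \<S> where S: "\<S> \<subseteq> dyn_cover \<alpha> B \<W>" "finite \<S>" "card \<S> = dyn_num \<alpha> \<W> B" "\<Union>\<S> = UNIV"
    by (rule dyn_num_witness[OF assms(1-3)])
  have "dyn_num \<alpha> \<W> A \<le> card \<S>"
    unfolding dyn_num_def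
  proof (rule cov_num_refine)
    fix R assume R: "R \<in> \<S>"
    obtain U where U: "\<forall>g\<in>B. U g \<in> \<W>" "R = {x. \<forall>g\<in>B. \<alpha> g x \<in> U g}"
      by (rule dyn_coverE[OF subsetD[OF S(1) R]])
    have "{x. \<forall>g\<in>A. \<alpha> g x \<in> U g} \<in> dyn_cover \<alpha> A \<W>"
      unfolding mem_dyn_cover using U(1) assms(4) by blast
    moreover have "R \<subseteq> {x. \<forall>g\<in>A. \<alpha> g x \<in> U g}" unfolding U(2) using assms(4) by auto
    ultimately show "\<exists>V\<in>dyn_cover \<alpha> A \<W>. R \<subseteq> V" by blast
  qed (use S in auto)
  then show ?thesis using S(3) by simp
qed

lemma dyn_num_singleton:
  assumes "finite \<W>" "\<Union>\<W> = UNIV"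
  shows "dyn_num \<alpha> \<W> {g} \<le> card \<W>"
proof -
  have "dyn_num \<alpha> \<W> {g} \<le> card ((\<lambda>W. \<alpha> g -` W) ` \<W>)"
    unfolding dyn_num_def
  proof (rule cov_num_le)
    show "(\<lambda>W. \<alpha> g -` W) ` \<W> \<subseteq> dyn_cover \<alpha> {g} \<W>"
    proof clarify
      fix W assume "W \<in> \<W>"
      then show "\<alpha> g -` W \<in> dyn_cover \<alpha> {g} \<W>"
        unfolding mem_dyn_cover by (intro exI[of _ "\<lambda>_. W"]) auto
    qed
    show "UNIV \<subseteq> \<Union> ((\<lambda>W. \<alpha> g -` W) ` \<W>)" using assms(2) by (auto simp: set_eq_iff)
  qed (use assms in auto)
  also have "\<dots> \<le> card \<W>" using assms(1) by (rule card_image_le)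
  finally show ?thesis .
qed

lemma dyn_num_UN:
  assumes "finite \<W>" "\<Union>\<W> = UNIV" "finite I" "\<And>i. i \<in> I \<Longrightarrow> finite (A i)"
  shows "dyn_num \<alpha> \<W> (\<Union>i\<in>I. A i) \<le> (\<Prod>i\<in>I. dyn_num \<alpha> \<W> (A i))"
  using assms(3,4)
proof (induction I rule: finite_induct)
  case empty
  then show ?case using dyn_num_empty by simp
next
  case (insert i I)
  have "dyn_num \<alpha> \<W> (\<Union>i\<in>insert i I. A i) \<le> dyn_num \<alpha> \<W> (A i) * dyn_num \<alpha> \<W> (\<Union>i\<in>I. A i)"
    using insert dyn_num_Un[OF assms(1,2), of "A i" "\<Union>i\<in>I. A i" \<alpha>] by auto
  also have "\<dots> \<le> dyn_num \<alpha> \<W> (A i) * (\<Prod>i\<in>I. dyn_num \<alpha> \<W> (A i))"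
    using insert by (intro mult_left_mono) auto
  finally show ?case using insert by simp
qed

lemma dyn_num_le_power:
  assumes "finite \<W>" "\<Union>\<W> = UNIV" "finite F"
  shows "dyn_num \<alpha> \<W> F \<le> card \<W> ^ card F"
proof -
  have "dyn_num \<alpha> \<W> (\<Union>g\<in>F. {g}) \<le> (\<Prod>g\<in>F. dyn_num \<alpha> \<W> {g})"
    using assms by (intro dyn_num_UN) auto
  also have "\<dots> \<le> (\<Prod>g\<in>F. card \<W>)"
    using dyn_num_singleton[OF assms(1,2)] by (intro prod_mono) auto
  finally show ?thesis by simp
qed

text \<open>Inside a Folner set the tile with centre c is the right translate of its shape. As s + c
  acts as s after c, the preimages under \<open>\<alpha> c\<close> of a subcover for
  \<open>F\<close> form one for the translate.\<close>

lemma dyn_num_translate: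
  fixes \<alpha> :: "'g::group_add \<Rightarrow> 'x \<Rightarrow> 'x"
  assumes "finite \<W>" "\<Union>\<W> = UNIV" "finite F"
    and \<alpha>: "\<And>s t. \<alpha> (s + t) = \<alpha> s \<circ> \<alpha> t"
  shows "dyn_num \<alpha> \<W> ((\<lambda>s. s + c) ` F) \<le> dyn_num \<alpha> \<W> F"
proof -
  obtain \<S> where S: "\<S> \<subseteq> dyn_cover \<alpha> F \<W>" "finite \<S>" "card \<S> = dyn_num \<alpha> \<W> F" "\<Union>\<S> = UNIV"
    by (rule dyn_num_witness[OF assms(1-3)])
  have "dyn_num \<alpha> \<W> ((\<lambda>s. s + c) ` F) \<le> card ((\<lambda>R. \<alpha> c -` R) ` \<S>)"
    unfolding dyn_num_def
  proof (rule cov_num_le)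
    show "(\<lambda>R. \<alpha> c -` R) ` \<S> \<subseteq> dyn_cover \<alpha> ((\<lambda>s. s + c) ` F) \<W>"
    proof clarify
      fix R assume R: "R \<in> \<S>"
      obtain U where "\<forall>g\<in>F. U g \<in> \<W>" "R = {x. \<forall>g\<in>F. \<alpha> g x \<in> U g}"
        by (rule dyn_coverE[OF subsetD[OF S(1) R]])
      then show "\<alpha> c -` R \<in> dyn_cover \<alpha> ((\<lambda>s. s + c) ` F) \<W>"
        unfolding mem_dyn_cover by (intro exI[of _ "\<lambda>g. U (g - c)"]) (auto simp: \<alpha>)
    qed
    show "UNIV \<subseteq> \<Union> ((\<lambda>R. \<alpha> c -` R) ` \<S>)" using S(4) by (auto simp: set_eq_iff)
  qed (use S in auto)
  also have "\<dots> \<le> card \<S>" using S(2) by (rule card_image_le)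
  finally show ?thesis using S(3) by simp
qed

section \<open>Folner sets tiled by Folner sets\<close>

lemma folner_approx_action:
  assumes "folner \<Psi>" "finite T" "0 < \<eta>"
  shows "\<forall>\<^sub>F n in sequentially. approx_action T (\<Psi> n) (+) {a\<in>\<Psi> n. \<forall>s\<in>T. s + a \<in> \<Psi> n} \<and>
    real (card (\<Psi> n - {a\<in>\<Psi> n. \<forall>s\<in>T. s + a \<in> \<Psi> n})) \<le> \<eta> * real (card (\<Psi> n))"
proof -
  \<comment> \<open>The bad points are those that some s in \<open>T\<close> moves out of the set;
    translation by s embeds them into the translate by s minus the set. Since
    \<open>almost_invariant\<close> translates by the negative, the window is negated.\<close>
  have "\<forall>\<^sub>F n in sequentially. almost_invariant \<eta> (uminus ` T) (\<Psi> n)"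
    using assms by (intro folner_almost_invariant) auto
  then show ?thesis
  proof eventually_elim
    case (elim n)
    have fin: "finite (\<Psi> n)" using assms(1) unfolding folner_def by auto
    have "approx_action T (\<Psi> n) (+) {a\<in>\<Psi> n. \<forall>s\<in>T. s + a \<in> \<Psi> n}"
      unfolding approx_action_def using fin by (auto simp: add.assoc inj_on_def)
    moreover have "real (card (\<Psi> n - {a\<in>\<Psi> n. \<forall>s\<in>T. s + a \<in> \<Psi> n})) \<le> \<eta> * real (card (\<Psi> n))"
    proof -
      have "\<Psi> n - {a\<in>\<Psi> n. \<forall>s\<in>T. s + a \<in> \<Psi> n} = (\<Union>s\<in>T. {a\<in>\<Psi> n. s + a \<notin> \<Psi> n})" by auto
      then have "card (\<Psi> n - {a\<in>\<Psi> n. \<forall>s\<in>T. s + a \<in> \<Psi> n}) \<le> (\<Sum>s\<in>T. card {a\<in>\<Psi> n. s + a \<notin> \<Psi> n})"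
        using card_UN_le[OF assms(2)] by simp
      also have "\<dots> \<le> (\<Sum>s\<in>T. card ((+) s ` \<Psi> n - \<Psi> n))"
        using fin by (intro sum_mono card_inj_on_le[of "(+) _"]) auto
      also have "\<dots> = (\<Sum>s\<in>uminus ` T. card ((+) (- s) ` \<Psi> n - \<Psi> n))"
        by (subst sum.reindex) (auto simp: inj_on_def)
      finally have "real (card (\<Psi> n - {a\<in>\<Psi> n. \<forall>s\<in>T. s + a \<in> \<Psi> n})) \<le>
          (\<Sum>s\<in>uminus ` T. real (card ((+) (- s) ` \<Psi> n - \<Psi> n)))"
        unfolding of_nat_sum[symmetric] of_nat_le_iff .
      then show ?thesis using elim unfolding almost_invariant_def by linarith
    qed
    ultimately show ?case by blast
  qed
qed

definition dyn_rate :: "('g \<Rightarrow> 'x \<Rightarrow> 'x) \<Rightarrow> 'x set set \<Rightarrow> 'g set \<Rightarrow> real" where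
  "dyn_rate \<alpha> \<W> F = ln (real (dyn_num \<alpha> \<W> F)) / real (card F)"

lemma dyn_rate_nonneg:
  assumes "finite \<W>" "\<Union>\<W> = UNIV" "finite F"
  shows "0 \<le> dyn_rate \<alpha> \<W> F"
proof -
  have "1 \<le> real (dyn_num \<alpha> \<W> F)" using dyn_num_pos[OF assms, of \<alpha>] by simp
  then show ?thesis unfolding dyn_rate_def by (intro divide_nonneg_nonneg ln_ge_zero) auto
qed

lemma ln_dyn_num: "finite F \<Longrightarrow> F \<noteq> {} \<Longrightarrow> ln (real (dyn_num \<alpha> \<W> F)) = dyn_rate \<alpha> \<W> F * real (card F)"
  unfolding dyn_rate_def by simp

lemma folner_subseq: "folner \<Phi> \<Longrightarrow> strict_mono r \<Longrightarrow> folner (\<Phi> \<circ> r)"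
  unfolding folner_def using LIMSEQ_subseq_LIMSEQ[of "\<lambda>n. real (card (sym_diff ((+) _ ` \<Phi> n) (\<Phi> n))) / real (card (\<Phi> n))"]
  by (auto simp: o_def)

lemma folner_shift: "folner \<Phi> \<Longrightarrow> folner (\<lambda>n. \<Phi> (n + N))"
  using folner_subseq[of \<Phi> "\<lambda>n. n + N"] by (simp add: o_def strict_mono_def)

text \<open>Tile a late set of \<Psi> by sets of \<Phi>. By submultiplicativity a core costs at most
  as much as its shape, that is b per element, and an uncovered point costs at most the factor
  \<open>card \<W>\<close>. The bound b is required along all of \<Phi>, since any of its members
  may occur as a shape.\<close>

lemma dyn_rate_upper:
  fixes \<alpha> :: "'g::group_add \<Rightarrow> 'x \<Rightarrow> 'x"
  assumes W: "finite \<W>" "\<Union>\<W> = UNIV" and \<alpha>: "\<And>s t. \<alpha> (s + t) = \<alpha> s \<circ> \<alpha> t"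
    and "folner \<Phi>" and b: "\<And>n. dyn_rate \<alpha> \<W> (\<Phi> n) \<le> b"
    and "folner \<Psi>" and "0 < \<kappa>"
  shows "\<forall>\<^sub>F n in sequentially. dyn_rate \<alpha> \<W> (\<Psi> n) \<le> b + \<kappa>"
proof -
  have fin: "finite (\<Phi> n)" "\<Phi> n \<noteq> {}" "finite (\<Psi> n)" "\<Psi> n \<noteq> {}" for n
    using assms(4,6) unfolding folner_def by auto
  have b0: "0 \<le> b" using dyn_rate_nonneg[OF W fin(1)[of 0], of \<alpha>] b[of 0] by linarith
  have "\<W> \<noteq> {}" using W(2) by auto
  then have W1: "1 \<le> real (card \<W>)" using W(1) by (simp add: Suc_leI card_gt_0_iff)
  define L where "L = ln (real (card \<W>))"
  have L0: "0 \<le> L" unfolding L_def using W1 by simp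
  \<comment> \<open>The overlap of the tiles will cost 2\<epsilon>b and the uncovered points
    \<epsilon>L per element; the summand 1 keeps the denominator positive.\<close>
  define \<epsilon> where "\<epsilon> = min (1 / 2) (\<kappa> / (2 * b + L + 1))"
  have "0 < \<kappa> / (2 * b + L + 1)" using b0 L0 assms(7) by simp
  then have \<epsilon>: "0 < \<epsilon>" "\<epsilon> \<le> 1 / 2" unfolding \<epsilon>_def by (simp_all only: min.cobounded1 min_less_iff_conj half_gt_zero_iff zero_less_one simp_thms)
  have "\<epsilon> \<le> \<kappa> / (2 * b + L + 1)" unfolding \<epsilon>_def by simp
  then have "\<epsilon> * (2 * b + L + 1) \<le> \<kappa>" using b0 L0 by (simp add: le_divide_eq)
  then have \<epsilon>\<kappa>: "2 * \<epsilon> * b + \<epsilon> * L \<le> \<kappa>" using \<epsilon>(1) by (simp add: algebra_simps)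
  obtain T \<eta> where T: "finite T" "0 < \<eta>" and tiling: "\<And>(D :: 'g set) \<tau> D0.
    approx_action T D \<tau> D0 \<Longrightarrow> real (card (D - D0)) \<le> \<eta> * real (card D) \<Longrightarrow>
    \<exists>P. quasi_tiling \<epsilon> \<tau> D0 T P \<and> (\<forall>(c, F, A)\<in>P. F \<in> range \<Phi>) \<and>
      real (card (D - covered \<tau> P)) \<le> \<epsilon> * real (card D)"
    using quasi_tiling_exists[OF assms(4) \<epsilon>, where 'd = 'g] by blast
  from folner_approx_action[OF assms(6) T] show ?thesis
  proof eventually_elim
    case (elim n)
    define D where "D = \<Psi> n"
    have D: "finite D" "D \<noteq> {}" unfolding D_def using fin by auto
    define D0 where "D0 = {a\<in>D. \<forall>s\<in>T. s + a \<in> D}"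
    have aa: "approx_action T D (+) D0" using elim unfolding D_def D0_def by blast
    obtain P where P: "quasi_tiling \<epsilon> (+) D0 T P" "\<forall>(c, F, A)\<in>P. F \<in> range \<Phi>"
      "real (card (D - covered (+) P)) \<le> \<epsilon> * real (card D)"
      using tiling[OF aa] elim unfolding D_def D0_def by blast
    note q = quasi_tiling_tile[OF P(1)]
    have finP: "finite P" using P(1) unfolding quasi_tiling_def by auto
    have fA: "finite A" if "(c, F, A) \<in> P" for c F A using q(2,5)[OF that] by (rule finite_subset[rotated])
    have fc: "finite (core (+) p)" if "p \<in> P" for p
      using that fA unfolding core_def by (auto split: prod.splits)
    have core_le: "dyn_num \<alpha> \<W> (core (+) p) \<le> (case p of (c, F, A) \<Rightarrow> dyn_num \<alpha> \<W> F)" if "p \<in> P" for p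
    proof -
      obtain c F A where p: "p = (c, F, A)" by (metis prod_cases3)
      have "dyn_num \<alpha> \<W> (core (+) p) \<le> dyn_num \<alpha> \<W> A"
        unfolding core_def p using dyn_num_translate[OF W fA, OF that[unfolded p] \<alpha>] by simp
      also have "\<dots> \<le> dyn_num \<alpha> \<W> F" using q[OF that[unfolded p]] by (intro dyn_num_mono[OF W])
      finally show ?thesis unfolding p by simp
    qed
    have "D \<subseteq> (\<Union>p\<in>P. core (+) p) \<union> (D - covered (+) P)" unfolding covered_def by auto
    then have "dyn_num \<alpha> \<W> D \<le> dyn_num \<alpha> \<W> ((\<Union>p\<in>P. core (+) p) \<union> (D - covered (+) P))"
      using finP fc D by (intro dyn_num_mono[OF W]) auto
    also have "\<dots> \<le> dyn_num \<alpha> \<W> (\<Union>p\<in>P. core (+) p) * dyn_num \<alpha> \<W> (D - covered (+) P)"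
      using finP fc D by (intro dyn_num_Un[OF W]) auto
    also have "\<dots> \<le> (\<Prod>p\<in>P. dyn_num \<alpha> \<W> (core (+) p)) * card \<W> ^ card (D - covered (+) P)"
      using finP fc D by (intro mult_mono dyn_num_UN[OF W] dyn_num_le_power[OF W]) auto
    also have "\<dots> \<le> (\<Prod>(c, F, A)\<in>P. dyn_num \<alpha> \<W> F) * card \<W> ^ card (D - covered (+) P)"
      using core_le by (intro mult_right_mono prod_mono) auto
    finally have "real (dyn_num \<alpha> \<W> D) \<le>
        real ((\<Prod>(c, F, A)\<in>P. dyn_num \<alpha> \<W> F) * card \<W> ^ card (D - covered (+) P))"
      by (simp only: of_nat_le_iff)
    then have "real (dyn_num \<alpha> \<W> D) \<le>
        (\<Prod>(c, F, A)\<in>P. real (dyn_num \<alpha> \<W> F)) * real (card \<W>) ^ card (D - covered (+) P)"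
      (is "_ \<le> ?prod * ?pow")
      by (simp add: case_prod_unfold)
    moreover have "0 < real (dyn_num \<alpha> \<W> D)" using dyn_num_pos[OF W D(1)] by simp
    moreover have pos: "0 < (case p of (c, F, A) \<Rightarrow> real (dyn_num \<alpha> \<W> F))" if "p \<in> P" for p
    proof -
      obtain c F A where p: "p = (c, F, A)" by (metis prod_cases3)
      then show ?thesis using that dyn_num_pos[OF W q(2)] by simp
    qed
    ultimately have "ln (real (dyn_num \<alpha> \<W> D)) \<le> ln (?prod * ?pow)" by (simp only: ln_mono)
    also have "\<dots> = ln ?prod + ln ?pow"
      using pos W1 by (intro ln_mult_pos prod_pos zero_less_power) auto
    also have "ln ?prod = (\<Sum>p\<in>P. ln (case p of (c, F, A) \<Rightarrow> real (dyn_num \<alpha> \<W> F)))"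
      using finP less_imp_neq[OF pos] by (intro ln_prod) metis+
    also have "\<dots> \<le> (\<Sum>(c, F, A)\<in>P. b * real (card F))"
    proof (intro sum_mono, clarify)
      fix c F A assume p: "(c, F, A) \<in> P"
      then obtain m where "F = \<Phi> m" using P(2) by auto
      then show "ln (real (dyn_num \<alpha> \<W> F)) \<le> b * real (card F)"
        using q[OF p] b[of m] by (simp add: ln_dyn_num mult_right_mono)
    qed
    also have "\<dots> = b * (\<Sum>(c, F, A)\<in>P. real (card F))" by (simp add: sum_distrib_left case_prod_unfold)
    also have "\<dots> \<le> b * ((1 + 2 * \<epsilon>) * real (card D))"
    proof (rule mult_left_mono[OF _ b0])
      define S where "S = (\<Sum>(c, F, A)\<in>P. real (card F))"
      have "(1 - \<epsilon>) * S \<le> real (card (covered (+) P))" unfolding S_def by (rule sum_card_shapes[OF aa P(1)])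
      also have "\<dots> \<le> real (card D)" using covered_subset[OF aa P(1)] D by (simp add: card_mono)
      also have "\<dots> \<le> (1 - \<epsilon>) * ((1 + 2 * \<epsilon>) * real (card D))"
      proof -
        \<comment> \<open>This amounts to 1/(1 - \<epsilon>) \<le> 1 + 2\<epsilon> for \<epsilon>
          \<le> 1/2.\<close>
        have "0 \<le> \<epsilon> * (1 - 2 * \<epsilon>)" using \<epsilon> by simp
        then have "1 \<le> (1 - \<epsilon>) * (1 + 2 * \<epsilon>)" by (simp add: algebra_simps)
        then have "1 * real (card D) \<le> ((1 - \<epsilon>) * (1 + 2 * \<epsilon>)) * real (card D)" by (intro mult_right_mono) auto
        then show ?thesis by (simp add: mult.assoc)
      qed
      finally show "S \<le> (1 + 2 * \<epsilon>) * real (card D)" using \<epsilon> by simp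
    qed
    also have "ln ?pow = real (card (D - covered (+) P)) * L"
      unfolding L_def by (rule ln_realpow)
    also have "\<dots> \<le> (\<epsilon> * real (card D)) * L" using P(3) L0 by (rule mult_right_mono)
    finally have "ln (real (dyn_num \<alpha> \<W> D)) \<le> (b + (2 * \<epsilon> * b + \<epsilon> * L)) * real (card D)"
      by (simp add: algebra_simps)
    also have "\<dots> \<le> (b + \<kappa>) * real (card D)" using \<epsilon>\<kappa> by (intro mult_right_mono) auto
    finally show ?case using D unfolding dyn_rate_def D_def[symmetric]
      by (simp add: divide_le_eq card_gt_0_iff)
  qed
qed

text \<open>The limit is the infimum of the constants that bound the rate along some Folner
  sequence. A sequence falling below y < Inf B infinitely often would have a subsequence, again
  Folner, that puts y into B. In the other direction, \<open>dyn_rate_upper\<close> transfers a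
  bound from any one Folner sequence to all others, up to an arbitrarily small error.\<close>

theorem Ornstein_Weiss:
  fixes \<alpha> :: "'g::group_add \<Rightarrow> 'x \<Rightarrow> 'x"
  assumes W: "finite \<W>" "\<Union>\<W> = UNIV" and \<alpha>: "\<And>s t. \<alpha> (s + t) = \<alpha> s \<circ> \<alpha> t"
  shows "\<exists>h. \<forall>\<Phi>. folner \<Phi> \<longrightarrow> (\<lambda>n. dyn_rate \<alpha> \<W> (\<Phi> n)) \<longlonglongrightarrow> h"
proof -
  define B where "B = {b. \<exists>\<Phi>. folner \<Phi> \<and> (\<forall>n. dyn_rate \<alpha> \<W> (\<Phi> n) \<le> b)}"
  have bdd: "bdd_below B"
  proof (rule bdd_belowI[of _ 0])
    fix b assume "b \<in> B"
    then obtain \<Phi> where "folner \<Phi>" "dyn_rate \<alpha> \<W> (\<Phi> 0) \<le> b" unfolding B_def by auto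
    moreover have "0 \<le> dyn_rate \<alpha> \<W> (\<Phi> 0)"
      using \<open>folner \<Phi>\<close> by (intro dyn_rate_nonneg[OF W]) (auto simp: folner_def)
    ultimately show "0 \<le> b" by simp
  qed
  have "(\<lambda>n. dyn_rate \<alpha> \<W> (\<Phi> n)) \<longlonglongrightarrow> Inf B" if \<Phi>: "folner \<Phi>" for \<Phi>
  proof (rule order_tendstoI)
    fix y assume y: "y < Inf B"
    show "\<forall>\<^sub>F n in sequentially. y < dyn_rate \<alpha> \<W> (\<Phi> n)"
    proof (rule ccontr)
      assume "\<not> (\<forall>\<^sub>F n in sequentially. y < dyn_rate \<alpha> \<W> (\<Phi> n))"
      then have "\<exists>\<^sub>F n in sequentially. dyn_rate \<alpha> \<W> (\<Phi> n) \<le> y"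
        by (simp add: frequently_def not_le)
      then have "infinite {n. dyn_rate \<alpha> \<W> (\<Phi> n) \<le> y}"
        by (simp add: frequently_cofinite[symmetric] cofinite_eq_sequentially)
      then obtain r :: "nat \<Rightarrow> nat" where r: "strict_mono r" "\<And>n. r n \<in> {n. dyn_rate \<alpha> \<W> (\<Phi> n) \<le> y}"
        using infinite_enumerate by metis
      then have "folner (\<Phi> \<circ> r)" "\<forall>n. dyn_rate \<alpha> \<W> ((\<Phi> \<circ> r) n) \<le> y"
        using folner_subseq[OF \<Phi>] by auto
      then have "y \<in> B" unfolding B_def by blast
      then have "Inf B \<le> y" by (rule cInf_lower[OF _ bdd])
      with y show False by simp
    qed
  next
    fix y assume "Inf B < y"
    moreover have "B \<noteq> {}"
    proof -
      have "dyn_rate \<alpha> \<W> (\<Phi> n) \<le> ln (real (card \<W>))" for n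
      proof -
        have F: "finite (\<Phi> n)" "\<Phi> n \<noteq> {}" using \<Phi> unfolding folner_def by auto
        have "\<W> \<noteq> {}" using W(2) by auto
        then have c: "0 < real (card \<W>)" using W(1) by (simp add: card_gt_0_iff)
        have "real (dyn_num \<alpha> \<W> (\<Phi> n)) \<le> real (card \<W>) ^ card (\<Phi> n)"
          using dyn_num_le_power[OF W F(1), of \<alpha>] by (simp only: of_nat_le_iff flip: of_nat_power)
        then have "ln (real (dyn_num \<alpha> \<W> (\<Phi> n))) \<le> ln (real (card \<W>) ^ card (\<Phi> n))"
          using dyn_num_pos[OF W F(1), of \<alpha>] c by simp
        then show ?thesis using F c unfolding dyn_rate_def
          by (simp add: ln_realpow divide_le_eq card_gt_0_iff mult.commute)
      qed
      then show ?thesis using \<Phi> unfolding B_def by blast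
    qed
    ultimately obtain b where b: "b \<in> B" "b < y" using cInf_lessD by blast
    then obtain \<Psi> where "folner \<Psi>" "\<And>n. dyn_rate \<alpha> \<W> (\<Psi> n) \<le> b" unfolding B_def by auto
    from dyn_rate_upper[OF W \<alpha> this \<Phi>, of "(y - b) / 2"] b(2)
    have "\<forall>\<^sub>F n in sequentially. dyn_rate \<alpha> \<W> (\<Phi> n) \<le> b + (y - b) / 2" by simp
    then show "\<forall>\<^sub>F n in sequentially. dyn_rate \<alpha> \<W> (\<Phi> n) < y"
      by eventually_elim (use b(2) in \<open>simp add: field_simps\<close>)
  qed
  then show ?thesis by blast
qed

text \<open>Justifies the description by \<open>THE\<close>: amenability supplies a Folner sequence,
  without which the value would not be unique, and positive covering numbers keep -\<infinity>
  out.\<close>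

lemma amenable_entropy_cover_limit:
  assumes W: "finite \<W>" "\<Union>\<W> = UNIV" and \<alpha>: "\<And>s t. \<alpha> (s + t) = \<alpha> s \<circ> \<alpha> t"
    and "amenable TYPE('g)"
  obtains h where "amenable_entropy_cover (\<alpha> :: 'g::group_add \<Rightarrow> 'x \<Rightarrow> 'x) \<W> = ereal h"
    "\<And>\<Phi>. folner \<Phi> \<Longrightarrow> (\<lambda>n. dyn_rate \<alpha> \<W> (\<Phi> n)) \<longlonglongrightarrow> h"
proof -
  obtain h where h: "\<And>\<Phi>. folner \<Phi> \<Longrightarrow> (\<lambda>n. dyn_rate \<alpha> \<W> (\<Phi> n)) \<longlonglongrightarrow> h"
    using Ornstein_Weiss[OF W \<alpha>] by blast
  obtain \<Phi> :: "nat \<Rightarrow> 'g set" where \<Phi>: "folner \<Phi>" using assms(4) unfolding amenable_def by blast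
  have eq: "ereal (1 / real (card (F n))) * log_nat (cov_num (dyn_cover \<alpha> (F n) \<W>) UNIV)
      = ereal (dyn_rate \<alpha> \<W> (F n))" if "folner F" for F :: "nat \<Rightarrow> 'g set" and n
  proof -
    have "0 < dyn_num \<alpha> \<W> (F n)" using that by (intro dyn_num_pos[OF W]) (auto simp: folner_def)
    then show ?thesis unfolding log_nat_def dyn_rate_def dyn_num_def by simp
  qed
  have "amenable_entropy_cover \<alpha> \<W> = ereal h"
    unfolding amenable_entropy_cover_def
  proof (rule the_equality)
    show "\<forall>F. folner F \<longrightarrow> (\<lambda>n. ereal (1 / real (card (F n))) *
        log_nat (cov_num (dyn_cover \<alpha> (F n) \<W>) UNIV)) \<longlonglongrightarrow> ereal h"
    proof (intro allI impI)
      fix F :: "nat \<Rightarrow> 'g set" assume F: "folner F"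
      show "(\<lambda>n. ereal (1 / real (card (F n))) * log_nat (cov_num (dyn_cover \<alpha> (F n) \<W>) UNIV))
          \<longlonglongrightarrow> ereal h"
        unfolding eq[OF F] using h[OF F] by simp
    qed
    fix h' assume h': "\<forall>F. folner F \<longrightarrow> (\<lambda>n. ereal (1 / real (card (F n))) *
        log_nat (cov_num (dyn_cover \<alpha> (F n) \<W>) UNIV)) \<longlonglongrightarrow> h'"
    have "(\<lambda>n. ereal (dyn_rate \<alpha> \<W> (\<Phi> n))) \<longlonglongrightarrow> h'"
      using h'[rule_format, OF \<Phi>] by (simp only: eq[OF \<Phi>])
    moreover have "(\<lambda>n. ereal (dyn_rate \<alpha> \<W> (\<Phi> n))) \<longlonglongrightarrow> ereal h" using h[OF \<Phi>] by simp
    ultimately show "h' = ereal h" using LIMSEQ_unique by blast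
  qed
  then show ?thesis using that h by blast
qed

section \<open>Separated sets and sofic orbits\<close>

text \<open>The map \<open>f\<close> assigns coordinates to labels. One notion then covers points of
  X^d, with \<open>f\<close> the identity, and orbit segments, with \<open>\<alpha> s x\<close> as
  the coordinate of \<open>x\<close> at \<open>s\<close>.\<close>

definition separated :: "'i set \<Rightarrow> real \<Rightarrow> ('a \<Rightarrow> 'i \<Rightarrow> 'x::metric_space) \<Rightarrow> 'a set \<Rightarrow> bool" where
  "separated I \<epsilon> f Z \<longleftrightarrow> (\<forall>z\<in>Z. \<forall>z'\<in>Z. z \<noteq> z' \<longrightarrow> (\<exists>i\<in>I. \<epsilon> \<le> dist (f z i) (f z' i)))"

text \<open>Rounding all coordinates to a finite \<epsilon>/2-net is injective on a separated set.
  The bound is uniform, so that a separated set of greatest cardinality exists; such a set is also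
  spanning.\<close>

lemma separated_bounded:
  assumes "compact (UNIV :: 'x::metric_space set)" "0 < \<epsilon>" "finite I"
  shows "\<exists>b. \<forall>Z. separated I \<epsilon> (f :: 'a \<Rightarrow> 'i \<Rightarrow> 'x) Z \<longrightarrow> finite Z \<and> card Z \<le> b"
proof -
  obtain C :: "'x set" where C: "finite C" "UNIV \<subseteq> (\<Union>c\<in>C. ball c (\<epsilon> / 2))"
    using assms(1,2) half_gt_zero[OF assms(2)] unfolding compact_eq_totally_bounded by blast
  have "\<exists>c. c \<in> C \<and> dist c x < \<epsilon> / 2" for x
  proof -
    have "x \<in> (\<Union>c\<in>C. ball c (\<epsilon> / 2))" using C(2) by (rule subsetD) simp
    then show ?thesis by auto
  qed
  then obtain c where c: "\<And>x. c x \<in> C" "\<And>x. dist (c x) x < \<epsilon> / 2" by metis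
  have fin: "finite (I \<rightarrow>\<^sub>E C)" using C(1) assms(3) by (intro finite_PiE)
  have "finite Z \<and> card Z \<le> card (I \<rightarrow>\<^sub>E C)" if Z: "separated I \<epsilon> f Z" for Z
  proof -
    let ?g = "\<lambda>z. \<lambda>i\<in>I. c (f z i)"
    have "inj_on ?g Z"
    proof (rule inj_onI, rule ccontr)
      fix z z' assume z: "z \<in> Z" "z' \<in> Z" "?g z = ?g z'" "z \<noteq> z'"
      then obtain i where i: "i \<in> I" "\<epsilon> \<le> dist (f z i) (f z' i)" using Z unfolding separated_def by meson
      have "c (f z i) = c (f z' i)" using fun_cong[OF z(3), of i] i(1) by simp
      moreover have "dist (f z i) (f z' i) \<le> dist (c (f z i)) (f z i) + dist (c (f z i)) (f z' i)"
        by (metis dist_commute dist_triangle)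
      ultimately show False using c(2)[of "f z i"] c(2)[of "f z' i"] i(2) by simp
    qed
    moreover have "?g ` Z \<subseteq> I \<rightarrow>\<^sub>E C" using c(1) by auto
    ultimately show ?thesis using fin by (meson card_inj_on_le finite_imageD finite_subset)
  qed
  then show ?thesis by blast
qed

lemma maximal_separated:
  assumes "compact (UNIV :: 'x::metric_space set)" "0 < \<epsilon>" "finite I"
  obtains Z where "Z \<subseteq> S" "finite Z" "separated I \<epsilon> (f :: 'a \<Rightarrow> 'i \<Rightarrow> 'x) Z"
    "\<And>x. x \<in> S \<Longrightarrow> \<exists>z\<in>Z. \<forall>i\<in>I. dist (f x i) (f z i) < \<epsilon>"
proof -
  obtain b where b: "\<And>Z. separated I \<epsilon> f Z \<Longrightarrow> finite Z \<and> card Z \<le> b"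
    using separated_bounded[OF assms, of f] by blast
  let ?P = "\<lambda>Z. Z \<subseteq> S \<and> separated I \<epsilon> f Z"
  have "?P {}" unfolding separated_def by simp
  moreover have "\<forall>Z. ?P Z \<longrightarrow> card Z < Suc b" using b by (simp add: less_Suc_eq_le)
  ultimately obtain Z where Z: "?P Z" "\<And>Z'. ?P Z' \<Longrightarrow> card Z' \<le> card Z"
    using ex_has_greatest_nat[of ?P "{}" card "Suc b"] by blast
  have "\<exists>z\<in>Z. \<forall>i\<in>I. dist (f x i) (f z i) < \<epsilon>" if x: "x \<in> S" for x
  proof (rule ccontr)
    assume neg: "\<not> (\<exists>z\<in>Z. \<forall>i\<in>I. dist (f x i) (f z i) < \<epsilon>)"
    then have far: "\<exists>i\<in>I. \<epsilon> \<le> dist (f x i) (f z i)" if "z \<in> Z" for z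
      using that by (simp add: not_less)
    then have far': "\<exists>i\<in>I. \<epsilon> \<le> dist (f z i) (f x i)" if "z \<in> Z" for z
      using that by (metis dist_commute)
    have "x \<notin> Z" using neg assms(2) by force
    have "?P (insert x Z)" using Z(1) x far far' unfolding separated_def by blast
    with Z(2) have "card (insert x Z) \<le> card Z" by blast
    then show False using \<open>x \<notin> Z\<close> b[of Z] Z(1) by simp
  qed
  then show ?thesis using that Z(1) b by blast
qed

lemma lebesgue_number:
  assumes "compact (UNIV :: 'x::metric_space set)" "\<U> \<in> open_covers"
  obtains \<epsilon> where "0 < \<epsilon>" "\<And>x :: 'x. \<exists>U\<in>\<U>. ball x \<epsilon> \<subseteq> U"
proof -
  have U: "UNIV \<subseteq> \<Union>\<U>" "\<And>G. G \<in> \<U> \<Longrightarrow> open G" using assms(2) unfolding open_covers_def by auto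
  show ?thesis using Heine_Borel_lemma[OF assms(1) U] that by (metis UNIV_I)
qed

lemma fine_open_cover:
  assumes "compact (UNIV :: 'x::metric_space set)" "0 < \<epsilon>"
  obtains \<U> :: "'x::metric_space set set" where "\<U> \<in> open_covers"
    "\<And>U x y. U \<in> \<U> \<Longrightarrow> x \<in> U \<Longrightarrow> y \<in> U \<Longrightarrow> dist x y < \<epsilon>"
proof -
  obtain C :: "'x set" where C: "finite C" "UNIV \<subseteq> (\<Union>c\<in>C. ball c (\<epsilon> / 2))"
    using assms(1) half_gt_zero[OF assms(2)] unfolding compact_eq_totally_bounded by blast
  have "(\<lambda>c. ball c (\<epsilon> / 2)) ` C \<in> open_covers"
    using C unfolding open_covers_def by auto
  moreover have "dist x y < \<epsilon>" if U: "U \<in> (\<lambda>c. ball c (\<epsilon> / 2)) ` C" "x \<in> U" "y \<in> U" for U x y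
  proof -
    obtain c where "dist c x < \<epsilon> / 2" "dist c y < \<epsilon> / 2" using U by auto
    then show ?thesis by (metis dist_commute dist_triangle_half_r)
  qed
  ultimately show ?thesis using that by blast
qed

lemma dyn_num_le_card:
  assumes \<epsilon>: "\<And>x :: 'x::metric_space. \<exists>U\<in>\<W>. ball x \<epsilon> \<subseteq> U"
    and E: "finite E" "\<And>x. \<exists>e\<in>E. \<forall>s\<in>A. dist (\<alpha> s x) (\<alpha> s e) < \<epsilon>"
  shows "dyn_num \<alpha> \<W> A \<le> card E"
proof -
  obtain U where U: "\<And>x. U x \<in> \<W>" "\<And>x. ball x \<epsilon> \<subseteq> U x" using \<epsilon> by metis
  let ?Q = "\<lambda>e. {x. \<forall>s\<in>A. \<alpha> s x \<in> U (\<alpha> s e)}"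
  have "dyn_num \<alpha> \<W> A \<le> card (?Q ` E)"
    unfolding dyn_num_def
  proof (rule cov_num_le)
    show "?Q ` E \<subseteq> dyn_cover \<alpha> A \<W>"
    proof (rule image_subsetI)
      fix e show "?Q e \<in> dyn_cover \<alpha> A \<W>"
        unfolding mem_dyn_cover using U(1) by (intro exI[of _ "\<lambda>s. U (\<alpha> s e)"]) simp
    qed
    show "UNIV \<subseteq> \<Union> (?Q ` E)"
    proof
      fix x
      obtain e where "e \<in> E" "\<forall>s\<in>A. dist (\<alpha> s x) (\<alpha> s e) < \<epsilon>" using E(2) by blast
      moreover from this have "x \<in> ?Q e" using subsetD[OF U(2)] by (auto simp: dist_commute)
      ultimately show "x \<in> \<Union> (?Q ` E)" by blast
    qed
  qed (use E(1) in simp)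
  also have "\<dots> \<le> card E" using E(1) by (rule card_image_le)
  finally show ?thesis .
qed

section \<open>Mean-square closeness and counts of bad coordinates\<close>

lemma sofic_orbits_deviation:
  assumes x: "x \<in> sofic_orbits \<alpha> F \<delta> d \<tau>" and "finite F" "s \<in> F" "0 < r"
  shows "real (card {j\<in>{1..d}. r \<le> dist (\<alpha> s (x j)) (x (\<tau> s j))}) \<le> (\<delta> / r)\<^sup>2 * real d"
proof (cases "d = 0")
  case False
  let ?D = "\<lambda>j. dist (\<alpha> s (x j)) (x (\<tau> s j))"
  let ?B = "{j\<in>{1..d}. r \<le> ?D j}"
  have nn: "0 \<le> (\<Sum>j=1..d. 1 / real d * (?D j)\<^sup>2)" by (intro sum_nonneg) auto
  have "sqrt (\<Sum>j=1..d. 1 / real d * (?D j)\<^sup>2) \<le>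
      (MAX s\<in>F. sqrt (\<Sum>j=1..d. 1 / real d * (dist (\<alpha> s (x j)) (x (\<tau> s j)))\<^sup>2))"
    using assms by (intro Max_ge) auto
  also have "\<dots> < \<delta>" using x unfolding sofic_orbits_def by auto
  finally have lt: "sqrt (\<Sum>j=1..d. 1 / real d * (?D j)\<^sup>2) < \<delta>" .
  then have "(sqrt (\<Sum>j=1..d. 1 / real d * (?D j)\<^sup>2))\<^sup>2 \<le> \<delta>\<^sup>2"
    using nn by (intro power_mono) auto
  then have le: "(\<Sum>j=1..d. 1 / real d * (?D j)\<^sup>2) \<le> \<delta>\<^sup>2" using nn by simp
  \<comment> \<open>Chebyshev's inequality: every bad coordinate contributes at least r^2/d to the
    mean square.\<close>
  have "real (card ?B) * (1 / real d * r\<^sup>2) = (\<Sum>j\<in>?B. 1 / real d * r\<^sup>2)" by simp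
  also have "\<dots> \<le> (\<Sum>j\<in>?B. 1 / real d * (?D j)\<^sup>2)"
    using assms(4) by (intro sum_mono mult_left_mono power_mono) auto
  also have "\<dots> \<le> (\<Sum>j=1..d. 1 / real d * (?D j)\<^sup>2)" by (intro sum_mono2) auto
  finally have "real (card ?B) * (1 / real d * r\<^sup>2) \<le> \<delta>\<^sup>2" using le by linarith
  then show ?thesis using False assms(4) by (simp add: field_simps power_divide)
qed simp

text \<open>Converse of \<open>sofic_orbits_deviation\<close>. Good coordinates deviate by less than
  \<delta>/2 and the others by at most M, so the mean square is at most \<delta>^2/4 + M^2 \<theta>
  \<le> 3\<delta>^2/4, which leaves room for the strict inequality.\<close>

lemma sofic_orbitsI:
  fixes x :: "nat \<Rightarrow> 'x::metric_space" and \<tau> :: "'g \<Rightarrow> nat \<Rightarrow> nat"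
  assumes x: "x \<in> {1..d} \<rightarrow>\<^sub>E UNIV" and F: "finite F" "F \<noteq> {}" and "0 < \<delta>"
    and M: "\<And>u v :: 'x. dist u v \<le> M" and \<theta>: "M\<^sup>2 * \<theta> \<le> \<delta>\<^sup>2 / 2"
    and dev: "\<And>s. s \<in> F \<Longrightarrow> real (card {j\<in>{1..d}. \<delta> / 2 \<le> dist (\<alpha> s (x j)) (x (\<tau> s j))}) \<le> \<theta> * real d"
  shows "x \<in> sofic_orbits \<alpha> F \<delta> d \<tau>"
proof -
  have "sqrt (\<Sum>j=1..d. 1 / real d * (dist (\<alpha> s (x j)) (x (\<tau> s j)))\<^sup>2) < \<delta>" if s: "s \<in> F" for s
  proof (cases "d = 0")
    case False
    let ?D = "\<lambda>j. dist (\<alpha> s (x j)) (x (\<tau> s j))"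
    let ?B = "{j\<in>{1..d}. \<delta> / 2 \<le> ?D j}"
    have "(\<Sum>j=1..d. 1 / real d * (?D j)\<^sup>2) \<le>
        (\<Sum>j=1..d. 1 / real d * ((\<delta> / 2)\<^sup>2 + (if j \<in> ?B then M\<^sup>2 else 0)))"
    proof (intro sum_mono mult_left_mono)
      fix j assume "j \<in> {1..d}"
      show "(?D j)\<^sup>2 \<le> (\<delta> / 2)\<^sup>2 + (if j \<in> ?B then M\<^sup>2 else 0)"
      proof (cases "j \<in> ?B")
        case True
        have "(?D j)\<^sup>2 \<le> M\<^sup>2" using M by (intro power_mono) auto
        then show ?thesis using True by (simp add: add_increasing)
      next
        case False
        then have "(?D j)\<^sup>2 \<le> (\<delta> / 2)\<^sup>2" using \<open>j \<in> {1..d}\<close> by (intro power_mono) auto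
        then show ?thesis unfolding if_not_P[OF False] by simp
      qed
    qed simp
    also have "\<dots> = 1 / real d * (real d * (\<delta> / 2)\<^sup>2 + real (card ?B) * M\<^sup>2)"
      by (simp add: sum_distrib_left[symmetric] sum_divide_distrib[symmetric] sum.distrib
          sum.If_cases Int_def Collect_conj_eq[symmetric])
    also have "\<dots> \<le> 1 / real d * (real d * (\<delta> / 2)\<^sup>2 + (\<theta> * real d) * M\<^sup>2)"
      using dev[OF s] by (intro mult_left_mono add_left_mono mult_right_mono) auto
    also have "\<dots> = (\<delta> / 2)\<^sup>2 + M\<^sup>2 * \<theta>" using False by (simp add: field_simps)
    also have "\<dots> \<le> 3 / 4 * \<delta>\<^sup>2" using \<theta> by (simp add: power_divide mult.commute)
    also have "\<dots> < \<delta>\<^sup>2" using \<open>0 < \<delta>\<close> by simp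
    finally show ?thesis using \<open>0 < \<delta>\<close> by (intro real_less_lsqrt) auto
  qed (use \<open>0 < \<delta>\<close> in simp)
  then have "(MAX s\<in>F. sqrt (\<Sum>j=1..d. 1 / real d * (dist (\<alpha> s (x j)) (x (\<tau> s j)))\<^sup>2)) < \<delta>"
    using F by simp
  then show ?thesis using x unfolding sofic_orbits_def by simp
qed

lemma compact_dist_bounded:
  assumes "compact (UNIV :: 'x::metric_space set)"
  obtains M where "0 < M" "\<And>u v :: 'x. dist u v \<le> M"
proof -
  have b: "bounded (UNIV :: 'x set)" using assms by (rule compact_imp_bounded)
  have "dist u v \<le> diameter (UNIV :: 'x set) + 1" for u v :: 'x
    using diameter_bounded_bound[OF b, of u v] by simp
  moreover have "0 < diameter (UNIV :: 'x set) + 1" using diameter_ge_0[OF b] by simp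
  ultimately show ?thesis using that by blast
qed

text \<open>Disjoint cores determine the tile of a covered point, and injectivity of s \<mapsto>
  \<open>\<tau> s c\<close> on \<open>T\<close> its position there. A point of X^d can therefore be
  prescribed tile by tile.\<close>

lemma core_coordinates:
  assumes "approx_action T D \<tau> D0" "quasi_tiling \<epsilon> \<tau> D0 T P"
  obtains loc where "\<And>c F A s. (c, F, A) \<in> P \<Longrightarrow> s \<in> A \<Longrightarrow> loc (\<tau> s c) = ((c, F, A), s)"
proof -
  let ?g = "\<lambda>(p, s). \<tau> s (fst p)"
  have "inj_on ?g (SIGMA p:P. snd (snd p))"
  proof (rule inj_onI)
    fix u v
    assume uv: "u \<in> (SIGMA p:P. snd (snd p))" "v \<in> (SIGMA p:P. snd (snd p))" "?g u = ?g v"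
    obtain c F A s where u: "u = ((c, F, A), s)" by (metis prod.exhaust)
    obtain c' F' A' s' where v: "v = ((c', F', A'), s')" by (metis prod.exhaust)
    have p: "(c, F, A) \<in> P" "(c', F', A') \<in> P" and s: "s \<in> A" "s' \<in> A'" and eq: "\<tau> s c = \<tau> s' c'"
      using uv unfolding u v by auto
    have "\<tau> s c \<in> core \<tau> (c, F, A)" using s unfolding core_def by simp
    moreover have "\<tau> s c \<in> core \<tau> (c', F', A')" using s unfolding eq core_def by simp
    ultimately have "core \<tau> (c, F, A) \<inter> core \<tau> (c', F', A') \<noteq> {}" by (metis IntI empty_iff)
    moreover have disj: "disjoint_family_on (core \<tau>) P" using assms(2) unfolding quasi_tiling_def by simp
    ultimately have pp: "(c, F, A) = (c', F', A')" using disjoint_family_onD[OF disj p] by argo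
    have "inj_on (\<lambda>s. \<tau> s c) T"
      using assms(1) quasi_tiling_tile(1)[OF assms(2) p(1)] unfolding approx_action_def by blast
    moreover have "s \<in> T" "s' \<in> T" using quasi_tiling_tile(4,5)[OF assms(2) p(1)] s pp by auto
    ultimately have "s = s'" using eq pp by (auto dest: inj_onD)
    with pp show "u = v" unfolding u v by simp
  qed
  then have "the_inv_into (SIGMA p:P. snd (snd p)) ?g (\<tau> s c) = ((c, F, A), s)"
    if "(c, F, A) \<in> P" "s \<in> A" for c F A s
    using the_inv_into_f_f[of ?g "SIGMA p:P. snd (snd p)" "((c, F, A), s)"] that by simp
  then show ?thesis using that by blast
qed

text \<open>An element that s moves out of \<open>A\<close> is moved out of \<open>H\<close> or into
  \<open>H - A\<close>.\<close>

lemma card_not_shifted: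
  fixes s :: "'g::group_add"
  assumes "finite H" "A \<subseteq> H"
  shows "card {t\<in>A. s + t \<notin> A} \<le> card ((+) s ` H - H) + card (H - A)"
proof -
  have "card {t\<in>A. s + t \<notin> A} \<le> card (((+) s ` H - H) \<union> (H - A))"
    using assms by (intro card_inj_on_le[of "(+) s"]) (auto simp: inj_on_def)
  also have "\<dots> \<le> card ((+) s ` H - H) + card (H - A)" by (rule card_Un_le)
  finally show ?thesis .
qed

text \<open>An exponential-moment bound in place of binomial estimates. Give a function the weight t
  to the number of its entries other than \<open>None\<close>: sparse functions weigh at least
  \<open>t powr m\<close>, and the total weight of all functions factorises over the
  coordinates.\<close>

lemma card_sparse_PiE:
  assumes "finite D" "finite W" "0 < t" "t \<le> 1"
  shows "real (card {f \<in> D \<rightarrow>\<^sub>E insert None (Some ` W). real (card {j\<in>D. f j \<noteq> None}) \<le> m}) * t powr m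
    \<le> (1 + t * real (card W)) ^ card D"
proof -
  let ?O = "insert None (Some ` W)"
  let ?F = "{f \<in> D \<rightarrow>\<^sub>E ?O. real (card {j\<in>D. f j \<noteq> None}) \<le> m}"
  have fin: "finite (D \<rightarrow>\<^sub>E ?O)" using assms by (intro finite_PiE) auto
  have weight: "(\<Prod>j\<in>D. if f j = None then 1 else t) = t ^ card {j\<in>D. f j \<noteq> None}" for f :: "'a \<Rightarrow> 'b option"
  proof -
    have "D \<inter> - {j. f j = None} = {j\<in>D. f j \<noteq> None}" by auto
    then show ?thesis using assms(1) by (simp add: prod.If_cases)
  qed
  have "real (card ?F) * t powr m = (\<Sum>f\<in>?F. t powr m)" by simp
  also have "\<dots> \<le> (\<Sum>f\<in>?F. \<Prod>j\<in>D. if f j = None then 1 else t)"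
  proof (rule sum_mono)
    fix f assume "f \<in> ?F"
    then have "t powr m \<le> t powr real (card {j\<in>D. f j \<noteq> None})" using assms by (intro powr_mono') auto
    then show "t powr m \<le> (\<Prod>j\<in>D. if f j = None then 1 else t)"
      unfolding weight using assms(3) by (simp add: powr_realpow)
  qed
  also have "\<dots> \<le> (\<Sum>f\<in>D \<rightarrow>\<^sub>E ?O. \<Prod>j\<in>D. if f j = None then 1 else t)"
    using fin assms(3) by (intro sum_mono2) (auto intro: prod_nonneg)
  also have "\<dots> = (\<Prod>j\<in>D. \<Sum>v\<in>?O. if v = None then 1 else t)"
    using assms by (intro prod_sum_PiE[symmetric]) auto
  also have "(\<Sum>v\<in>?O. if v = None then 1 else t) = 1 + t * real (card W)"
    using assms(2) by (simp add: sum.reindex image_iff mult.commute)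
  finally show ?thesis by simp
qed

text \<open>The one expression x - y + z serves three purposes: combining sofic orbits into a new
  one, staying close to z when x is close to y, and recovering x as w - z + y from w = x - y +
  z.\<close>

lemma uniformly_continuous_diff_add:
  assumes "compact (UNIV :: 'x::{metric_space, topological_group_add} set)" "0 < e"
  obtains r where "0 < r"
    "\<And>x y z x' y' z' :: 'x. dist x x' < r \<Longrightarrow> dist y y' < r \<Longrightarrow> dist z z' < r \<Longrightarrow>
      dist (x - y + z) (x' - y' + z') < e"
proof -
  let ?f = "\<lambda>p :: 'x \<times> 'x \<times> 'x. fst p - fst (snd p) + snd (snd p)"
  have "compact (UNIV :: ('x \<times> 'x \<times> 'x) set)"
    using compact_Times[OF assms(1) compact_Times[OF assms(1) assms(1)]] by simp
  moreover have "continuous_on UNIV ?f" by (intro continuous_intros)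
  ultimately have "uniformly_continuous_on UNIV ?f" by (intro compact_uniformly_continuous)
  then obtain r where r: "0 < r" "\<And>p q. dist p q < r \<Longrightarrow> dist (?f p) (?f q) < e"
    using assms(2) unfolding uniformly_continuous_on_def by (metis UNIV_I dist_commute)
  have "dist (x - y + z) (x' - y' + z') < e"
    if "dist x x' < r / 3" "dist y y' < r / 3" "dist z z' < r / 3" for x y z x' y' z' :: 'x
  proof -
    have "dist (x, y, z) (x', y', z') \<le> dist x x' + (dist y y' + dist z z')"
      unfolding dist_Pair_Pair
      by (intro order_trans[OF sqrt_sum_squares_le_sum] add_left_mono sqrt_sum_squares_le_sum)
        simp_all
    then have "dist (x, y, z) (x', y', z') < r" using that by linarith
    then show ?thesis using r(2)[of "(x, y, z)" "(x', y', z')"] by simp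
  qed
  then show ?thesis using that[of "r / 3"] r(1) by simp
qed

section \<open>Covers of X^d against separated sets\<close>

lemma finite_power_cover:
  assumes "finite \<U>"
  shows "finite (power_cover n \<U>)" "card (power_cover n \<U>) \<le> card \<U> ^ n"
proof -
  have eq: "power_cover n \<U> = Pi\<^sub>E {1..n} ` ({1..n} \<rightarrow>\<^sub>E \<U>)"
  proof (intro equalityI subsetI)
    fix V assume "V \<in> power_cover n \<U>"
    then obtain U where U: "\<forall>j\<in>{1..n}. U j \<in> \<U>" "V = Pi\<^sub>E {1..n} U" unfolding power_cover_def by blast
    have V: "V = Pi\<^sub>E {1..n} (restrict U {1..n})" unfolding U(2) by (rule PiE_cong) simp
    show "V \<in> Pi\<^sub>E {1..n} ` ({1..n} \<rightarrow>\<^sub>E \<U>)"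
      unfolding V using U(1) by (intro imageI restrict_PiE_iff[THEN iffD2])
  next
    fix V assume "V \<in> Pi\<^sub>E {1..n} ` ({1..n} \<rightarrow>\<^sub>E \<U>)"
    then obtain U where U: "V = Pi\<^sub>E {1..n} U" "U \<in> {1..n} \<rightarrow>\<^sub>E \<U>" by (rule imageE)
    then show "V \<in> power_cover n \<U>"
      unfolding power_cover_def using PiE_mem[OF U(2)] by (intro CollectI exI[of _ U]) simp
  qed
  have fin: "finite ({1..n} \<rightarrow>\<^sub>E \<U>)" using assms by (intro finite_PiE) auto
  then show "finite (power_cover n \<U>)" unfolding eq by simp
  \<comment> \<open>Different families of factors may give the same product, for instance when a
    factor is empty.\<close>
  have "card (power_cover n \<U>) \<le> card ({1..n} \<rightarrow>\<^sub>E \<U>)" unfolding eq using fin by (rule card_image_le)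
  then show "card (power_cover n \<U>) \<le> card \<U> ^ n" by (simp add: card_PiE)
qed

lemma Union_power_cover:
  assumes "\<Union>\<U> = UNIV"
  shows "{1..n} \<rightarrow>\<^sub>E UNIV \<subseteq> \<Union>(power_cover n \<U>)"
proof
  fix x :: "nat \<Rightarrow> 'a" assume x: "x \<in> {1..n} \<rightarrow>\<^sub>E UNIV"
  have "\<exists>U. U \<in> \<U> \<and> x j \<in> U" for j
  proof -
    have "x j \<in> \<Union>\<U>" unfolding assms by simp
    then show ?thesis by blast
  qed
  then obtain U where U: "\<And>j. U j \<in> \<U>" "\<And>j. x j \<in> U j" by metis
  have "x \<in> Pi\<^sub>E {1..n} U" using x U(2) by auto
  moreover have "Pi\<^sub>E {1..n} U \<in> power_cover n \<U>" unfolding power_cover_def using U(1) by blast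
  ultimately show "x \<in> \<Union>(power_cover n \<U>)" by blast
qed

lemma cov_num_power_le_card:
  assumes \<epsilon>: "\<And>x :: 'x::metric_space. \<exists>U\<in>\<U>. ball x \<epsilon> \<subseteq> U"
    and S: "S \<subseteq> {1..n} \<rightarrow>\<^sub>E UNIV"
    and Z: "finite Z" "\<And>x. x \<in> S \<Longrightarrow> \<exists>z\<in>Z. \<forall>j\<in>{1..n}. dist (x j) (z j) < \<epsilon>"
  shows "cov_num (power_cover n \<U>) S \<le> card Z"
proof -
  obtain U where U: "\<And>x. U x \<in> \<U>" "\<And>x. ball x \<epsilon> \<subseteq> U x" using \<epsilon> by metis
  let ?Q = "\<lambda>z. Pi\<^sub>E {1..n} (\<lambda>j. U (z j))"
  have "cov_num (power_cover n \<U>) S \<le> card (?Q ` Z)"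
  proof (rule cov_num_le)
    show "?Q ` Z \<subseteq> power_cover n \<U>" unfolding power_cover_def using U(1) by blast
    show "S \<subseteq> \<Union> (?Q ` Z)"
    proof
      fix x assume x: "x \<in> S"
      then obtain z where z: "z \<in> Z" "\<forall>j\<in>{1..n}. dist (x j) (z j) < \<epsilon>" using Z(2) by blast
      have "x j \<in> U (z j)" if "j \<in> {1..n}" for j
        using subsetD[OF U(2), of "x j" "z j"] bspec[OF z(2) that] by (simp add: dist_commute)
      then have "x \<in> ?Q z" using subsetD[OF S x] by auto
      then show "x \<in> \<Union> (?Q ` Z)" using z(1) by blast
    qed
  qed (use Z(1) in simp)
  also have "\<dots> \<le> card Z" using Z(1) by (rule card_image_le)
  finally show ?thesis .
qed

text \<open>A product of sets of diameter below \<epsilon> contains at most one point of an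
  \<epsilon>-separated set. Together with \<open>cov_num_power_le_card\<close>, which works at the
  scale of a Lebesgue number, this translates between covering numbers and separated sets.\<close>

lemma card_le_cov_num_power:
  assumes U: "finite \<U>" "\<Union>\<U> = UNIV" "\<And>U x y. U \<in> \<U> \<Longrightarrow> x \<in> U \<Longrightarrow> y \<in> U \<Longrightarrow> dist x y < \<epsilon>"
    and K: "K \<subseteq> {1..n} \<rightarrow>\<^sub>E UNIV"
    and Z: "Z \<subseteq> K" "separated {1..n} \<epsilon> (\<lambda>z. z :: nat \<Rightarrow> 'x::metric_space) Z"
  shows "card Z \<le> cov_num (power_cover n \<U>) K"
proof -
  obtain \<W> where W: "\<W> \<subseteq> power_cover n \<U>" "finite \<W>" "card \<W> = cov_num (power_cover n \<U>) K" "K \<subseteq> \<Union>\<W>"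
    by (rule cov_num_witness[OF finite_power_cover(1)[OF U(1)] order_trans[OF K Union_power_cover[OF U(2)]]])
  have "\<forall>z\<in>Z. \<exists>w. w \<in> \<W> \<and> z \<in> w" using Z(1) W(4) by blast
  then obtain w where w: "\<And>z. z \<in> Z \<Longrightarrow> w z \<in> \<W>" "\<And>z. z \<in> Z \<Longrightarrow> z \<in> w z" by metis
  have "inj_on w Z"
  proof (rule inj_onI, rule ccontr)
    fix z z' assume z: "z \<in> Z" "z' \<in> Z" "w z = w z'" "z \<noteq> z'"
    then obtain j where j: "j \<in> {1..n}" "\<epsilon> \<le> dist (z j) (z' j)" using Z(2) unfolding separated_def by blast
    have "w z \<in> power_cover n \<U>" using w(1)[OF z(1)] W(1) by blast
    then obtain V where V: "\<forall>j\<in>{1..n}. V j \<in> \<U>" "w z = Pi\<^sub>E {1..n} V" unfolding power_cover_def by blast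
    have "z \<in> Pi\<^sub>E {1..n} V" "z' \<in> Pi\<^sub>E {1..n} V" using w(2)[OF z(1)] w(2)[OF z(2)] z(3) V(2) by simp_all
    then have "z j \<in> V j" "z' j \<in> V j" using j(1) by (auto dest: PiE_mem)
    then have "dist (z j) (z' j) < \<epsilon>" using U(3) V(1) j(1) by blast
    with j(2) show False by simp
  qed
  moreover have "w ` Z \<subseteq> \<W>" using w(1) by blast
  ultimately show ?thesis using card_inj_on_le[of w Z \<W>] W(2,3) by simp
qed

lemma log_nat_le:
  assumes "real n \<le> exp c"
  shows "log_nat n \<le> ereal c"
  using ln_mono[OF assms] unfolding log_nat_def by auto

section \<open>Entropy along a sofic approximation\<close>

locale sofic_system =
  fixes \<alpha> :: "'g::group_add \<Rightarrow> 'x::{metric_space, topological_group_add} \<Rightarrow> 'x"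
    and d :: "nat \<Rightarrow> nat"
    and \<sigma> :: "nat \<Rightarrow> 'g \<Rightarrow> nat \<Rightarrow> nat"
  assumes amenable: "amenable TYPE('g)"
    and sofic: "sofic_approximation d \<sigma>"
    and compact: "compact (UNIV :: 'x set)"
    and acts: "acts_by_continuous_automorphisms \<alpha>"
begin

lemma act_add: "\<alpha> (s + t) = \<alpha> s \<circ> \<alpha> t"
  using acts unfolding acts_by_continuous_automorphisms_def by simp

lemma act_hom: "\<alpha> s (x + y) = \<alpha> s x + \<alpha> s y"
  using acts unfolding acts_by_continuous_automorphisms_def by simp

text \<open>Real-valued because it occurs in exponents. On open covers the extended value is finite,
  so the conversion loses nothing.\<close>

definition ent :: "'x set set \<Rightarrow> real" where
  "ent \<W> = real_of_ereal (amenable_entropy_cover \<alpha> \<W>)"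

lemma
  assumes "\<W> \<in> open_covers"
  shows amenable_entropy_cover: "amenable_entropy_cover \<alpha> \<W> = ereal (ent \<W>)"
    and dyn_rate_tendsto: "folner \<Phi> \<Longrightarrow> (\<lambda>n. dyn_rate \<alpha> \<W> (\<Phi> n)) \<longlonglongrightarrow> ent \<W>"
proof -
  have W: "finite \<W>" "\<Union>\<W> = UNIV" using assms unfolding open_covers_def by auto
  obtain h where "amenable_entropy_cover \<alpha> \<W> = ereal h"
    "\<And>\<Phi>. folner \<Phi> \<Longrightarrow> (\<lambda>n. dyn_rate \<alpha> \<W> (\<Phi> n)) \<longlonglongrightarrow> h"
    using amenable_entropy_cover_limit[OF W act_add amenable] by blast
  then show "amenable_entropy_cover \<alpha> \<W> = ereal (ent \<W>)"
    "folner \<Phi> \<Longrightarrow> (\<lambda>n. dyn_rate \<alpha> \<W> (\<Phi> n)) \<longlonglongrightarrow> ent \<W>"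
    unfolding ent_def by simp_all
qed

text \<open>Any member of the Folner sequence may become the shape of a tile. Deleting an initial
  segment makes a property that holds eventually true of all possible shapes.\<close>

lemma eventually_folner:
  assumes "\<And>\<Phi> :: nat \<Rightarrow> 'g set. folner \<Phi> \<Longrightarrow> \<forall>\<^sub>F n in sequentially. Q (\<Phi> n)"
  shows "\<exists>\<Phi> :: nat \<Rightarrow> 'g set. folner \<Phi> \<and> (\<forall>n. Q (\<Phi> n))"
proof -
  obtain \<Phi> :: "nat \<Rightarrow> 'g set" where \<Phi>: "folner \<Phi>" using amenable unfolding amenable_def by blast
  from assms[OF \<Phi>] obtain N where "\<And>n. n \<ge> N \<Longrightarrow> Q (\<Phi> n)" unfolding eventually_sequentially by blast
  then show ?thesis using folner_shift[OF \<Phi>, of N] by (intro exI[of _ "\<lambda>n. \<Phi> (n + N)"]) simp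
qed

section \<open>Counting separated sofic orbits by means of tilings\<close>

definition free_points :: "'g set \<Rightarrow> nat \<Rightarrow> nat set" where
  "free_points T i = {a\<in>{1..d i}. \<sigma> i 0 a = a \<and> (\<forall>s\<in>T. \<forall>t\<in>T.
     \<sigma> i s (\<sigma> i t a) = \<sigma> i (s + t) a \<and> (s \<noteq> t \<longrightarrow> \<sigma> i s a \<noteq> \<sigma> i t a))}"

text \<open>That \<open>0\<close> acts as the identity is not among the axioms of
  \<open>sofic_approximation\<close>. It holds wherever the product law holds for the pair (0, 0),
  by cancelling the injective map \<open>\<sigma> i 0\<close>; hence \<open>0\<close> joins the
  window inside the proof. The tolerance \<eta> is shared equally among two conditions for each of
  the n pairs.\<close>

lemma sofic_approx_action:
  assumes "finite T" "0 < \<eta>"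
  shows "\<forall>\<^sub>F i in sequentially. approx_action T {1..d i} (\<sigma> i) (free_points T i) \<and>
    real (card ({1..d i} - free_points T i)) \<le> \<eta> * real (d i)"
proof -
  have perm: "\<sigma> i g permutes {1..d i}" for i g using sofic unfolding sofic_approximation_def by blast
  define T' where "T' = insert 0 T"
  have finT': "finite T'" using assms(1) unfolding T'_def by simp
  define n where "n = real (card (T' \<times> T'))"
  have n: "0 < n" unfolding n_def using finT' by (simp add: card_gt_0_iff T'_def)
  have evl: "\<forall>\<^sub>F i in sequentially. real (card {a\<in>{1..d i}. \<not> R i a}) \<le> \<eta> / (2 * n) * real (d i)"
    if "(\<lambda>i. real (card {a\<in>{1..d i}. R i a}) / real (d i)) \<longlonglongrightarrow> 1" for R
  proof -
    have "\<forall>\<^sub>F i in sequentially. 1 - \<eta> / (2 * n) < real (card {a\<in>{1..d i}. R i a}) / real (d i)"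
      using order_tendstoD(1)[OF that, of "1 - \<eta> / (2 * n)"] assms(2) n by simp
    then show ?thesis
    proof eventually_elim
      case (elim i)
      have "card {a\<in>{1..d i}. R i a} + card {a\<in>{1..d i}. \<not> R i a} = card ({a\<in>{1..d i}. R i a} \<union> {a\<in>{1..d i}. \<not> R i a})"
        by (rule card_Un_disjoint[symmetric]) auto
      also have "{a\<in>{1..d i}. R i a} \<union> {a\<in>{1..d i}. \<not> R i a} = {1..d i}" by auto
      finally have "real (card {a\<in>{1..d i}. R i a}) + real (card {a\<in>{1..d i}. \<not> R i a}) = real (d i)"
        by (simp flip: of_nat_add)
      moreover have "(1 - \<eta> / (2 * n)) * real (d i) \<le> real (card {a\<in>{1..d i}. R i a})"
        using elim by (cases "d i = 0") (auto simp: less_divide_eq intro: less_imp_le)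
      ultimately show ?case by (simp add: left_diff_distrib)
    qed
  qed
  have mult: "\<forall>\<^sub>F i in sequentially. real (card {a\<in>{1..d i}. \<not> \<sigma> i s (\<sigma> i t a) = \<sigma> i (s + t) a}) \<le> \<eta> / (2 * n) * real (d i)" for s t
    using sofic unfolding sofic_approximation_def by (intro evl) blast
  have free: "\<forall>\<^sub>F i in sequentially. real (card {a\<in>{1..d i}. \<not> (s \<noteq> t \<longrightarrow> \<sigma> i s a \<noteq> \<sigma> i t a)}) \<le> \<eta> / (2 * n) * real (d i)" for s t
  proof (cases "s = t")
    case True
    then show ?thesis using assms(2) n by simp
  next
    case False
    have "\<forall>\<^sub>F i in sequentially. real (card {a\<in>{1..d i}. \<not> \<sigma> i s a \<noteq> \<sigma> i t a}) \<le> \<eta> / (2 * n) * real (d i)"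
      using sofic False unfolding sofic_approximation_def by (intro evl) blast
    then show ?thesis using False by simp
  qed
  have "\<forall>\<^sub>F i in sequentially. \<forall>(s, t)\<in>T' \<times> T'.
      real (card {a\<in>{1..d i}. \<not> \<sigma> i s (\<sigma> i t a) = \<sigma> i (s + t) a}) \<le> \<eta> / (2 * n) * real (d i) \<and>
      real (card {a\<in>{1..d i}. \<not> (s \<noteq> t \<longrightarrow> \<sigma> i s a \<noteq> \<sigma> i t a)}) \<le> \<eta> / (2 * n) * real (d i)"
    using finT' mult free by (intro eventually_ball_finite) (auto intro: eventually_conj)
  then show ?thesis
  proof eventually_elim
    case (elim i)
    have "approx_action T {1..d i} (\<sigma> i) (free_points T i)"
      unfolding approx_action_def free_points_def
      using permutes_in_image[OF perm] permutes_inj_on[OF perm]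
      by (auto intro!: inj_onI simp del: atLeastAtMost_iff)
    moreover have "real (card ({1..d i} - free_points T i)) \<le> \<eta> * real (d i)"
    proof -
      let ?B = "\<lambda>(s, t). {a\<in>{1..d i}. \<not> \<sigma> i s (\<sigma> i t a) = \<sigma> i (s + t) a} \<union>
        {a\<in>{1..d i}. \<not> (s \<noteq> t \<longrightarrow> \<sigma> i s a \<noteq> \<sigma> i t a)}"
      have "{1..d i} - free_points T i \<subseteq> (\<Union>p\<in>T' \<times> T'. ?B p)"
      proof
        fix a assume a: "a \<in> {1..d i} - free_points T i"
        show "a \<in> (\<Union>p\<in>T' \<times> T'. ?B p)"
        proof (cases "\<sigma> i 0 a = a")
          case True
          then obtain s t where "s \<in> T" "t \<in> T"
            "\<not> (\<sigma> i s (\<sigma> i t a) = \<sigma> i (s + t) a \<and> (s \<noteq> t \<longrightarrow> \<sigma> i s a \<noteq> \<sigma> i t a))"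
            using a unfolding free_points_def by blast
          then show ?thesis using a by (intro UN_I[of "(s, t)"]) (auto simp: T'_def)
        next
          case False
          then have "\<sigma> i 0 (\<sigma> i 0 a) \<noteq> \<sigma> i (0 + 0) a"
            using permutes_inj[OF perm, of i 0] by (auto dest: injD)
          then show ?thesis using a by (intro UN_I[of "(0, 0)"]) (auto simp: T'_def)
        qed
      qed
      then have "card ({1..d i} - free_points T i) \<le> card (\<Union>p\<in>T' \<times> T'. ?B p)"
        using finT' by (intro card_mono) auto
      also have "\<dots> \<le> (\<Sum>p\<in>T' \<times> T'. card (?B p))" using finT' by (intro card_UN_le) auto
      finally have "real (card ({1..d i} - free_points T i)) \<le> (\<Sum>p\<in>T' \<times> T'. real (card (?B p)))"
        unfolding of_nat_sum[symmetric] of_nat_le_iff .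
      also have "\<dots> \<le> (\<Sum>p\<in>T' \<times> T'. \<eta> / n * real (d i))"
      proof (rule sum_mono)
        fix p assume p: "p \<in> T' \<times> T'"
        obtain s t where st: "p = (s, t)" by (cases p)
        have "real (card (?B p)) \<le> real (card {a\<in>{1..d i}. \<not> \<sigma> i s (\<sigma> i t a) = \<sigma> i (s + t) a}) +
            real (card {a\<in>{1..d i}. \<not> (s \<noteq> t \<longrightarrow> \<sigma> i s a \<noteq> \<sigma> i t a)})"
          unfolding st prod.case of_nat_add[symmetric] of_nat_le_iff by (rule card_Un_le)
        also have "\<dots> \<le> \<eta> / (2 * n) * real (d i) + \<eta> / (2 * n) * real (d i)"
          using bspec[OF elim p] unfolding st prod.case by (intro add_mono) blast+
        finally show "real (card (?B p)) \<le> \<eta> / n * real (d i)" by simp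
      qed
      also have "\<dots> = \<eta> * real (d i)" using n unfolding n_def by simp
      finally show ?thesis .
    qed
    ultimately show ?case by blast
  qed
qed

text \<open>One point is chosen for each tile, independently, from a set whose orbit segments over
  the core are separated, and its segment is copied along the core. Different choices are \<epsilon>
  apart at some coordinate, and the copies follow the action except at uncovered coordinates and
  where a core is left. As a Lebesgue number of the cover, \<epsilon> is fixed before \<kappa>,
  \<open>F\<close> and \<delta>.\<close>

lemma sofic_lower:
  assumes W: "\<W> \<in> open_covers"
  obtains \<epsilon> where "0 < \<epsilon>"
    "\<And>\<kappa> F \<delta>. 0 < \<kappa> \<Longrightarrow> finite F \<Longrightarrow> F \<noteq> {} \<Longrightarrow> 0 < \<delta> \<Longrightarrow> \<forall>\<^sub>F i in sequentially.
      \<exists>Z\<subseteq>sofic_orbits \<alpha> F \<delta> (d i) (\<sigma> i). finite Z \<and> separated {1..d i} \<epsilon> (\<lambda>z. z) Z \<and>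
        exp (real (d i) * (ent \<W> - \<kappa>)) \<le> real (card Z)"
proof -
  obtain \<epsilon> where \<epsilon>: "0 < \<epsilon>" "\<And>x :: 'x. \<exists>U\<in>\<W>. ball x \<epsilon> \<subseteq> U"
    using lebesgue_number[OF compact W] by blast
  have W': "finite \<W>" "\<Union>\<W> = UNIV" using W unfolding open_covers_def by auto
  have "\<forall>A. \<exists>E. finite A \<longrightarrow> finite E \<and> separated A \<epsilon> (\<lambda>x s. \<alpha> s x) E \<and> dyn_num \<alpha> \<W> A \<le> card E"
  proof (intro allI)
    fix A :: "'g set"
    show "\<exists>E. finite A \<longrightarrow> finite E \<and> separated A \<epsilon> (\<lambda>x s. \<alpha> s x) E \<and> dyn_num \<alpha> \<W> A \<le> card E"
    proof (cases "finite A")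
      case True
      obtain E where E: "E \<subseteq> UNIV" "finite E" "separated A \<epsilon> (\<lambda>x s. \<alpha> s x) E"
        "\<And>x. x \<in> UNIV \<Longrightarrow> \<exists>z\<in>E. \<forall>s\<in>A. dist (\<alpha> s x) (\<alpha> s z) < \<epsilon>"
        using maximal_separated[OF compact \<epsilon>(1) True] by blast
      have "dyn_num \<alpha> \<W> A \<le> card E" using \<epsilon>(2) E(2,4) by (intro dyn_num_le_card) auto
      then show ?thesis using E by blast
    qed simp
  qed
  then obtain E where "\<forall>A. finite A \<longrightarrow> finite (E A) \<and> separated A \<epsilon> (\<lambda>x s. \<alpha> s x) (E A) \<and>
      dyn_num \<alpha> \<W> A \<le> card (E A)" by metis
  then have E: "\<And>A. finite A \<Longrightarrow> finite (E A)" "\<And>A. finite A \<Longrightarrow> separated A \<epsilon> (\<lambda>x s. \<alpha> s x) (E A)"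
    "\<And>A. finite A \<Longrightarrow> dyn_num \<alpha> \<W> A \<le> card (E A)" by blast+
  have "\<W> \<noteq> {}" using W'(2) by auto
  then have W1: "1 \<le> real (card \<W>)" using W'(1) by (simp add: Suc_leI card_gt_0_iff)
  define L where "L = ln (real (card \<W>))"
  have L0: "0 \<le> L" unfolding L_def using W1 by simp
  define h where "h = ent \<W>"
  obtain M where M: "0 < M" "\<And>u v :: 'x. dist u v \<le> M" using compact_dist_bounded[OF compact] by blast
  have "\<forall>\<^sub>F i in sequentially.
      \<exists>Z\<subseteq>sofic_orbits \<alpha> F \<delta> (d i) (\<sigma> i). finite Z \<and> separated {1..d i} \<epsilon> (\<lambda>z. z) Z \<and>
        exp (real (d i) * (ent \<W> - \<kappa>)) \<le> real (card Z)"
    if \<kappa>: "0 < \<kappa>" and F: "finite F" "F \<noteq> {}" and \<delta>: "0 < \<delta>" for \<kappa> F \<delta>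
  proof -
    \<comment> \<open>The second bound limits two losses to \<kappa>/3 each: cutting shapes down to
      cores, and leaving coordinates uncovered. The third makes a fraction 5\<theta> of bad
      coordinates admissible in \<open>sofic_orbitsI\<close>.\<close>
    define \<theta> where "\<theta> = min (1 / 2) (min (\<kappa> / (3 * (L + \<bar>h\<bar> + 1))) (\<delta>\<^sup>2 / (10 * M\<^sup>2)))"
    have pos: "0 < \<kappa> / (3 * (L + \<bar>h\<bar> + 1))" "0 < \<delta>\<^sup>2 / (10 * M\<^sup>2)" using \<kappa> \<delta> L0 M by auto
    then have \<theta>: "0 < \<theta>" "\<theta> \<le> 1 / 2" "\<theta> \<le> \<kappa> / (3 * (L + \<bar>h\<bar> + 1))" "\<theta> \<le> \<delta>\<^sup>2 / (10 * M\<^sup>2)"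
      unfolding \<theta>_def by (simp_all only: min_less_iff_conj min.cobounded1 min.coboundedI2 min.cobounded2
          half_gt_zero_iff zero_less_one simp_thms)
    define a where "a = \<theta> * \<bar>h\<bar>"
    have "3 * (\<theta> * L + a + \<theta>) \<le> \<kappa>"
      using \<theta>(3) L0 unfolding a_def by (subst (asm) pos_le_divide_eq) (auto simp: algebra_simps)
    moreover have "0 \<le> \<theta> * L" "0 \<le> a" "\<theta> * h \<le> a" using \<theta>(1) L0 unfolding a_def by auto
    ultimately have \<theta>\<kappa>: "\<theta> * L \<le> \<kappa> / 3" "\<theta> * h \<le> \<kappa> / 3" using \<theta>(1) by auto
    have \<theta>\<delta>: "M\<^sup>2 * (5 * \<theta>) \<le> \<delta>\<^sup>2 / 2"
      using \<theta>(4) M(1) by (subst (asm) pos_le_divide_eq) (auto simp: algebra_simps)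
    \<comment> \<open>Invariance under the negated \<open>F\<close> bounds the positions that some s
      in \<open>F\<close> moves out of a shape.\<close>
    let ?Q = "\<lambda>H. h - \<kappa> / 3 < dyn_rate \<alpha> \<W> H \<and> almost_invariant \<theta> (uminus ` F) H"
    have Q: "\<forall>\<^sub>F n in sequentially. ?Q (\<Phi> n)" if "folner \<Phi>" for \<Phi> :: "nat \<Rightarrow> 'g set"
      using order_tendstoD(1)[OF dyn_rate_tendsto[OF W that], of "h - \<kappa> / 3"] \<kappa>
        folner_almost_invariant[OF that _ \<theta>(1), of "uminus ` F"] F(1)
      unfolding h_def by (intro eventually_conj) auto
    obtain \<Phi> :: "nat \<Rightarrow> 'g set" where \<Phi>: "folner \<Phi>" "\<And>n. ?Q (\<Phi> n)"
      using eventually_folner[of ?Q, OF Q] by blast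
    obtain T \<eta> where T: "finite T" "0 < \<eta>" and tiling: "\<And>(D :: nat set) \<tau> D0.
      approx_action T D \<tau> D0 \<Longrightarrow> real (card (D - D0)) \<le> \<eta> * real (card D) \<Longrightarrow>
      \<exists>P. quasi_tiling \<theta> \<tau> D0 T P \<and> (\<forall>(c, F, A)\<in>P. F \<in> range \<Phi>) \<and>
        real (card (D - covered \<tau> P)) \<le> \<theta> * real (card D)"
      using quasi_tiling_exists[OF \<Phi>(1) \<theta>(1,2), where 'd = nat] by blast
    \<comment> \<open>The tiling lives in the window \<open>T\<close>; following the action also
      takes the product law for s in \<open>F\<close> after t in \<open>T\<close>.\<close>
    have finTF: "finite (T \<union> F)" using T F by simp
    from sofic_approx_action[OF finTF T(2)] show ?thesis
    proof eventually_elim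
      case (elim i)
      let ?\<tau> = "\<sigma> i" let ?Y = "free_points (T \<union> F) i" let ?D = "{1..d i}"
      have aaTF: "approx_action (T \<union> F) ?D ?\<tau> ?Y" using elim by blast
      have aa: "approx_action T ?D ?\<tau> ?Y" using approx_action_mono[OF aaTF] by simp
      obtain P where P: "quasi_tiling \<theta> ?\<tau> ?Y T P" "\<forall>(c, H, A)\<in>P. H \<in> range \<Phi>"
        "real (card (?D - covered ?\<tau> P)) \<le> \<theta> * real (card ?D)"
        using tiling[OF aa] elim by auto
      note q = quasi_tiling_tile[OF P(1)]
      have PQ: "?Q H" if "(c, H, A) \<in> P" for c H A
        using bspec[OF P(2) that] \<Phi>(2) by auto
      have finP: "finite P" using P(1) unfolding quasi_tiling_def by auto
      have fA: "finite A" if "(c, H, A) \<in> P" for c H A using q(2,5)[OF that] by (rule finite_subset[rotated])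
      have HA: "real (card (H - A)) \<le> \<theta> * real (card H)" if "(c, H, A) \<in> P" for c H A
      proof -
        have "card (H - A) = card H - card A" using fA[OF that] q(5)[OF that] by (rule card_Diff_subset)
        then have "real (card (H - A)) = real (card H) - real (card A)"
          using card_mono[OF q(2,5)[OF that]] by simp
        then show ?thesis using q(6)[OF that] by (simp add: algebra_simps)
      qed
      define S where "S = (\<Sum>(c, H, A)\<in>P. real (card H))"
      have covD: "covered ?\<tau> P \<subseteq> ?D" by (rule covered_subset[OF aa P(1)])
      have S_le: "S \<le> 2 * real (d i)"
      proof -
        have "0 \<le> S" unfolding S_def by (intro sum_nonneg) auto
        then have "1 / 2 * S \<le> (1 - \<theta>) * S" using \<theta>(2) by (intro mult_right_mono) auto
        also have "\<dots> \<le> real (card (covered ?\<tau> P))" unfolding S_def by (rule sum_card_shapes[OF aa P(1)])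
        also have "\<dots> \<le> real (d i)" using card_mono[OF _ covD] by simp
        finally show ?thesis by simp
      qed
      have S_ge: "(1 - \<theta>) * real (d i) \<le> S"
      proof -
        have "card ?D = card (?D - covered ?\<tau> P) + card (covered ?\<tau> P)"
          using covD by (metis card_Diff_subset card_mono finite_atLeastAtMost finite_subset le_add_diff_inverse2)
        then have "(1 - \<theta>) * real (d i) \<le> real (card (covered ?\<tau> P))"
          using P(3) by (simp add: algebra_simps)
        also have "\<dots> = (\<Sum>(c, H, A)\<in>P. real (card A))"
          unfolding card_covered[OF aa P(1)] by (simp add: case_prod_unfold)
        also have "\<dots> \<le> S" unfolding S_def using card_mono[OF q(2,5)] by (intro sum_mono) auto
        finally show ?thesis .
      qed
      obtain loc where loc: "\<And>c H A s. (c, H, A) \<in> P \<Longrightarrow> s \<in> A \<Longrightarrow> loc (?\<tau> s c) = ((c, H, A), s)"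
        using core_coordinates[OF aa P(1)] by blast
      define C where "C = (\<Pi>\<^sub>E p\<in>P. E (snd (snd p)))"
      \<comment> \<open>The value 0 at uncovered coordinates is an arbitrary filler, and
        \<open>undefined\<close> beyond \<open>d i\<close> makes the point extensional.\<close>
      define x where "x = (\<lambda>e j. if j \<in> covered ?\<tau> P then \<alpha> (snd (loc j)) (e (fst (loc j)))
        else if j \<in> ?D then 0 else undefined)"
      have in_cov: "?\<tau> s c \<in> covered ?\<tau> P" if "(c, H, A) \<in> P" "s \<in> A" for c H A s
        using that unfolding covered_def core_def by force
      have xv: "x e (?\<tau> s c) = \<alpha> s (e (c, H, A))" if "(c, H, A) \<in> P" "s \<in> A" for e c H A s
        unfolding x_def loc[OF that] using in_cov[OF that] by simp
      have sep: "\<exists>j\<in>?D. \<epsilon> \<le> dist (x e j) (x e' j)" if e: "e \<in> C" "e' \<in> C" "e \<noteq> e'" for e e'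
      proof -
        obtain p where p: "p \<in> P" "e p \<noteq> e' p"
          using e PiE_ext[of e P "\<lambda>p. E (snd (snd p))" e'] unfolding C_def by blast
        obtain c H A where pc: "p = (c, H, A)" by (metis prod_cases3)
        note pP = p(1)[unfolded pc]
        have "e p \<in> E A" "e' p \<in> E A" using e p(1) unfolding C_def pc by (auto dest: PiE_mem)
        then obtain s where s: "s \<in> A" "\<epsilon> \<le> dist (\<alpha> s (e p)) (\<alpha> s (e' p))"
          using E(2)[OF fA[OF pP]] p(2) unfolding separated_def by blast
        have "?\<tau> s c \<in> ?D" using in_cov[OF pP s(1)] covD by blast
        moreover have "\<epsilon> \<le> dist (x e (?\<tau> s c)) (x e' (?\<tau> s c))"
          unfolding xv[OF pP s(1)] using s(2) unfolding pc .
        ultimately show ?thesis by blast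
      qed
      have "inj_on x C"
      proof (rule inj_onI, rule ccontr)
        fix e e' assume "e \<in> C" "e' \<in> C" "x e = x e'" "e \<noteq> e'"
        with sep[OF this(1,2,4)] \<epsilon>(1) show False by auto
      qed
      then have card_Z: "card (x ` C) = (\<Prod>p\<in>P. card (E (snd (snd p))))"
        unfolding C_def using finP by (simp add: card_image card_PiE)
      have fin_C: "finite C" unfolding C_def using finP E(1) fA by (intro finite_PiE) auto
      have "separated ?D \<epsilon> (\<lambda>z. z) (x ` C)" unfolding separated_def
      proof (intro ballI impI)
        fix z z' assume "z \<in> x ` C" "z' \<in> x ` C" "z \<noteq> z'"
        then obtain e e' where "e \<in> C" "e' \<in> C" "z = x e" "z' = x e'" "e \<noteq> e'" by blast
        then show "\<exists>j\<in>?D. \<epsilon> \<le> dist (z j) (z' j)" using sep by blast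
      qed
      moreover have "x ` C \<subseteq> sofic_orbits \<alpha> F \<delta> (d i) ?\<tau>"
      proof (rule image_subsetI)
        fix e assume "e \<in> C"
        show "x e \<in> sofic_orbits \<alpha> F \<delta> (d i) ?\<tau>"
        proof (rule sofic_orbitsI[OF _ F \<delta> M(2) \<theta>\<delta>])
          show "x e \<in> ?D \<rightarrow>\<^sub>E UNIV" unfolding x_def using covD by auto
          fix s assume s: "s \<in> F"
          let ?B = "{j\<in>?D. \<delta> / 2 \<le> dist (\<alpha> s (x e j)) (x e (?\<tau> s j))}"
          let ?b = "\<lambda>p. (\<lambda>t. ?\<tau> t (fst p)) ` {t\<in>snd (snd p). s + t \<notin> snd (snd p)}"
          \<comment> \<open>The origin of 5\<theta>: uncovered coordinates give \<theta>. In each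
            tile, leaving the shape \<open>H\<close> and landing in \<open>H - A\<close> give
            \<theta>|H| each, and the shapes have total size at most 2d.\<close>
          have "?B \<subseteq> (?D - covered ?\<tau> P) \<union> (\<Union>p\<in>P. ?b p)"
          proof
            fix j assume j: "j \<in> ?B"
            show "j \<in> (?D - covered ?\<tau> P) \<union> (\<Union>p\<in>P. ?b p)"
            proof (cases "j \<in> covered ?\<tau> P")
              case True
              then obtain c H A t where t: "(c, H, A) \<in> P" "t \<in> A" "j = ?\<tau> t c"
                unfolding covered_def core_def by auto
              have "s + t \<notin> A"
              proof
                assume st: "s + t \<in> A"
                have "t \<in> T" using q(4,5)[OF t(1)] t(2) by blast
                then have "?\<tau> s (?\<tau> t c) = ?\<tau> (s + t) c"
                  using aaTF q(1)[OF t(1)] s unfolding approx_action_def by blast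
                then have "x e (?\<tau> s j) = \<alpha> s (x e j)"
                  using xv[OF t(1) st] xv[OF t(1,2)] t(3) by (simp add: act_add)
                then show False using j \<delta> by simp
              qed
              then have "j \<in> ?b (c, H, A)" using t by auto
              then show ?thesis using t(1) by blast
            qed (use j in auto)
          qed
          then have "card ?B \<le> card ((?D - covered ?\<tau> P) \<union> (\<Union>p\<in>P. ?b p))"
            using finP fA by (intro card_mono) auto
          also have "\<dots> \<le> card (?D - covered ?\<tau> P) + card (\<Union>p\<in>P. ?b p)" by (rule card_Un_le)
          also have "card (\<Union>p\<in>P. ?b p) \<le> (\<Sum>p\<in>P. card (?b p))" using finP by (rule card_UN_le)
          finally have "real (card ?B) \<le> real (card (?D - covered ?\<tau> P)) + (\<Sum>p\<in>P. real (card (?b p)))"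
            by (simp flip: of_nat_sum of_nat_add)
          also have "(\<Sum>p\<in>P. real (card (?b p))) \<le> (\<Sum>(c, H, A)\<in>P. 2 * \<theta> * real (card H))"
          proof (rule sum_mono, clarify)
            fix c H A assume p: "(c, H, A) \<in> P"
            have "card (?b (c, H, A)) \<le> card {t\<in>A. s + t \<notin> A}"
              unfolding fst_conv snd_conv using fA[OF p] by (intro card_image_le) simp
            also have "\<dots> \<le> card ((+) s ` H - H) + card (H - A)"
              by (rule card_not_shifted[OF q(2,5)[OF p]])
            finally have "real (card (?b (c, H, A))) \<le> real (card ((+) s ` H - H)) + real (card (H - A))"
              unfolding of_nat_add[symmetric] of_nat_le_iff .
            moreover have "real (card ((+) s ` H - H)) \<le> \<theta> * real (card H)"
            proof -
              have "real (card ((+) (- (- s)) ` H - H)) \<le> (\<Sum>u\<in>uminus ` F. real (card ((+) (- u) ` H - H)))"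
                using s F(1) by (intro member_le_sum[where f = "\<lambda>u. real (card ((+) (- u) ` H - H))"]) auto
              then show ?thesis using PQ[OF p] unfolding almost_invariant_def by simp
            qed
            ultimately show "real (card (?b (c, H, A))) \<le> 2 * \<theta> * real (card H)" using HA[OF p] by simp
          qed
          also have "\<dots> = 2 * \<theta> * S" unfolding S_def by (simp add: sum_distrib_left case_prod_unfold)
          also have "\<dots> \<le> 2 * \<theta> * (2 * real (d i))" using S_le \<theta>(1) by (intro mult_left_mono) auto
          finally show "real (card ?B) \<le> 5 * \<theta> * real (d i)" using P(3) by (simp add: algebra_simps)
        qed
      qed
      moreover have "exp (real (d i) * (ent \<W> - \<kappa>)) \<le> real (card (x ` C))"
      proof -
        have ge1: "1 \<le> real (card (E (snd (snd p))))" if "p \<in> P" for p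
        proof -
          obtain c H A where pc: "p = (c, H, A)" by (metis prod_cases3)
          have "0 < dyn_num \<alpha> \<W> A" using dyn_num_pos[OF W' fA] that pc by blast
          then show ?thesis using E(3)[OF fA, of c H A] that pc by simp
        qed
        define b where "b = h - 2 * \<kappa> / 3"
        \<comment> \<open>The points are separated over the core \<open>A\<close>, whereas the rate
          is known for the shape \<open>H\<close>; the elements of \<open>H - A\<close> cost at most
          the factor \<open>card \<W>\<close> each.\<close>
        have each: "b * real (card H) \<le> ln (real (card (E A)))" if p: "(c, H, A) \<in> P" for c H A
        proof -
          have "dyn_num \<alpha> \<W> H = dyn_num \<alpha> \<W> (A \<union> (H - A))" using q(5)[OF p] by (simp add: Un_absorb1)
          also have "\<dots> \<le> dyn_num \<alpha> \<W> A * dyn_num \<alpha> \<W> (H - A)"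
            using fA[OF p] q(2)[OF p] by (intro dyn_num_Un[OF W']) auto
          also have "\<dots> \<le> card (E A) * card \<W> ^ card (H - A)"
            using fA[OF p] q(2)[OF p] E(3) by (intro mult_mono dyn_num_le_power[OF W']) auto
          finally have "real (dyn_num \<alpha> \<W> H) \<le> real (card (E A)) * real (card \<W>) ^ card (H - A)"
            by (simp flip: of_nat_mult of_nat_power)
          moreover have "0 < real (dyn_num \<alpha> \<W> H)" using dyn_num_pos[OF W' q(2)[OF p]] by simp
          ultimately have "ln (real (dyn_num \<alpha> \<W> H)) \<le> ln (real (card (E A)) * real (card \<W>) ^ card (H - A))"
            by (rule ln_mono)
          also have "\<dots> = ln (real (card (E A))) + real (card (H - A)) * L"
            using ge1[OF p] W1 unfolding L_def by (subst ln_mult_pos) (auto simp: ln_realpow)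
          also have "\<dots> \<le> ln (real (card (E A))) + \<theta> * real (card H) * L"
            using HA[OF p] L0 by (intro add_left_mono mult_right_mono)
          also have "\<theta> * real (card H) * L \<le> \<kappa> / 3 * real (card H)"
            using mult_right_mono[OF \<theta>\<kappa>(1), of "real (card H)"] by (simp add: algebra_simps)
          finally have "ln (real (dyn_num \<alpha> \<W> H)) \<le> ln (real (card (E A))) + \<kappa> / 3 * real (card H)" by simp
          moreover have "(h - \<kappa> / 3) * real (card H) \<le> ln (real (dyn_num \<alpha> \<W> H))"
            unfolding ln_dyn_num[OF q(2,3)[OF p]] using PQ[OF p] by (intro mult_right_mono) auto
          ultimately show ?thesis unfolding b_def by (simp add: algebra_simps)
        qed
        have "real (d i) * (h - \<kappa>) \<le> (\<Sum>p\<in>P. ln (real (card (E (snd (snd p))))))"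
        \<comment> \<open>Replacing \<open>S\<close> by its lower bound requires b \<ge> 0.
          Otherwise h - \<kappa> is negative, and it is enough that each tile offers at least one
          choice.\<close>
        proof (cases "0 \<le> b")
          case True
          have "h * \<theta> \<le> \<kappa> / 3" "0 \<le> \<theta> * \<kappa>" using \<theta>\<kappa>(2) \<theta>(1) \<kappa> by (simp_all add: mult.commute)
          moreover have "b * (1 - \<theta>) = h - 2 * \<kappa> / 3 - h * \<theta> + 2 / 3 * (\<theta> * \<kappa>)"
            unfolding b_def by (simp add: field_simps)
          ultimately have "h - \<kappa> \<le> b * (1 - \<theta>)" by linarith
          then have "real (d i) * (h - \<kappa>) \<le> b * ((1 - \<theta>) * real (d i))"
            using mult_left_mono[of "h - \<kappa>" "b * (1 - \<theta>)" "real (d i)"] by (simp add: mult_ac)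
          also have "\<dots> \<le> b * S" using S_ge True by (rule mult_left_mono)
          also have "\<dots> = (\<Sum>(c, H, A)\<in>P. b * real (card H))"
            unfolding S_def by (simp add: sum_distrib_left case_prod_unfold)
          also have "\<dots> \<le> (\<Sum>p\<in>P. ln (real (card (E (snd (snd p))))))"
            using each by (intro sum_mono) auto
          finally show ?thesis .
        next
          case False
          then have "real (d i) * (h - \<kappa>) \<le> 0"
            unfolding b_def using \<kappa> by (intro mult_nonneg_nonpos) auto
          also have "0 \<le> (\<Sum>p\<in>P. ln (real (card (E (snd (snd p))))))"
            using ge1 by (intro sum_nonneg ln_ge_zero) auto
          finally show ?thesis .
        qed
        also have "\<dots> = ln (\<Prod>p\<in>P. real (card (E (snd (snd p)))))"
          using finP ge1 by (intro ln_prod[symmetric]) force+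
        finally have "exp (real (d i) * (h - \<kappa>)) \<le> exp (ln (\<Prod>p\<in>P. real (card (E (snd (snd p))))))"
          by simp
        also have "\<dots> = (\<Prod>p\<in>P. real (card (E (snd (snd p)))))"
          using ge1 by (intro exp_ln prod_pos) force
        also have "\<dots> = real (card (x ` C))" unfolding card_Z by simp
        finally show ?thesis unfolding h_def .
      qed
      ultimately show ?case using fin_C by (intro exI[of _ "x ` C"] conjI) auto
    qed
  qed
  then show ?thesis using that[OF \<epsilon>(1)] by blast
qed

text \<open>A point is coded by the cell of its value at each centre, taken from a minimal subcover
  for the shape, and by corrections at the few coordinates that the centres do not predict. Two
  points with equal codes are less than 3\<gamma> = \<epsilon> apart at a predicted coordinate:
  \<gamma> for each prediction and \<gamma> for the cell. Hence a separated set has at most as many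
  points as there are codes.\<close>

lemma sofic_upper:
  assumes "0 < \<epsilon>"
  obtains \<W> where "\<W> \<in> open_covers"
    "\<And>\<kappa>. 0 < \<kappa> \<Longrightarrow> \<exists>F \<delta>. finite F \<and> F \<noteq> {} \<and> 0 < \<delta> \<and> (\<forall>\<^sub>F i in sequentially.
      \<forall>Z\<subseteq>sofic_orbits \<alpha> F \<delta> (d i) (\<sigma> i). separated {1..d i} \<epsilon> (\<lambda>z. z) Z \<longrightarrow>
        real (card Z) \<le> exp (real (d i) * (ent \<W> + \<kappa>)))"
proof -
  define \<gamma> where "\<gamma> = \<epsilon> / 3"
  have \<gamma>: "0 < \<gamma>" using assms unfolding \<gamma>_def by simp
  obtain \<W> :: "'x set set" where W: "\<W> \<in> open_covers"
    and mesh: "\<And>U x y. U \<in> \<W> \<Longrightarrow> x \<in> U \<Longrightarrow> y \<in> U \<Longrightarrow> dist x y < \<gamma>"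
    using fine_open_cover[OF compact \<gamma>] by blast
  have W': "finite \<W>" "\<Union>\<W> = UNIV" using W unfolding open_covers_def by auto
  have "\<W> \<noteq> {}" using W'(2) by auto
  then have W1: "0 < real (card \<W>)" using W'(1) by (simp add: card_gt_0_iff)
  have "\<exists>U. U \<in> \<W> \<and> x \<in> U" for x
  proof -
    have "x \<in> \<Union>\<W>" unfolding W'(2) by simp
    then show ?thesis by blast
  qed
  then obtain V where V: "\<And>x. V x \<in> \<W>" "\<And>x. x \<in> V x" by metis
  have "\<exists>\<S>. finite H \<longrightarrow> \<S> \<subseteq> dyn_cover \<alpha> H \<W> \<and> finite \<S> \<and> card \<S> = dyn_num \<alpha> \<W> H \<and> \<Union>\<S> = UNIV" for H
  proof (cases "finite H")
    case True
    obtain \<S> where "\<S> \<subseteq> dyn_cover \<alpha> H \<W>" "finite \<S>" "card \<S> = dyn_num \<alpha> \<W> H" "\<Union>\<S> = UNIV"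
      by (rule dyn_num_witness[OF W' True])
    then show ?thesis by blast
  qed simp
  then obtain \<S> where "\<forall>H. finite H \<longrightarrow> \<S> H \<subseteq> dyn_cover \<alpha> H \<W> \<and> finite (\<S> H) \<and>
      card (\<S> H) = dyn_num \<alpha> \<W> H \<and> \<Union>(\<S> H) = UNIV" by metis
  then have S: "\<And>H. finite H \<Longrightarrow> \<S> H \<subseteq> dyn_cover \<alpha> H \<W>" "\<And>H. finite H \<Longrightarrow> finite (\<S> H)"
    "\<And>H. finite H \<Longrightarrow> card (\<S> H) = dyn_num \<alpha> \<W> H" "\<And>H. finite H \<Longrightarrow> \<Union>(\<S> H) = UNIV" by blast+
  have "\<exists>R. finite H \<longrightarrow> R \<in> \<S> H \<and> x \<in> R" for H x
  proof (cases "finite H")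
    case True
    have "x \<in> \<Union>(\<S> H)" unfolding S(4)[OF True] by simp
    then show ?thesis by blast
  qed simp
  then obtain R where "\<forall>H x. finite H \<longrightarrow> R H x \<in> \<S> H \<and> x \<in> R H x" by metis
  then have R: "\<And>H x. finite H \<Longrightarrow> R H x \<in> \<S> H" "\<And>H x. finite H \<Longrightarrow> x \<in> R H x" by blast+
  define h where "h = ent \<W>"
  have "\<exists>F \<delta>. finite F \<and> F \<noteq> {} \<and> 0 < \<delta> \<and> (\<forall>\<^sub>F i in sequentially.
      \<forall>Z\<subseteq>sofic_orbits \<alpha> F \<delta> (d i) (\<sigma> i). separated {1..d i} \<epsilon> (\<lambda>z. z) Z \<longrightarrow>
        real (card Z) \<le> exp (real (d i) * (ent \<W> + \<kappa>)))"
    if \<kappa>: "0 < \<kappa>" for \<kappa>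
  proof -
    define b where "b = h + \<kappa> / 6"
    let ?Q = "\<lambda>H. dyn_rate \<alpha> \<W> H < b"
    have Q: "\<forall>\<^sub>F n in sequentially. ?Q (\<Phi> n)" if "folner \<Phi>" for \<Phi> :: "nat \<Rightarrow> 'g set"
      using order_tendstoD(2)[OF dyn_rate_tendsto[OF W that], of b] \<kappa> unfolding h_def b_def by simp
    obtain \<Phi> :: "nat \<Rightarrow> 'g set" where \<Phi>: "folner \<Phi>" "\<And>n. ?Q (\<Phi> n)"
      using eventually_folner[of ?Q, OF Q] by blast
    have "finite (\<Phi> 0)" using \<Phi>(1) unfolding folner_def by simp
    then have b0: "0 < b" using dyn_rate_nonneg[OF W', of "\<Phi> 0" \<alpha>] \<Phi>(2)[of 0] by linarith
    \<comment> \<open>\<open>t\<close> and \<open>\<mu>\<close> are the parameters of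
      \<open>card_sparse_PiE\<close>: per coordinate, the total weight costs at most t|W| \<le>
      \<kappa>/3 and dividing by the least weight -\<mu> ln t \<le> \<kappa>/3. So \<open>t\<close>
      is chosen first and \<open>\<mu>\<close> is adapted to ln t.\<close>
    define t where "t = min 1 (\<kappa> / (3 * real (card \<W>)))"
    have "0 < \<kappa> / (3 * real (card \<W>))" using \<kappa> W1 by simp
    then have t: "0 < t" "t \<le> 1" unfolding t_def by (simp_all only: min_less_iff_conj min.cobounded1 zero_less_one simp_thms)
    have "t \<le> \<kappa> / (3 * real (card \<W>))" unfolding t_def by simp
    then have tW: "t * real (card \<W>) \<le> \<kappa> / 3" using W1 by (simp add: field_simps)
    have lnt: "ln t \<le> 0" using t by simp
    define \<mu> where "\<mu> = \<kappa> / 3 / (1 - ln t)"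
    have \<mu>: "0 < \<mu>" unfolding \<mu>_def using \<kappa> lnt by simp
    have "\<mu> * (1 - ln t) = \<kappa> / 3"
      unfolding \<mu>_def using lnt by (intro nonzero_eq_divide_eq[THEN iffD1, OF _ refl]) linarith
    then have \<mu>t: "- (\<mu> * ln t) \<le> \<kappa> / 3" using \<mu> by (simp add: algebra_simps)
    define \<theta> where "\<theta> = min (1 / 2) (min (\<kappa> / (12 * b)) (\<mu> / 2))"
    have "0 < \<kappa> / (12 * b)" "0 < \<mu> / 2" using \<kappa> b0 \<mu> by auto
    then have \<theta>: "0 < \<theta>" "\<theta> \<le> 1 / 2" "\<theta> \<le> \<kappa> / (12 * b)" "\<theta> \<le> \<mu> / 2"
      unfolding \<theta>_def by (simp_all only: min_less_iff_conj min.cobounded1 min.coboundedI2 min.cobounded2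
          half_gt_zero_iff zero_less_one simp_thms)
    have \<theta>b: "2 * \<theta> * b \<le> \<kappa> / 6" using \<theta>(3) b0 by (simp add: field_simps)
    obtain T \<eta> where T: "finite T" "0 < \<eta>" and tiling: "\<And>(D :: nat set) \<tau> D0.
      approx_action T D \<tau> D0 \<Longrightarrow> real (card (D - D0)) \<le> \<eta> * real (card D) \<Longrightarrow>
      \<exists>P. quasi_tiling \<theta> \<tau> D0 T P \<and> (\<forall>(c, F, A)\<in>P. F \<in> range \<Phi>) \<and>
        real (card (D - covered \<tau> P)) \<le> \<theta> * real (card D)"
      using quasi_tiling_exists[OF \<Phi>(1) \<theta>(1,2), where 'd = nat] by blast
    define F where "F = insert 0 T"
    have F: "finite F" "F \<noteq> {}" "T \<subseteq> F" unfolding F_def using T(1) by auto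
    have cF: "0 < real (card F)" using F by (simp add: card_gt_0_iff)
    \<comment> \<open>Solves |F|(\<delta>/\<gamma>)^2 = \<mu>/2, so that the deviations of all s in
      \<open>F\<close> together fill at most the other half of \<mu>.\<close>
    define \<delta> where "\<delta> = \<gamma> * sqrt (\<mu> / (2 * real (card F)))"
    have \<delta>: "0 < \<delta>" unfolding \<delta>_def using \<gamma> \<mu> cF by simp
    have "\<delta> / \<gamma> = sqrt (\<mu> / (2 * real (card F)))" unfolding \<delta>_def using \<gamma> by simp
    then have "(\<delta> / \<gamma>)\<^sup>2 = \<mu> / (2 * real (card F))" using \<mu> by simp
    then have \<delta>F: "real (card F) * (\<delta> / \<gamma>)\<^sup>2 = \<mu> / 2" using cF by simp
    have "\<forall>\<^sub>F i in sequentially.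
      \<forall>Z\<subseteq>sofic_orbits \<alpha> F \<delta> (d i) (\<sigma> i). separated {1..d i} \<epsilon> (\<lambda>z. z) Z \<longrightarrow>
        real (card Z) \<le> exp (real (d i) * (ent \<W> + \<kappa>))"
      using sofic_approx_action[OF T]
    proof eventually_elim
      case (elim i)
      let ?\<tau> = "\<sigma> i" let ?Y = "free_points T i" let ?D = "{1..d i}"
      have aa: "approx_action T ?D ?\<tau> ?Y" using elim by blast
      obtain P where P: "quasi_tiling \<theta> ?\<tau> ?Y T P" "\<forall>(c, H, A)\<in>P. H \<in> range \<Phi>"
        "real (card (?D - covered ?\<tau> P)) \<le> \<theta> * real (card ?D)"
        using tiling[OF aa] elim by auto
      note q = quasi_tiling_tile[OF P(1)]
      have PQ: "dyn_rate \<alpha> \<W> H < b" if "(c, H, A) \<in> P" for c H A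
        using bspec[OF P(2) that] \<Phi>(2) by auto
      have finP: "finite P" using P(1) unfolding quasi_tiling_def by auto
      \<comment> \<open>The possible correction patterns; \<open>None\<close> stands for a predicted
        coordinate.\<close>
      define N where "N = {f \<in> ?D \<rightarrow>\<^sub>E insert None (Some ` \<W>). real (card {j\<in>?D. f j \<noteq> None}) \<le> \<mu> * real (d i)}"
      have finN: "finite N" unfolding N_def using W'(1) by (intro finite_subset[OF Collect_restrict finite_PiE]) simp_all
      define \<R> where "\<R> = (\<Pi>\<^sub>E p\<in>P. \<S> (fst (snd p)))"
      have fin\<R>: "finite \<R>" unfolding \<R>_def using finP S(2) q(2) by (intro finite_PiE) auto
      have card_N: "real (card N) \<le> exp (real (d i) * (2 * \<kappa> / 3))"
      proof -
        have "real (card N) * t powr (\<mu> * real (d i)) \<le> (1 + t * real (card \<W>)) ^ card ?D"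
          unfolding N_def using t W'(1) by (intro card_sparse_PiE) auto
        also have "\<dots> \<le> exp (t * real (card \<W>)) ^ card ?D"
          using t W1 by (intro power_mono[OF exp_ge_add_one_self]) simp
        also have "\<dots> = exp (real (d i) * (t * real (card \<W>)))" by (simp add: exp_of_nat_mult)
        also have "\<dots> \<le> exp (real (d i) * (\<kappa> / 3))" using mult_left_mono[OF tW, of "real (d i)"] by simp
        also have "t powr (\<mu> * real (d i)) = exp (\<mu> * real (d i) * ln t)" using t by (simp add: powr_def)
        finally have "real (card N) * exp (\<mu> * real (d i) * ln t) * exp (- (\<mu> * real (d i) * ln t))
            \<le> exp (real (d i) * (\<kappa> / 3)) * exp (- (\<mu> * real (d i) * ln t))"
          by (rule mult_right_mono) simp
        then have "real (card N) \<le> exp (real (d i) * (\<kappa> / 3) + real (d i) * (- (\<mu> * ln t)))"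
          by (simp add: mult.assoc flip: exp_add) (simp add: algebra_simps)
        also have "\<dots> \<le> exp (real (d i) * (\<kappa> / 3) + real (d i) * (\<kappa> / 3))"
          using \<mu>t by (subst exp_le_cancel_iff, intro add_left_mono mult_left_mono) auto
        finally show ?thesis by (simp add: algebra_simps)
      qed
      have card_\<R>: "real (card \<R>) \<le> exp (real (d i) * (h + \<kappa> / 3))"
      proof -
        have pos: "0 < real (card (\<S> (fst (snd p))))" if "p \<in> P" for p
        proof -
          obtain c H A where pc: "p = (c, H, A)" by (metis prod_cases3)
          then show ?thesis using dyn_num_pos[OF W' q(2)] S(3)[OF q(2)] that by simp
        qed
        have card_eq: "real (card \<R>) = (\<Prod>p\<in>P. real (card (\<S> (fst (snd p)))))"
          unfolding \<R>_def using finP by (simp add: card_PiE)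
        have "ln (real (card \<R>)) = (\<Sum>p\<in>P. ln (real (card (\<S> (fst (snd p))))))"
          unfolding card_eq using finP less_imp_neq[OF pos] by (intro ln_prod) metis+
        also have "\<dots> \<le> (\<Sum>(c, H, A)\<in>P. b * real (card H))"
        proof (rule sum_mono, clarify)
          fix c H A assume p: "(c, H, A) \<in> P"
          show "ln (real (card (\<S> (fst (snd (c, H, A)))))) \<le> b * real (card H)"
            unfolding fst_conv snd_conv S(3)[OF q(2)[OF p]] ln_dyn_num[OF q(2,3)[OF p]]
            using PQ[OF p] by (intro mult_right_mono) auto
        qed
        also have "\<dots> = b * (\<Sum>(c, H, A)\<in>P. real (card H))" by (simp add: sum_distrib_left case_prod_unfold)
        also have "\<dots> \<le> b * ((1 + 2 * \<theta>) * real (d i))"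
        proof (rule mult_left_mono)
          define S' where "S' = (\<Sum>(c, H, A)\<in>P. real (card H))"
          have "(1 - \<theta>) * S' \<le> real (card (covered ?\<tau> P))"
            unfolding S'_def by (rule sum_card_shapes[OF aa P(1)])
          also have "\<dots> \<le> real (d i)" using card_mono[OF _ covered_subset[OF aa P(1)]] by simp
          also have "\<dots> \<le> (1 - \<theta>) * ((1 + 2 * \<theta>) * real (d i))"
          proof -
            have "0 \<le> \<theta> * (1 - 2 * \<theta>)" using \<theta> by simp
            then have "1 \<le> (1 - \<theta>) * (1 + 2 * \<theta>)" by (simp add: algebra_simps)
            then have "1 * real (d i) \<le> ((1 - \<theta>) * (1 + 2 * \<theta>)) * real (d i)"
              by (intro mult_right_mono) auto
            then show ?thesis by (simp add: mult.assoc)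
          qed
          finally show "S' \<le> (1 + 2 * \<theta>) * real (d i)" using \<theta> by simp
        qed (use b0 in simp)
        also have "\<dots> = real (d i) * (b + 2 * \<theta> * b)" by (simp add: algebra_simps)
        also have "\<dots> \<le> real (d i) * (h + \<kappa> / 3)"
          using \<theta>b unfolding b_def by (intro mult_left_mono) auto
        finally have "exp (ln (real (card \<R>))) \<le> exp (real (d i) * (h + \<kappa> / 3))" by simp
        moreover have "0 < real (card \<R>)" unfolding card_eq using pos by (rule prod_pos)
        ultimately show ?thesis by simp
      qed
      show ?case
      proof (intro allI impI)
        fix Z assume Z: "Z \<subseteq> sofic_orbits \<alpha> F \<delta> (d i) ?\<tau>" "separated ?D \<epsilon> (\<lambda>z. z) Z"
        \<comment> \<open>The implication puts every uncovered coordinate into \<open>J z\<close>; a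
          covered one belongs to it when the value at its centre predicts it badly.\<close>
        define J where "J = (\<lambda>z. {j\<in>?D. j \<in> covered ?\<tau> P \<longrightarrow>
          (\<exists>(c, H, A)\<in>P. \<exists>s\<in>A. j = ?\<tau> s c \<and> \<gamma> \<le> dist (\<alpha> s (z c)) (z j))})"
        define g where "g = (\<lambda>z. (\<lambda>p\<in>P. R (fst (snd p)) (z (fst p)),
          \<lambda>j\<in>?D. if j \<in> J z then Some (V (z j)) else None))"
        have J_le: "real (card (J z)) \<le> \<mu> * real (d i)" if z: "z \<in> Z" for z
        proof -
          let ?b = "\<lambda>s. {c\<in>?D. \<gamma> \<le> dist (\<alpha> s (z c)) (z (?\<tau> s c))}"
          have "J z \<subseteq> (?D - covered ?\<tau> P) \<union> (\<Union>s\<in>F. ?\<tau> s ` ?b s)"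
          proof
            fix j assume j: "j \<in> J z"
            show "j \<in> (?D - covered ?\<tau> P) \<union> (\<Union>s\<in>F. ?\<tau> s ` ?b s)"
            proof (cases "j \<in> covered ?\<tau> P")
              case True
              then obtain c H A s where s: "(c, H, A) \<in> P" "s \<in> A" "j = ?\<tau> s c"
                "\<gamma> \<le> dist (\<alpha> s (z c)) (z j)"
                using j unfolding J_def by blast
              have "s \<in> F" using q(4,5)[OF s(1)] s(2) F(3) by blast
              moreover have "c \<in> ?D" using q(1)[OF s(1)] aa unfolding approx_action_def by blast
              ultimately show ?thesis using s(3,4) by blast
            next
              case False
              then show ?thesis using j unfolding J_def by blast
            qed
          qed
          then have "card (J z) \<le> card ((?D - covered ?\<tau> P) \<union> (\<Union>s\<in>F. ?\<tau> s ` ?b s))"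
            using F(1) by (intro card_mono) auto
          also have "\<dots> \<le> card (?D - covered ?\<tau> P) + card (\<Union>s\<in>F. ?\<tau> s ` ?b s)" by (rule card_Un_le)
          also have "card (\<Union>s\<in>F. ?\<tau> s ` ?b s) \<le> (\<Sum>s\<in>F. card (?\<tau> s ` ?b s))" using F(1) by (rule card_UN_le)
          also have "\<dots> \<le> (\<Sum>s\<in>F. card (?b s))" by (intro sum_mono card_image_le) simp
          finally have "real (card (J z)) \<le> real (card (?D - covered ?\<tau> P)) + (\<Sum>s\<in>F. real (card (?b s)))"
            by (simp flip: of_nat_sum of_nat_add)
          also have "(\<Sum>s\<in>F. real (card (?b s))) \<le> (\<Sum>s\<in>F. (\<delta> / \<gamma>)\<^sup>2 * real (d i))"
            using sofic_orbits_deviation[OF subsetD[OF Z(1) z] F(1) _ \<gamma>] by (intro sum_mono)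
          also have "\<dots> = (real (card F) * (\<delta> / \<gamma>)\<^sup>2) * real (d i)" by simp
          also have "\<dots> = \<mu> / 2 * real (d i)" unfolding \<delta>F ..
          also have "real (card (?D - covered ?\<tau> P)) \<le> \<mu> / 2 * real (d i)"
          proof -
            have "real (card (?D - covered ?\<tau> P)) \<le> \<theta> * real (d i)" using P(3) by simp
            also have "\<dots> \<le> \<mu> / 2 * real (d i)" using \<theta>(4) by (rule mult_right_mono) simp
            finally show ?thesis .
          qed
          finally show ?thesis by simp
        qed
        have gZ: "g ` Z \<subseteq> \<R> \<times> N"
        proof (rule image_subsetI)
          fix z assume z: "z \<in> Z"
          have "(\<lambda>p\<in>P. R (fst (snd p)) (z (fst p))) \<in> \<R>" unfolding \<R>_def using R(1) q(2) by auto
          moreover have "(\<lambda>j\<in>?D. if j \<in> J z then Some (V (z j)) else None) \<in> N"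
          proof -
            have "{j\<in>?D. (\<lambda>j\<in>?D. if j \<in> J z then Some (V (z j)) else None) j \<noteq> None} = J z"
              unfolding J_def by auto
            then show ?thesis unfolding N_def using J_le[OF z] V(1) by auto
          qed
          ultimately show "g z \<in> \<R> \<times> N" unfolding g_def by blast
        qed
        have "inj_on g Z"
        proof (rule inj_onI, rule ccontr)
          fix z z' assume z: "z \<in> Z" "z' \<in> Z" "g z = g z'" "z \<noteq> z'"
          then obtain j where j: "j \<in> ?D" "\<epsilon> \<le> dist (z j) (z' j)" using Z(2) unfolding separated_def by blast
          \<comment> \<open>The set \<open>J z\<close> varies with z, but the code contains it as
            the support of the corrections: at j both points are corrected or both are
            predicted.\<close>
          have "(\<lambda>j\<in>?D. if j \<in> J z then Some (V (z j)) else None) = (\<lambda>j\<in>?D. if j \<in> J z' then Some (V (z' j)) else None)"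
            using z(3) unfolding g_def by (rule Pair_inject)
          from fun_cong[OF this, of j] j(1)
          have Jeq: "(if j \<in> J z then Some (V (z j)) else None) = (if j \<in> J z' then Some (V (z' j)) else None)"
            by simp
          show False
          proof (cases "j \<in> J z")
            case True
            then have "V (z j) = V (z' j)" using Jeq by (auto split: if_splits)
            then have "dist (z j) (z' j) < \<gamma>" using mesh[OF V(1)] V(2) by metis
            then show False using j(2) \<gamma> unfolding \<gamma>_def by simp
          next
            case False
            then have nJ: "j \<notin> J z" "j \<notin> J z'" using Jeq by (auto split: if_splits)
            then have "j \<in> covered ?\<tau> P" using j(1) unfolding J_def by blast
            then obtain c H A s where s: "(c, H, A) \<in> P" "s \<in> A" "j = ?\<tau> s c"
              unfolding covered_def core_def by auto
            have near: "dist (\<alpha> s (z c)) (z j) < \<gamma>" "dist (\<alpha> s (z' c)) (z' j) < \<gamma>"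
              using nJ s j(1) unfolding J_def by force+
            note fH = q(2)[OF s(1)]
            have "(\<lambda>p\<in>P. R (fst (snd p)) (z (fst p))) = (\<lambda>p\<in>P. R (fst (snd p)) (z' (fst p)))"
              using z(3) unfolding g_def by (rule Pair_inject)
            from fun_cong[OF this, of "(c, H, A)"] s(1) have "R H (z c) = R H (z' c)" by simp
            then have mem: "z c \<in> R H (z c)" "z' c \<in> R H (z c)" using R(2)[OF fH] by metis+
            have "R H (z c) \<in> dyn_cover \<alpha> H \<W>" using S(1)[OF fH] R(1)[OF fH] by blast
            then obtain U where U: "\<forall>g\<in>H. U g \<in> \<W>" "R H (z c) = {x. \<forall>g\<in>H. \<alpha> g x \<in> U g}"
              by (rule dyn_coverE)
            have "s \<in> H" using q(5)[OF s(1)] s(2) by blast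
            then have "U s \<in> \<W>" "\<alpha> s (z c) \<in> U s" "\<alpha> s (z' c) \<in> U s" using U(1) mem unfolding U(2) by auto
            then have "dist (\<alpha> s (z c)) (\<alpha> s (z' c)) < \<gamma>" by (rule mesh)
            moreover have "dist (z j) (z' j) \<le> dist (\<alpha> s (z c)) (z j) + dist (\<alpha> s (z c)) (\<alpha> s (z' c)) + dist (\<alpha> s (z' c)) (z' j)"
              by (metis (no_types, opaque_lifting) add.commute add_left_mono dist_commute dist_triangle dist_triangle2 order_trans add_right_mono)
            ultimately show False using near j(2) unfolding \<gamma>_def by linarith
          qed
        qed
        then have "card Z \<le> card (\<R> \<times> N)" using gZ finN fin\<R> by (intro card_inj_on_le) auto
        then have "real (card Z) \<le> real (card \<R>) * real (card N)"
          by (simp add: card_cartesian_product flip: of_nat_mult)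
        also have "\<dots> \<le> exp (real (d i) * (h + \<kappa> / 3)) * exp (real (d i) * (2 * \<kappa> / 3))"
          using card_\<R> card_N by (intro mult_mono) auto
        also have "\<dots> = exp (real (d i) * (ent \<W> + \<kappa>))"
          unfolding h_def by (simp add: algebra_simps flip: exp_add)
        finally show "real (card Z) \<le> exp (real (d i) * (ent \<W> + \<kappa>))" .
      qed
    qed
    then show ?thesis using F(1,2) \<delta> by blast
  qed
  then show ?thesis using that[OF W] by blast
qed

section \<open>The two implications\<close>

lemma eventually_degree_pos: "\<forall>\<^sub>F i in sequentially. 0 < d i"
proof -
  have "filterlim d at_top sequentially" using sofic unfolding sofic_approximation_def by simp
  then have "\<forall>\<^sub>F i in sequentially. Suc 0 \<le> d i" unfolding filterlim_at_top by simp
  then show ?thesis by eventually_elim simp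
qed

lemma sofic_orbits_PiE: "sofic_orbits \<alpha> F \<delta> n \<tau> \<subseteq> {1..n} \<rightarrow>\<^sub>E UNIV"
  unfolding sofic_orbits_def by blast

lemma act_diff_add: "\<alpha> s (x - y + z) = \<alpha> s x - \<alpha> s y + \<alpha> s z"
proof -
  have "\<alpha> s (x - y) + \<alpha> s y = \<alpha> s x" using act_hom[of s "x - y" y] by simp
  then have "\<alpha> s (x - y) = \<alpha> s x - \<alpha> s y" by (simp add: eq_diff_eq)
  then show ?thesis by (simp add: act_hom)
qed

text \<open>As each s acts by a homomorphism, x - y + z can deviate at a coordinate only if x, y or
  z deviates there by at least r. This is where the hypothesis on automorphisms enters.\<close>

lemma sofic_orbits_diff_add:
  assumes F: "finite F" "F \<noteq> {}" and "0 < \<delta>"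
  obtains \<delta>' where "0 < \<delta>'" "\<And>x y z n \<tau>. x \<in> sofic_orbits \<alpha> F \<delta>' n \<tau> \<Longrightarrow> y \<in> sofic_orbits \<alpha> F \<delta>' n \<tau> \<Longrightarrow>
    z \<in> sofic_orbits \<alpha> F \<delta>' n \<tau> \<Longrightarrow> (\<And>s. s \<in> F \<Longrightarrow> \<tau> s permutes {1..n}) \<Longrightarrow>
    (\<lambda>j\<in>{1..n}. x j - y j + z j) \<in> sofic_orbits \<alpha> F \<delta> n \<tau>"
proof -
  obtain r where r: "0 < r" "\<And>x y z x' y' z' :: 'x. dist x x' < r \<Longrightarrow> dist y y' < r \<Longrightarrow> dist z z' < r \<Longrightarrow>
      dist (x - y + z) (x' - y' + z') < \<delta> / 2"
    using uniformly_continuous_diff_add[OF compact half_gt_zero[OF assms(3)]] by blast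
  obtain M where M: "0 < M" "\<And>u v :: 'x. dist u v \<le> M" using compact_dist_bounded[OF compact] by blast
  \<comment> \<open>Each of the three exceptional sets then has density at most (\<delta>/(3M))^2,
    which gives M^2 \<theta> = \<delta>^2/3 in \<open>sofic_orbitsI\<close>.\<close>
  define \<delta>' where "\<delta>' = r * (\<delta> / (3 * M))"
  have pos: "0 < \<delta>'" unfolding \<delta>'_def using r M assms(3) by simp
  have "\<delta>' / r = \<delta> / (3 * M)" unfolding \<delta>'_def using r by simp
  then have "M\<^sup>2 * (3 * (\<delta>' / r)\<^sup>2) = \<delta>\<^sup>2 / 3" using M(1) by (simp add: power_divide power_mult_distrib)
  moreover have "0 \<le> \<delta>\<^sup>2" by simp
  ultimately have \<theta>: "M\<^sup>2 * (3 * (\<delta>' / r)\<^sup>2) \<le> \<delta>\<^sup>2 / 2" by linarith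
  have "(\<lambda>j\<in>{1..n}. x j - y j + z j) \<in> sofic_orbits \<alpha> F \<delta> n \<tau>"
    if mem: "x \<in> sofic_orbits \<alpha> F \<delta>' n \<tau>" "y \<in> sofic_orbits \<alpha> F \<delta>' n \<tau>" "z \<in> sofic_orbits \<alpha> F \<delta>' n \<tau>"
      and perm: "\<And>s. s \<in> F \<Longrightarrow> \<tau> s permutes {1..n}" for x y z n and \<tau> :: "'g \<Rightarrow> nat \<Rightarrow> nat"
  proof (rule sofic_orbitsI[OF _ F assms(3) M(2) \<theta>])
    let ?w = "\<lambda>j\<in>{1..n}. x j - y j + z j"
    show "?w \<in> {1..n} \<rightarrow>\<^sub>E UNIV" by simp
    fix s assume s: "s \<in> F"
    let ?B = "\<lambda>x. {j\<in>{1..n}. r \<le> dist (\<alpha> s (x j)) (x (\<tau> s j))}"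
    have "{j\<in>{1..n}. \<delta> / 2 \<le> dist (\<alpha> s (?w j)) (?w (\<tau> s j))} \<subseteq> ?B x \<union> ?B y \<union> ?B z"
    proof (rule subsetI, rule ccontr)
      fix j assume j: "j \<in> {j\<in>{1..n}. \<delta> / 2 \<le> dist (\<alpha> s (?w j)) (?w (\<tau> s j))}" "j \<notin> ?B x \<union> ?B y \<union> ?B z"
      then have jn: "j \<in> {1..n}" by blast
      \<comment> \<open>Outside {1..n} the restricted function would not be given by the
        formula.\<close>
      moreover have "\<tau> s j \<in> {1..n}" using permutes_in_image[OF perm[OF s]] jn by blast
      ultimately have "dist (\<alpha> s (?w j)) (?w (\<tau> s j)) < \<delta> / 2"
        using r(2)[of "\<alpha> s (x j)" "x (\<tau> s j)" "\<alpha> s (y j)" "y (\<tau> s j)" "\<alpha> s (z j)" "z (\<tau> s j)"] j(2)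
        by (simp add: act_diff_add)
      moreover have "\<delta> / 2 \<le> dist (\<alpha> s (?w j)) (?w (\<tau> s j))" using j(1) by blast
      ultimately show False by linarith
    qed
    then have "card {j\<in>{1..n}. \<delta> / 2 \<le> dist (\<alpha> s (?w j)) (?w (\<tau> s j))} \<le> card (?B x \<union> ?B y \<union> ?B z)"
      by (intro card_mono) auto
    also have "\<dots> \<le> card (?B x \<union> ?B y) + card (?B z)" by (rule card_Un_le)
    also have "card (?B x \<union> ?B y) \<le> card (?B x) + card (?B y)" by (rule card_Un_le)
    finally have "real (card {j\<in>{1..n}. \<delta> / 2 \<le> dist (\<alpha> s (?w j)) (?w (\<tau> s j))}) \<le>
        real (card (?B x)) + real (card (?B y)) + real (card (?B z))"
      by (simp flip: of_nat_add)
    also have "\<dots> \<le> (\<delta>' / r)\<^sup>2 * real n + (\<delta>' / r)\<^sup>2 * real n + (\<delta>' / r)\<^sup>2 * real n"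
      using mem by (intro add_mono sofic_orbits_deviation[OF _ F(1) s r(1)])
    also have "\<dots> = 3 * (\<delta>' / r)\<^sup>2 * real n" by simp
    finally show "real (card {j\<in>{1..n}. \<delta> / 2 \<le> dist (\<alpha> s (?w j)) (?w (\<tau> s j))}) \<le>
        3 * (\<delta>' / r)\<^sup>2 * real n" .
  qed
  then show ?thesis using that[OF pos] by blast
qed

text \<open>Inside a cell there are at most exp(d(H + \<kappa>/4)) / exp(d(H - \<kappa>/2)) finely
  separated orbits, which is below exp(d\<kappa>). The scale \<open>\<epsilon>\<^sub>2\<close> and
  the cover \<open>\<U>\<^sub>2\<close> come from \<open>\<W>\<^sub>2\<close> alone and precede
  \<open>\<U>\<^sub>1\<close>; the latter influences \<open>F\<close>, the tolerances and the scale
  of the upper count.\<close>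

lemma tail_entropy_le:
  assumes H: "\<And>\<W>. \<W> \<in> open_covers \<Longrightarrow> ent \<W> \<le> H"
    and sup: "\<And>\<eta>. 0 < \<eta> \<Longrightarrow> \<exists>\<W>\<in>open_covers. H - \<eta> < ent \<W>"
    and \<kappa>: "0 < \<kappa>"
  shows "tail_entropy d \<sigma> \<alpha> \<le> ereal \<kappa>"
proof -
  have perm: "\<sigma> i g permutes {1..d i}" for i g using sofic unfolding sofic_approximation_def by blast
  obtain \<W>\<^sub>2 where W2: "\<W>\<^sub>2 \<in> open_covers" "H - \<kappa> / 4 < ent \<W>\<^sub>2" using sup[of "\<kappa> / 4"] \<kappa> by auto
  obtain \<epsilon>\<^sub>2 where \<epsilon>2: "0 < \<epsilon>\<^sub>2" and lower: "\<And>\<kappa> F \<delta>. 0 < \<kappa> \<Longrightarrow> finite F \<Longrightarrow> F \<noteq> {} \<Longrightarrow> 0 < \<delta> \<Longrightarrow>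
      \<forall>\<^sub>F i in sequentially. \<exists>Z\<subseteq>sofic_orbits \<alpha> F \<delta> (d i) (\<sigma> i). finite Z \<and>
        separated {1..d i} \<epsilon>\<^sub>2 (\<lambda>z. z) Z \<and> exp (real (d i) * (ent \<W>\<^sub>2 - \<kappa>)) \<le> real (card Z)"
    using sofic_lower[OF W2(1)] by blast
  have \<epsilon>23: "0 < \<epsilon>\<^sub>2 / 3" using \<epsilon>2 by simp
  obtain r2 where r2: "0 < r2" "\<And>x y z x' y' z' :: 'x. dist x x' < r2 \<Longrightarrow> dist y y' < r2 \<Longrightarrow> dist z z' < r2 \<Longrightarrow>
      dist (x - y + z) (x' - y' + z') < \<epsilon>\<^sub>2 / 3"
    using uniformly_continuous_diff_add[OF compact \<epsilon>23] by blast
  obtain \<U>\<^sub>2 :: "'x set set" where U2: "\<U>\<^sub>2 \<in> open_covers"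
    and mesh: "\<And>U x y. U \<in> \<U>\<^sub>2 \<Longrightarrow> x \<in> U \<Longrightarrow> y \<in> U \<Longrightarrow> dist x y < r2"
    using fine_open_cover[OF compact r2(1)] by blast
  have finU2: "finite \<U>\<^sub>2" "\<Union>\<U>\<^sub>2 = UNIV" using U2 unfolding open_covers_def by auto
  have "cond_entropy_cover d \<sigma> \<alpha> \<U>\<^sub>1 \<U>\<^sub>2 \<le> ereal \<kappa>" if U1: "\<U>\<^sub>1 \<in> open_covers" for \<U>\<^sub>1
  proof -
    obtain \<epsilon>\<^sub>1 where \<epsilon>1: "0 < \<epsilon>\<^sub>1" "\<And>x :: 'x. \<exists>U\<in>\<U>\<^sub>1. ball x \<epsilon>\<^sub>1 \<subseteq> U"
      using lebesgue_number[OF compact U1] by blast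
    obtain r1 where r1: "0 < r1" "\<And>x y z x' y' z' :: 'x. dist x x' < r1 \<Longrightarrow> dist y y' < r1 \<Longrightarrow> dist z z' < r1 \<Longrightarrow>
        dist (x - y + z) (x' - y' + z') < \<epsilon>\<^sub>1"
      using uniformly_continuous_diff_add[OF compact \<epsilon>1(1)] by blast
    \<comment> \<open>A separation valid in both cases: pairs with different z are seen at
      \<open>\<epsilon>\<^sub>2 / 3\<close>, those with equal z and different x at
      \<open>r1\<close>.\<close>
    define \<epsilon> where "\<epsilon> = min r1 (\<epsilon>\<^sub>2 / 3)"
    have \<epsilon>: "0 < \<epsilon>" "\<epsilon> \<le> r1" "\<epsilon> \<le> \<epsilon>\<^sub>2 / 3" unfolding \<epsilon>_def using r1(1) \<epsilon>2 by auto
    obtain \<W>\<^sub>1 where W1: "\<W>\<^sub>1 \<in> open_covers" and upper: "\<And>\<kappa>. 0 < \<kappa> \<Longrightarrow> \<exists>F \<delta>. finite F \<and> F \<noteq> {} \<and> 0 < \<delta> \<and>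
        (\<forall>\<^sub>F i in sequentially. \<forall>Z\<subseteq>sofic_orbits \<alpha> F \<delta> (d i) (\<sigma> i). separated {1..d i} \<epsilon> (\<lambda>z. z) Z \<longrightarrow>
          real (card Z) \<le> exp (real (d i) * (ent \<W>\<^sub>1 + \<kappa>)))"
      using sofic_upper[OF \<epsilon>(1)] by blast
    have \<kappa>4: "0 < \<kappa> / 4" using \<kappa> by simp
    obtain F \<delta> where F: "finite F" "F \<noteq> {}" and \<delta>: "0 < \<delta>"
      and up: "\<forall>\<^sub>F i in sequentially. \<forall>Z\<subseteq>sofic_orbits \<alpha> F \<delta> (d i) (\<sigma> i). separated {1..d i} \<epsilon> (\<lambda>z. z) Z \<longrightarrow>
          real (card Z) \<le> exp (real (d i) * (ent \<W>\<^sub>1 + \<kappa> / 4))"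
      using upper[OF \<kappa>4] by blast
    obtain \<delta>' where \<delta>': "0 < \<delta>'" and comb: "\<And>x y z n \<tau>. x \<in> sofic_orbits \<alpha> F \<delta>' n \<tau> \<Longrightarrow> y \<in> sofic_orbits \<alpha> F \<delta>' n \<tau> \<Longrightarrow>
        z \<in> sofic_orbits \<alpha> F \<delta>' n \<tau> \<Longrightarrow> (\<And>s. s \<in> F \<Longrightarrow> \<tau> s permutes {1..n}) \<Longrightarrow>
        (\<lambda>j\<in>{1..n}. x j - y j + z j) \<in> sofic_orbits \<alpha> F \<delta> n \<tau>"
      using sofic_orbits_diff_add[OF F \<delta>] by blast
    let ?m = "\<lambda>i. MAX V\<in>power_cover (d i) \<U>\<^sub>2.
      cov_num (power_cover (d i) \<U>\<^sub>1) (sofic_orbits \<alpha> F \<delta>' (d i) (\<sigma> i) \<inter> V)"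
    have "\<forall>\<^sub>F i in sequentially. ereal (1 / real (d i)) * log_nat (?m i) \<le> ereal \<kappa>"
      using up lower[OF \<kappa>4 F \<delta>'] eventually_degree_pos
    proof eventually_elim
      case (elim i)
      let ?D = "{1..d i}" let ?X = "sofic_orbits \<alpha> F \<delta>' (d i) (\<sigma> i)"
      obtain Z2 where Z2: "Z2 \<subseteq> ?X" "finite Z2" "separated ?D \<epsilon>\<^sub>2 (\<lambda>z. z) Z2"
        "exp (real (d i) * (ent \<W>\<^sub>2 - \<kappa> / 4)) \<le> real (card Z2)" using elim(2) by blast
      have each: "real (cov_num (power_cover (d i) \<U>\<^sub>1) (?X \<inter> V)) \<le> exp (real (d i) * \<kappa>)"
        if V: "V \<in> power_cover (d i) \<U>\<^sub>2" for V
      proof (cases "?X \<inter> V = {}")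
        case True
        have "cov_num (power_cover (d i) \<U>\<^sub>1) (?X \<inter> V) \<le> card ({} :: (nat \<Rightarrow> 'x) set set)"
          unfolding True by (rule cov_num_le) auto
        then show ?thesis by simp
      next
        case False
        \<comment> \<open>The base point must itself be a sofic orbit, so that x - y + z is one too;
          a cell without such a point has covering number 0.\<close>
        then obtain y where y: "y \<in> ?X" "y \<in> V" by blast
        obtain U where U: "\<forall>j\<in>?D. U j \<in> \<U>\<^sub>2" "V = Pi\<^sub>E ?D U" using V unfolding power_cover_def by blast
        have close: "dist (x j) (y j) < r2" if "x \<in> V" "j \<in> ?D" for x j
          using that y(2) U(1) unfolding U(2) by (intro mesh[of "U j"] PiE_mem[of _ ?D U]) auto
        have finD: "finite ?D" by simp
        obtain Z1 where Z1: "Z1 \<subseteq> ?X \<inter> V" "finite Z1" "separated ?D \<epsilon>\<^sub>1 (\<lambda>z. z) Z1"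
          "\<And>x. x \<in> ?X \<inter> V \<Longrightarrow> \<exists>z\<in>Z1. \<forall>j\<in>?D. dist (x j) (z j) < \<epsilon>\<^sub>1"
          using maximal_separated[OF compact \<epsilon>1(1) finD, of "?X \<inter> V" "\<lambda>z. z"] by blast
        define f where "f = (\<lambda>(x, z). \<lambda>j\<in>?D. x j - y j + z j)"
        have f: "f p j = fst p j - y j + snd p j" if "j \<in> ?D" for p j
          using that unfolding f_def by (simp add: case_prod_unfold)
        have sep: "\<exists>j\<in>?D. \<epsilon> \<le> dist (f p j) (f p' j)"
          if p: "p \<in> Z1 \<times> Z2" "p' \<in> Z1 \<times> Z2" "p \<noteq> p'" for p p'
        proof (cases "snd p = snd p'")
          case False
          then obtain j where j: "j \<in> ?D" "\<epsilon>\<^sub>2 \<le> dist (snd p j) (snd p' j)"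
            using Z2(3) p unfolding separated_def by fastforce
          \<comment> \<open>x and y lie in the same small cell, so x - y + z is close to y - y + z =
            z.\<close>
          have "dist (f q j) (snd q j) < \<epsilon>\<^sub>2 / 3" if "q \<in> Z1 \<times> Z2" for q
          proof -
            have "fst q \<in> V" using that Z1(1) by auto
            then show ?thesis
              using r2(2)[of "fst q j" "y j" "y j" "y j" "snd q j" "snd q j"] close j(1) r2(1) f[OF j(1)] by simp
          qed
          from this[OF p(1)] this[OF p(2)]
          have "dist (snd p j) (snd p' j) < \<epsilon>\<^sub>2 / 3 + dist (f p j) (f p' j) + \<epsilon>\<^sub>2 / 3"
            using dist_triangle[of "snd p j" "snd p' j" "f p j"] dist_triangle[of "f p j" "snd p' j" "f p' j"]
            by (simp add: dist_commute)
          then have "\<epsilon> \<le> dist (f p j) (f p' j)" using j(2) \<epsilon>(3) by linarith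
          then show ?thesis using j(1) by blast
        next
          case True
          then have "fst p \<noteq> fst p'" using p(3) by (simp add: prod_eq_iff)
          then obtain j where j: "j \<in> ?D" "\<epsilon>\<^sub>1 \<le> dist (fst p j) (fst p' j)"
            using Z1(3) p unfolding separated_def by fastforce
          have "\<epsilon> \<le> dist (f p j) (f p' j)"
          proof (rule ccontr)
            assume "\<not> \<epsilon> \<le> dist (f p j) (f p' j)"
            then have "dist (f p j) (f p' j) < r1" using \<epsilon>(2) by simp
            \<comment> \<open>Undoing the combination: with z in common, close images would come
              from close x.\<close>
            then have "dist (f p j - snd p j + y j) (f p' j - snd p j + y j) < \<epsilon>\<^sub>1"
              using r1 by simp
            then show False using j True f[OF j(1)] by (simp add: add_diff_eq[symmetric])
          qed
          then show ?thesis using j(1) by blast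
        qed
        have inj: "inj_on f (Z1 \<times> Z2)"
        proof (rule inj_onI, rule ccontr)
          fix p p' assume "p \<in> Z1 \<times> Z2" "p' \<in> Z1 \<times> Z2" "f p = f p'" "p \<noteq> p'"
          with sep[OF this(1,2,4)] \<epsilon>(1) show False by auto
        qed
        have "separated ?D \<epsilon> (\<lambda>z. z) (f ` (Z1 \<times> Z2))" unfolding separated_def
        proof (intro ballI impI)
          fix w w' assume "w \<in> f ` (Z1 \<times> Z2)" "w' \<in> f ` (Z1 \<times> Z2)" "w \<noteq> w'"
          then obtain p p' where "p \<in> Z1 \<times> Z2" "p' \<in> Z1 \<times> Z2" "w = f p" "w' = f p'" "p \<noteq> p'" by blast
          then show "\<exists>j\<in>?D. \<epsilon> \<le> dist (w j) (w' j)" using sep by blast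
        qed
        moreover have "f ` (Z1 \<times> Z2) \<subseteq> sofic_orbits \<alpha> F \<delta> (d i) (\<sigma> i)"
        proof (rule image_subsetI)
          fix p assume "p \<in> Z1 \<times> Z2"
          then have "fst p \<in> ?X" "snd p \<in> ?X" using Z1(1) Z2(1) by auto
          from comb[OF this(1) y(1) this(2) perm]
          show "f p \<in> sofic_orbits \<alpha> F \<delta> (d i) (\<sigma> i)" unfolding f_def case_prod_unfold .
        qed
        ultimately have "real (card (f ` (Z1 \<times> Z2))) \<le> exp (real (d i) * (ent \<W>\<^sub>1 + \<kappa> / 4))"
          using elim(1) by blast
        then have "real (card Z1) * real (card Z2) \<le> exp (real (d i) * (ent \<W>\<^sub>1 + \<kappa> / 4))"
          using card_image[OF inj] by (simp add: card_cartesian_product)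
        also have "\<dots> \<le> exp (real (d i) * (H + \<kappa> / 4))"
          using H[OF W1] by (subst exp_le_cancel_iff, intro mult_left_mono) auto
        finally have prod: "real (card Z1) * real (card Z2) \<le> exp (real (d i) * (H + \<kappa> / 4))" .
        have "real (card Z1) * exp (real (d i) * (H - \<kappa> / 2)) \<le> real (card Z1) * real (card Z2)"
        proof (rule mult_left_mono)
          have "exp (real (d i) * (H - \<kappa> / 2)) \<le> exp (real (d i) * (ent \<W>\<^sub>2 - \<kappa> / 4))"
            using W2(2) by (subst exp_le_cancel_iff, intro mult_left_mono) auto
          then show "exp (real (d i) * (H - \<kappa> / 2)) \<le> real (card Z2)" using Z2(4) by linarith
        qed simp
        also note prod
        also have "exp (real (d i) * (H + \<kappa> / 4)) \<le> exp (real (d i) * \<kappa> + real (d i) * (H - \<kappa> / 2))"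
          unfolding exp_le_cancel_iff distrib_left[symmetric] using \<kappa> by (intro mult_left_mono) auto
        finally have "real (card Z1) \<le> exp (real (d i) * \<kappa>)" by (simp add: exp_add)
        moreover have "cov_num (power_cover (d i) \<U>\<^sub>1) (?X \<inter> V) \<le> card Z1"
          by (rule cov_num_power_le_card[OF \<epsilon>1(2) le_infI1[OF sofic_orbits_PiE] Z1(2,4)])
        ultimately show ?thesis by (meson of_nat_le_iff order_trans)
      qed
      have "{1..d i} \<rightarrow>\<^sub>E (UNIV :: 'x set) \<noteq> {}" by (simp add: PiE_eq_empty_iff)
      then have "power_cover (d i) \<U>\<^sub>2 \<noteq> {}" using Union_power_cover[OF finU2(2), of "d i"] by auto
      then have "?m i \<in> (\<lambda>V. cov_num (power_cover (d i) \<U>\<^sub>1) (?X \<inter> V)) ` power_cover (d i) \<U>\<^sub>2"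
        using finite_power_cover(1)[OF finU2(1)] by (intro Max_in) auto
      then have "real (?m i) \<le> exp (real (d i) * \<kappa>)" using each by (metis (no_types, lifting) imageE)
      then have "log_nat (?m i) \<le> ereal (real (d i) * \<kappa>)" by (rule log_nat_le)
      then have "ereal (1 / real (d i)) * log_nat (?m i) \<le> ereal (1 / real (d i)) * ereal (real (d i) * \<kappa>)"
        by (rule ereal_mult_left_mono) simp
      also have "\<dots> = ereal \<kappa>" using elim(3) by simp
      finally show ?case .
    qed
    then have "limsup (\<lambda>i. ereal (1 / real (d i)) * log_nat (?m i)) \<le> ereal \<kappa>" by (rule Limsup_bounded)
    then show ?thesis
      unfolding cond_entropy_cover_def using F \<delta>'
      by (intro INF_lower2[of F] INF_lower2[of \<delta>']) auto
  qed
  then have "cond_entropy d \<sigma> \<alpha> \<U>\<^sub>2 \<le> ereal \<kappa>" unfolding cond_entropy_def by (rule SUP_least)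
  then show ?thesis unfolding tail_entropy_def using U2 by (intro INF_lower2[of \<U>\<^sub>2])
qed

text \<open>The bound depends on \<open>\<U>\<^sub>2\<close> only. A separated set for any
  \<open>\<W>\<close> is cut into at most |\<open>\<U>\<^sub>2\<close>|^d cells, each with at most
  exp(d) of its points. Of the 2 that is added to the logarithm, one unit is this growth within
  cells, the other the loss \<kappa> = 1 in \<open>sofic_lower\<close>.\<close>

lemma ent_bounded:
  assumes "tail_entropy d \<sigma> \<alpha> < 1"
  shows "\<exists>B. \<forall>\<W>\<in>open_covers. ent \<W> \<le> B"
proof -
  obtain \<U>\<^sub>2 where U2: "\<U>\<^sub>2 \<in> open_covers" "cond_entropy d \<sigma> \<alpha> \<U>\<^sub>2 < 1"
    using assms unfolding tail_entropy_def INF_less_iff by blast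
  have finU2: "finite \<U>\<^sub>2" "\<Union>\<U>\<^sub>2 = UNIV" using U2(1) unfolding open_covers_def by auto
  have "\<U>\<^sub>2 \<noteq> {}" using finU2(2) by auto
  then have cU2: "0 < real (card \<U>\<^sub>2)" using finU2(1) by (simp add: card_gt_0_iff)
  have "ent \<W> \<le> ln (real (card \<U>\<^sub>2)) + 2" if W: "\<W> \<in> open_covers" for \<W>
  proof -
    obtain \<epsilon> where \<epsilon>: "0 < \<epsilon>" and lower: "\<And>\<kappa> F \<delta>. 0 < \<kappa> \<Longrightarrow> finite F \<Longrightarrow> F \<noteq> {} \<Longrightarrow> 0 < \<delta> \<Longrightarrow>
        \<forall>\<^sub>F i in sequentially. \<exists>Z\<subseteq>sofic_orbits \<alpha> F \<delta> (d i) (\<sigma> i). finite Z \<and>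
          separated {1..d i} \<epsilon> (\<lambda>z. z) Z \<and> exp (real (d i) * (ent \<W> - \<kappa>)) \<le> real (card Z)"
      using sofic_lower[OF W] by blast
    obtain \<U>\<^sub>1 :: "'x set set" where U1: "\<U>\<^sub>1 \<in> open_covers"
      and mesh: "\<And>U x y. U \<in> \<U>\<^sub>1 \<Longrightarrow> x \<in> U \<Longrightarrow> y \<in> U \<Longrightarrow> dist x y < \<epsilon>"
      using fine_open_cover[OF compact \<epsilon>] by blast
    have finU1: "finite \<U>\<^sub>1" "\<Union>\<U>\<^sub>1 = UNIV" using U1 unfolding open_covers_def by auto
    have "cond_entropy_cover d \<sigma> \<alpha> \<U>\<^sub>1 \<U>\<^sub>2 \<le> cond_entropy d \<sigma> \<alpha> \<U>\<^sub>2"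
      unfolding cond_entropy_def using U1 by (rule SUP_upper)
    also note U2(2)
    finally obtain F \<delta> where F: "finite F" "F \<noteq> {}" and \<delta>: "0 < \<delta>"
      and lim: "limsup (\<lambda>i. ereal (1 / real (d i)) * log_nat (MAX V\<in>power_cover (d i) \<U>\<^sub>2.
        cov_num (power_cover (d i) \<U>\<^sub>1) (sofic_orbits \<alpha> F \<delta> (d i) (\<sigma> i) \<inter> V))) < 1"
      unfolding cond_entropy_cover_def INF_less_iff by auto
    \<comment> \<open>The inequality does not involve i, so a single late index proves it.\<close>
    have "\<forall>\<^sub>F i in sequentially. ent \<W> \<le> ln (real (card \<U>\<^sub>2)) + 2"
      using Limsup_lessD[OF lim] lower[OF zero_less_one F \<delta>] eventually_degree_pos
    proof eventually_elim
      case (elim i)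
      let ?D = "{1..d i}" let ?X = "sofic_orbits \<alpha> F \<delta> (d i) (\<sigma> i)"
      let ?c = "\<lambda>V. cov_num (power_cover (d i) \<U>\<^sub>1) (?X \<inter> V)"
      obtain Z where Z: "Z \<subseteq> ?X" "finite Z" "separated ?D \<epsilon> (\<lambda>z. z) Z"
        "exp (real (d i) * (ent \<W> - 1)) \<le> real (card Z)" using elim(2) by blast
      note finP = finite_power_cover[OF finU2(1), of "d i"]
      define m where "m = Max (?c ` power_cover (d i) \<U>\<^sub>2)"
      have m: "real m \<le> exp (real (d i))"
      proof (cases "m = 0")
        case False
        then have "ereal (1 / real (d i) * ln (real m)) < ereal 1"
          using elim(1) unfolding m_def[symmetric] log_nat_def by (simp add: one_ereal_def)
        then have "ln (real m) < real (d i)" using elim(3) by (simp add: divide_less_eq)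
        then have "exp (ln (real m)) < exp (real (d i))" by (rule exp_less_mono)
        then show ?thesis using False by simp
      qed simp
      have "card (Z \<inter> V) \<le> m" if V: "V \<in> power_cover (d i) \<U>\<^sub>2" for V
      proof -
        have "card (Z \<inter> V) \<le> ?c V"
        proof (rule card_le_cov_num_power[OF finU1 mesh])
          show "?X \<inter> V \<subseteq> ?D \<rightarrow>\<^sub>E UNIV" using sofic_orbits_PiE by blast
          show "Z \<inter> V \<subseteq> ?X \<inter> V" using Z(1) by blast
          show "separated ?D \<epsilon> (\<lambda>z. z) (Z \<inter> V)" using Z(3) unfolding separated_def by blast
        qed
        also have "\<dots> \<le> m" unfolding m_def using finP(1) V by (intro Max_ge) auto
        finally show ?thesis .
      qed
      then have sum_le: "(\<Sum>V\<in>power_cover (d i) \<U>\<^sub>2. card (Z \<inter> V)) \<le> card (power_cover (d i) \<U>\<^sub>2) * m"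
        using sum_bounded_above[of "power_cover (d i) \<U>\<^sub>2" "\<lambda>V. card (Z \<inter> V)" m] by simp
      have "Z \<subseteq> \<Union>(power_cover (d i) \<U>\<^sub>2)"
        using Z(1) sofic_orbits_PiE[of F \<delta> "d i" "\<sigma> i"] Union_power_cover[OF finU2(2), of "d i"] by (meson order_trans)
      then have "Z = (\<Union>V\<in>power_cover (d i) \<U>\<^sub>2. Z \<inter> V)" by blast
      then have "card Z \<le> (\<Sum>V\<in>power_cover (d i) \<U>\<^sub>2. card (Z \<inter> V))"
        using card_UN_le[OF finP(1), of "\<lambda>V. Z \<inter> V"] by simp
      also note sum_le
      also have "card (power_cover (d i) \<U>\<^sub>2) * m \<le> card \<U>\<^sub>2 ^ d i * m" using finP(2) by (rule mult_right_mono) simp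
      finally have "real (card Z) \<le> real (card \<U>\<^sub>2 ^ d i * m)" by (simp only: of_nat_le_iff)
      also have "\<dots> = real (card \<U>\<^sub>2) ^ d i * real m" by simp
      also have "\<dots> \<le> real (card \<U>\<^sub>2) ^ d i * exp (real (d i))" using m by (rule mult_left_mono) simp
      also have "real (card \<U>\<^sub>2) ^ d i = exp (real (d i) * ln (real (card \<U>\<^sub>2)))"
        using cU2 by (simp add: exp_of_nat_mult)
      finally have "exp (real (d i) * (ent \<W> - 1)) \<le> exp (real (d i) * (ln (real (card \<U>\<^sub>2)) + 1))"
        using Z(4) by (simp add: distrib_left exp_add)
      then have "ent \<W> - 1 \<le> ln (real (card \<U>\<^sub>2)) + 1" using elim(3) by simp
      then show ?case by simp
    qed
    then show ?thesis by simp
  qed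
  then show ?thesis by blast
qed

lemma asymptotically_h_expansive_iff: "asymptotically_h_expansive d \<sigma> \<alpha> \<longleftrightarrow> amenable_entropy \<alpha> < \<infinity>"
proof
  assume "asymptotically_h_expansive d \<sigma> \<alpha>"
  then have "tail_entropy d \<sigma> \<alpha> < 1"
    unfolding asymptotically_h_expansive_def by (rule le_less_trans) simp
  then obtain B where "\<forall>\<W>\<in>open_covers. ent \<W> \<le> B" using ent_bounded by blast
  then have "amenable_entropy \<alpha> \<le> ereal B"
    unfolding amenable_entropy_def by (intro SUP_least) (simp add: amenable_entropy_cover)
  then show "amenable_entropy \<alpha> < \<infinity>" by (rule le_less_trans) simp
next
  assume fin: "amenable_entropy \<alpha> < \<infinity>"
  have le: "ereal (ent \<W>) \<le> amenable_entropy \<alpha>" if "\<W> \<in> open_covers" for \<W>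
    using that unfolding amenable_entropy_def amenable_entropy_cover[OF that, symmetric] by (rule SUP_upper)
  \<comment> \<open>Some cover must exist for the supremum to exceed -\<infinity>, so that the
    entropy is a real number.\<close>
  have "{UNIV} \<in> (open_covers :: 'x set set set)" unfolding open_covers_def by simp
  from le[OF this] fin obtain H where H: "amenable_entropy \<alpha> = ereal H"
    by (cases "amenable_entropy \<alpha>") auto
  have "tail_entropy d \<sigma> \<alpha> \<le> ereal \<kappa>" if "0 < \<kappa>" for \<kappa>
  proof (rule tail_entropy_le[OF _ _ that])
    show "ent \<W> \<le> H" if "\<W> \<in> open_covers" for \<W> using le[OF that] unfolding H by simp
    show "\<exists>\<W>\<in>open_covers. H - \<eta> < ent \<W>" if "0 < \<eta>" for \<eta>
    proof -
      have "ereal (H - \<eta>) < amenable_entropy \<alpha>" unfolding H using that by simp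
      then obtain \<W> where "\<W> \<in> open_covers" "ereal (H - \<eta>) < amenable_entropy_cover \<alpha> \<W>"
        unfolding amenable_entropy_def less_SUP_iff by blast
      then show ?thesis using amenable_entropy_cover by (intro bexI[of _ \<W>]) auto
    qed
  qed
  then show "asymptotically_h_expansive d \<sigma> \<alpha>"
    unfolding asymptotically_h_expansive_def using ereal_le_epsilon2[of "tail_entropy d \<sigma> \<alpha>" 0] by simp
qed

end

theorem theorem7p1:
  fixes \<alpha> :: "'g::group_add \<Rightarrow> 'x::{metric_space, topological_group_add} \<Rightarrow> 'x"
    and d :: "nat \<Rightarrow> nat"
    and \<sigma> :: "nat \<Rightarrow> 'g \<Rightarrow> nat \<Rightarrow> nat"
  assumes "countable (UNIV :: 'g set)"
    and "amenable TYPE('g)"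
    and "sofic_approximation d \<sigma>"
    and "compact (UNIV :: 'x set)"
    and "acts_by_continuous_automorphisms \<alpha>"
  shows "asymptotically_h_expansive d \<sigma> \<alpha> \<longleftrightarrow> amenable_entropy \<alpha> < \<infinity>"
proof -
  interpret sofic_system \<alpha> d \<sigma> using assms(2-5) by unfold_locales
  show ?thesis by (rule asymptotically_h_expansive_iff)
qed

end
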